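(* Let $(\check X,\check\omega,\check\Omega)=(N,\check\omega,\check\Omega)$ be the completely solvable Nakamura manifold with its balanced metric $\check\omega$ and holomorphic volume form $\check\Omega=i\varphi^0\wedge\varphi^1\wedge\varphi^2$, and let $(X,\omega,\Omega)=(M,\omega,\Omega)$, where $M=\Gamma_S\backslash(\mathbb C\ltimes_\rho\mathbb C^2)$ with $S=\begin{pmatrix}0&1\\1&0\end{pmatrix}$, $\omega$ is its symplectic form and $\Omega$ is the Fourier-Mukai transform of $e^{2\check\omega}$. Then $(\check X,\check\omega,\check\Omega)$ and $(X,\omega,\Omega)$ form a semi-flat mirror pair.
   Context: The manifold $N$. Let $\lambda\in\mathbb R\setminus\{0\}$, $M_0\in SL(2,\mathbb Z)$ and $P\in GL(2,\mathbb R)$ with $PM_0P^{-1}=\mathrm{diag}(e^{\lambda},e^{-\lambda})$, and $\tau\in\mathbb R\setminus\{0\}$. $\mathbb C\ltimes_\rho\mathbb C^2$ has coordinates $(w,z_1,z_2)$, $w=x+iy$, $z_k=x_k+iy_k$, and product $(w',z_1',z_2')*(w,z_1,z_2)=(w'+w,e^{\lambda\mathrm{Re}\,w'}z_1+z_1',e^{-\lambda\mathrm{Re}\,w'}z_2+z_2')$. $N=\Gamma\backslash(\mathbb C\ltimes_\rho\mathbb C^2)$ with $\Gamma=(\mathbb Z\oplus i\tau\mathbb Z)\ltimes_\rho(P\mathbb Z^2\oplus iP\mathbb Z^2)$; $\varphi^0=dw$, $\varphi^1=e^{-\lambda x}dz_1$, $\varphi^2=e^{\lambda x}dz_2$; $\check\omega=\frac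 i2\sum_k\varphi^k\wedge\bar\varphi^k$. Base and fibration. $B=(\mathbb Z\ltimes P\mathbb Z^2)\backslash\mathbb R^3$ with affine coordinates $(r_0,r_1,r_2)$, where $(a,b_1,b_2)$ acts by $(r_0,r_1,r_2)\mapsto(r_0+a,\,e^{\lambda a}r_1+p_{11}b_1+p_{12}b_2,\,e^{-\lambda a}r_2+p_{21}b_1+p_{22}b_2)$. The special Lagrangian torus fibration $N\to B$ is $[x,x_1,x_2,y,y_1,y_2]\mapsto(x,y_1,y_2)=(r_0,r_1,r_2)$; via fiber coordinates $\check\theta_0=-y$, $\check\theta_1=x_1$, $\check\theta_2=x_2$, $N$ is identified with $TB/\Lambda$, $\Lambda=\tau\mathbb Z\oplus P\mathbb Z^2$, with holomorphic coordinates $\check\theta_j+ir_j$, and $\check\Omega=\bigwedge_{j=0}^2(d\check\theta_j+i\,dr_j)$. The dual lattice is $\Lambda^*=\tau^{-1}\mathbb Z\oplus(P^{-1})^T\mathbb Z^2$ with dual fiber coordinates $\theta_j$ on $T^*B/\Lambda^*$, which carries the canonical symplectic form $\sum_{j=0}^2d\theta_j\wedge dr_j$. The manifold $M$. $\Gamma_S=(\mathbb Z\oplus i\tau^{-1}\mathbb Z)\ltimes_\rho(P\mathbb Z^2\oplus iSP^{-T}\mathbb Z^2)$, $P^{-T}=(P^{-1})^T$, and $\omega=dx\wedge dy+dx_2\wedge dy_1+dx_1\wedge dy_2$. $(M,\omega)$ is identified by a symplectomorphism with $(T^*B/\Lambda^*,\sum_jd\theta_j\wedge dr_j)$, and $\Omega$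 is regarded as a form on $M$ through this identification. Fourier-Mukai transform. For a form $\check\alpha$ on $TB/\Lambda$ with coefficients depending only on $B$, $\mathrm{FT}(\check\alpha)=\check\pi_*\big(\pi^*(\mathcal P\cdot\check\alpha)\wedge e^{\sum_jd\check\theta_j\wedge d\theta_j}\big)$, where $\pi,\check\pi$ are the projections of the fiber product $(TB/\Lambda)\times_B(T^*B/\Lambda^* )$ to $TB/\Lambda$, $T^*B/\Lambda^*$, $\check\pi_*$ is integration along the fibers, and $\mathcal P$ is the polarization switch operator, which replaces $d\check\theta_j+i\,dr_j$ by $d\check\theta_j$ and $d\check\theta_j-i\,dr_j$ by $dr_j$ (so $\mathcal P\cdot e^{2\check\omega}=e^{i\check\omega}$). Semi-flat mirror pair. $(X,\omega)$ is a symplectic manifold with a Lagrangian torus bundle $X\to B$, locally symplectomorphic to $(T^*U/\Lambda^*,\sum d\theta_j\wedge dr_j)$ in action-angle coordinates; $\check X\to B$ is the dual torus bundle, locally biholomorphic to $TU/\Lambda$ with its canonical complex structure with holomorphic coordinates $\check\theta_j+ir_j$, and with holomorphic volume form $\check\Omega=\bigwedge_j(d\check\theta_j+i\,dr_j)$. Then $(X,\omega)$ and $(\check X,\check\Omega)$ are said to form a semi-flat mirror pair; for the triples, $\Omega$ is the Fourier-Mukai transform of $e^{2\check\omega}$. *)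

theory Defs
  imports "HOL-Analysis.Analysis" "HOL-Library.Function_Algebras"
begin

section \<open>Smooth manifolds\<close>

text \<open>\<open>smooth_on\<close> is only used on open sets.\<close>

primrec Ck_on :: "nat \<Rightarrow> 'e::real_normed_vector set \<Rightarrow> ('e \<Rightarrow> 'f::real_normed_vector) \<Rightarrow> bool" where
  "Ck_on 0 S f \<longleftrightarrow> continuous_on S f"
| "Ck_on (Suc k) S f \<longleftrightarrow>
     f differentiable_on S \<and> (\<forall>v. Ck_on k S (\<lambda>x. frechet_derivative f (at x) v))"

definition smooth_on :: "'e::real_normed_vector set \<Rightarrow> ('e \<Rightarrow> 'f::real_normed_vector) \<Rightarrow> bool" where
  "smooth_on S f \<longleftrightarrow> (\<forall>k. Ck_on k S f)"

text \<open>A manifold is given by an atlas; a chart is a pair of its domain and its coordinate map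
  (whose values outside the domain are irrelevant).\<close>

type_synonym ('a, 'e) atlas = "('a set \<times> ('a \<Rightarrow> 'e)) set"

definition carrier_of :: "('a, 'e) atlas \<Rightarrow> 'a set" where
  "carrier_of A = \<Union> (fst ` A)"

definition manifold_open :: "('a, 'e::euclidean_space) atlas \<Rightarrow> 'a set \<Rightarrow> bool" where
  "manifold_open A W \<longleftrightarrow> W \<subseteq> carrier_of A \<and> (\<forall>(U, \<phi>)\<in>A. open (\<phi> ` (U \<inter> W)))"

definition coord_rep :: "'a set \<Rightarrow> ('a \<Rightarrow> 'e) \<Rightarrow> ('b \<Rightarrow> 'f) \<Rightarrow> ('a \<Rightarrow> 'b) \<Rightarrow> 'e \<Rightarrow> 'f" where
  "coord_rep U \<phi> \<psi> f = \<psi> \<circ> f \<circ> inv_into U \<phi>"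

definition smooth_map ::
  "('a, 'e::euclidean_space) atlas \<Rightarrow> ('b, 'f::euclidean_space) atlas \<Rightarrow> ('a \<Rightarrow> 'b) \<Rightarrow> bool" where
  "smooth_map A B f \<longleftrightarrow> f ` carrier_of A \<subseteq> carrier_of B \<and>
     (\<forall>(U, \<phi>)\<in>A. \<forall>(V, \<psi>)\<in>B. open (\<phi> ` (U \<inter> f -` V)) \<and>
        smooth_on (\<phi> ` (U \<inter> f -` V)) (coord_rep U \<phi> \<psi> f))"

definition diffeomorphism ::
  "('a, 'e::euclidean_space) atlas \<Rightarrow> ('b, 'f::euclidean_space) atlas \<Rightarrow> ('a \<Rightarrow> 'b) \<Rightarrow> bool" where
  "diffeomorphism A B f \<longleftrightarrow> bij_betw f (carrier_of A) (carrier_of B) \<and>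
     smooth_map A B f \<and> smooth_map B A (inv_into (carrier_of A) f)"

definition smooth_manifold :: "('a, 'e::euclidean_space) atlas \<Rightarrow> bool" where
  "smooth_manifold A \<longleftrightarrow>
     (\<forall>(U, \<phi>)\<in>A. inj_on \<phi> U \<and> open (\<phi> ` U)) \<and>
     smooth_map A A (\<lambda>x. x) \<and>
     Hausdorff_space (topology (manifold_open A)) \<and>
     second_countable (topology (manifold_open A))"

definition open_submanifold :: "('a, 'e) atlas \<Rightarrow> 'a set \<Rightarrow> ('a, 'e) atlas" where
  "open_submanifold A W = (\<lambda>(U, \<phi>). (U \<inter> W, \<phi>)) ` A"

definition euclidean_atlas :: "'e set \<Rightarrow> ('e, 'e) atlas" where
  "euclidean_atlas W = {(W, \<lambda>x. x)}"

text \<open>Complex manifolds are modelled on \<open>complex ^ 'n\<close>; maps between them are holomorphic if they are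
  smooth and their derivative in charts is complex linear.\<close>

definition holomorphic_map ::
  "('a, complex ^ 'n) atlas \<Rightarrow> ('b, complex ^ 'm) atlas \<Rightarrow> ('a \<Rightarrow> 'b) \<Rightarrow> bool" where
  "holomorphic_map A B f \<longleftrightarrow> smooth_map A B f \<and>
     (\<forall>(U, \<phi>)\<in>A. \<forall>(V, \<psi>)\<in>B. \<forall>p \<in> U \<inter> f -` V. \<forall>v.
        frechet_derivative (coord_rep U \<phi> \<psi> f) (at (\<phi> p)) (\<i> *s v) =
        \<i> *s frechet_derivative (coord_rep U \<phi> \<psi> f) (at (\<phi> p)) v)"

definition biholomorphism ::
  "('a, complex ^ 'n) atlas \<Rightarrow> ('b, complex ^ 'm) atlas \<Rightarrow> ('a \<Rightarrow> 'b) \<Rightarrow> bool" where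
  "biholomorphism A B f \<longleftrightarrow> bij_betw f (carrier_of A) (carrier_of B) \<and>
     holomorphic_map A B f \<and> holomorphic_map B A (inv_into (carrier_of A) f)"

definition complex_manifold :: "('a, complex ^ 'n) atlas \<Rightarrow> bool" where
  "complex_manifold A \<longleftrightarrow> smooth_manifold A \<and> holomorphic_map A A (\<lambda>x. x)"

text \<open>The quotient of an open set \<open>S\<close> by a group \<open>G\<close> of transformations: its points are the
  orbits, and its charts are the local inverses of the projection.\<close>

definition orbit_of :: "('e \<Rightarrow> 'e) set \<Rightarrow> 'e \<Rightarrow> 'e set" where
  "orbit_of G x = (\<lambda>g. g x) ` G"

definition quotient_atlas :: "'e::euclidean_space set \<Rightarrow> ('e \<Rightarrow> 'e) set \<Rightarrow> ('e set, 'e) atlas" where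
  "quotient_atlas S G =
     {(orbit_of G ` V, inv_into V (orbit_of G)) | V. open V \<and> V \<subseteq> S \<and> inj_on (orbit_of G) V}"


section \<open>Differential forms\<close>

text \<open>An inhomogeneous complex-valued form on a Euclidean space is a function of the point and of a list
  of tangent vectors; its degree \<open>k\<close> part is its restriction to lists of length \<open>k\<close>.\<close>

type_synonym 'e form = "'e \<Rightarrow> 'e list \<Rightarrow> complex"

text \<open>Vanishing on adjacent equal arguments suffices for a multilinear map to be alternating.\<close>

definition alternating :: "('e::real_vector list \<Rightarrow> complex) \<Rightarrow> bool" where
  "alternating a \<longleftrightarrow> (\<forall>us vs. linear (\<lambda>v. a (us @ v # vs))) \<and> (\<forall>us v vs. a (us @ v # v # vs) = 0)"

definition dform :: "('e::real_normed_vector \<Rightarrow> complex) \<Rightarrow> 'e form" where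
  "dform f x vs = (case vs of [v] \<Rightarrow> frechet_derivative f (at x) v | _ \<Rightarrow> 0)"

definition fscale :: "('e \<Rightarrow> complex) \<Rightarrow> 'e form \<Rightarrow> 'e form" where
  "fscale f \<alpha> x vs = f x * \<alpha> x vs"

definition fcnj :: "'e form \<Rightarrow> 'e form" where
  "fcnj \<alpha> x vs = cnj (\<alpha> x vs)"

text \<open>The wedge product as a sum over shuffles, normalised by
  \<open>(dx \<and> dy)(u, v) = dx(u) dy(v) - dx(v) dy(u)\<close>; \<open>I\<close> is the set of positions handed to \<open>\<alpha>\<close>.\<close>

definition wedge :: "'e form \<Rightarrow> 'e form \<Rightarrow> 'e form" (infixr "\<and>\<^sub>d" 75) where
  "(\<alpha> \<and>\<^sub>d \<beta>) x vs = (\<Sum>I\<in>Pow {..<length vs}.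
     (-1) ^ card {(i, j). i \<in> I \<and> j < length vs \<and> j \<notin> I \<and> j < i} *
     \<alpha> x (nths vs I) * \<beta> x (nths vs (- I)))"

primrec wedge_power :: "'e form \<Rightarrow> nat \<Rightarrow> 'e form" where
  "wedge_power \<alpha> 0 = (\<lambda>x vs. if vs = [] then 1 else 0)"
| "wedge_power \<alpha> (Suc k) = \<alpha> \<and>\<^sub>d wedge_power \<alpha> k"

text \<open>The exponential of a form without component in degree 0: only powers up to the number of
  arguments contribute.\<close>

definition fexp :: "'e form \<Rightarrow> 'e form" where
  "fexp \<alpha> x vs = (\<Sum>k\<le>length vs. wedge_power \<alpha> k x vs / fact k)"

definition pullback :: "('e::real_normed_vector \<Rightarrow> 'f::real_normed_vector) \<Rightarrow> 'f form \<Rightarrow> 'e form" where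
  "pullback f \<alpha> x vs = \<alpha> (f x) (map (frechet_derivative f (at x)) vs)"

definition ext_d :: "'e::real_normed_vector form \<Rightarrow> 'e form" where
  "ext_d \<alpha> x vs = (\<Sum>i<length vs. (-1) ^ i *
     frechet_derivative (\<lambda>y. \<alpha> y (take i vs @ drop (Suc i) vs)) (at x) (vs ! i))"

text \<open>A form on a manifold: \<open>\<alpha> \<phi> p vs\<close> is its value at the point \<open>p\<close> on the tangent vectors whose
  coordinates in the chart \<open>\<phi>\<close> are \<open>vs\<close>.\<close>

type_synonym ('a, 'e) mform = "('a \<Rightarrow> 'e) \<Rightarrow> 'a \<Rightarrow> 'e list \<Rightarrow> complex"

definition is_pullback :: "('a, 'e::euclidean_space) atlas \<Rightarrow> ('b, 'f::euclidean_space) atlas \<Rightarrow>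
    ('a \<Rightarrow> 'b) \<Rightarrow> ('b, 'f) mform \<Rightarrow> ('a, 'e) mform \<Rightarrow> bool" where
  "is_pullback A B f \<beta> \<alpha> \<longleftrightarrow> (\<forall>(U, \<phi>)\<in>A. \<forall>(V, \<psi>)\<in>B. \<forall>p \<in> U \<inter> f -` V. \<forall>vs.
     \<alpha> \<phi> p vs = \<beta> \<psi> (f p) (map (frechet_derivative (coord_rep U \<phi> \<psi> f) (at (\<phi> p))) vs))"

definition in_chart :: "'a set \<Rightarrow> ('a \<Rightarrow> 'e) \<Rightarrow> ('a, 'e) mform \<Rightarrow> 'e form" where
  "in_chart U \<phi> \<alpha> x vs = \<alpha> \<phi> (inv_into U \<phi> x) vs"

definition differential_form :: "('a, 'e::euclidean_space) atlas \<Rightarrow> ('a, 'e) mform \<Rightarrow> bool" where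
  "differential_form A \<alpha> \<longleftrightarrow>
     (\<forall>(U, \<phi>)\<in>A. (\<forall>p\<in>U. alternating (\<alpha> \<phi> p)) \<and>
        (\<forall>vs. smooth_on (\<phi> ` U) (\<lambda>x. in_chart U \<phi> \<alpha> x vs))) \<and>
     is_pullback A A (\<lambda>x. x) \<alpha> \<alpha>"

definition symplectic_manifold :: "('a, 'e::euclidean_space) atlas \<Rightarrow> ('a, 'e) mform \<Rightarrow> bool" where
  "symplectic_manifold A \<omega> \<longleftrightarrow> smooth_manifold A \<and> differential_form A \<omega> \<and>
     (\<forall>(U, \<phi>)\<in>A. \<forall>p\<in>U.
        (\<forall>vs. \<omega> \<phi> p vs \<in> \<real>) \<and>
        (\<forall>vs. length vs \<noteq> 2 \<longrightarrow> \<omega> \<phi> p vs = 0) \<and>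
        (\<forall>vs. ext_d (in_chart U \<phi> \<omega>) (\<phi> p) vs = 0) \<and>
        (\<forall>u. u \<noteq> 0 \<longrightarrow> (\<exists>v. \<omega> \<phi> p [u, v] \<noteq> 0)))"

definition symplectomorphism :: "('a, 'e::euclidean_space) atlas \<Rightarrow> ('a, 'e) mform \<Rightarrow>
    ('b, 'f::euclidean_space) atlas \<Rightarrow> ('b, 'f) mform \<Rightarrow> ('a \<Rightarrow> 'b) \<Rightarrow> bool" where
  "symplectomorphism A \<omega> B \<omega>' f \<longleftrightarrow> diffeomorphism A B f \<and> is_pullback A B f \<omega>' \<omega>"

text \<open>The form on a quotient induced by an invariant form on the covering space; in each chart of
  \<open>quotient_atlas\<close> it is the given form itself.\<close>

definition descend :: "'e form \<Rightarrow> ('e set, 'e) mform" where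
  "descend \<alpha> \<phi> p vs = \<alpha> (\<phi> p) vs"


section \<open>The local models \<open>TU/\<Lambda>\<close> and \<open>T*U/\<Lambda>*\<close>\<close>

text \<open>Coordinates are indexed by the type \<open>3\<close> with elements 0, 1, 2 (the numeral 3 denotes 0, so the
  library's \<open>vector [a, b, c]\<close> would put \<open>c\<close> at index 0).\<close>

definition vec012 :: "'a \<Rightarrow> 'a \<Rightarrow> 'a \<Rightarrow> 'a ^ 3" where
  "vec012 a b c = (\<chi> j. if j = 0 then a else if j = 1 then b else c)"

definition re_vec :: "complex ^ 3 \<Rightarrow> real ^ 3" where
  "re_vec \<zeta> = (\<chi> j. Re (\<zeta> $ j))"

definition im_vec :: "complex ^ 3 \<Rightarrow> real ^ 3" where
  "im_vec \<zeta> = (\<chi> j. Im (\<zeta> $ j))"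

definition complex_vec :: "real ^ 3 \<Rightarrow> real ^ 3 \<Rightarrow> complex ^ 3" where
  "complex_vec u v = (\<chi> j. Complex (u $ j) (v $ j))"

definition lattice :: "real ^ 3 ^ 3 \<Rightarrow> (real ^ 3) set" where
  "lattice L = {L *v k | k. \<forall>i. k $ i \<in> \<int>}"

definition dual_lattice :: "(real ^ 3) set \<Rightarrow> (real ^ 3) set" where
  "dual_lattice \<Lambda> = {\<theta>. \<forall>l\<in>\<Lambda>. \<theta> \<bullet> l \<in> \<int>}"

text \<open>A point of \<open>TU\<close> is \<open>\<zeta> = \<theta>' + i r\<close>, with \<open>\<theta>'\<close> the fibre coordinate (dual to \<open>\<theta>\<close>) and \<open>r \<in> U\<close>; a
  point of \<open>T*U\<close> is \<open>(r, \<theta>)\<close>.\<close>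

definition tangent_torus_bundle :: "(real ^ 3) set \<Rightarrow> (real ^ 3) set \<Rightarrow>
    ((complex ^ 3) set, complex ^ 3) atlas" where
  "tangent_torus_bundle U \<Lambda> =
     quotient_atlas {\<zeta>. im_vec \<zeta> \<in> U} {(\<lambda>\<zeta>. \<zeta> + complex_vec l 0) | l. l \<in> \<Lambda>}"

definition cotangent_torus_bundle :: "(real ^ 3) set \<Rightarrow> (real ^ 3) set \<Rightarrow>
    (((real ^ 3) \<times> (real ^ 3)) set, (real ^ 3) \<times> (real ^ 3)) atlas" where
  "cotangent_torus_bundle U \<Lambda>' =
     quotient_atlas (U \<times> UNIV) {(\<lambda>(r, \<theta>). (r, \<theta> + l)) | l. l \<in> \<Lambda>'}"

definition holomorphic_volume :: "(complex ^ 3) form" where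
  "holomorphic_volume =
     (dform (\<lambda>\<zeta>. of_real (re_vec \<zeta> $ 0)) + fscale (\<lambda>_. \<i>) (dform (\<lambda>\<zeta>. of_real (im_vec \<zeta> $ 0)))) \<and>\<^sub>d
     (dform (\<lambda>\<zeta>. of_real (re_vec \<zeta> $ 1)) + fscale (\<lambda>_. \<i>) (dform (\<lambda>\<zeta>. of_real (im_vec \<zeta> $ 1)))) \<and>\<^sub>d
     (dform (\<lambda>\<zeta>. of_real (re_vec \<zeta> $ 2)) + fscale (\<lambda>_. \<i>) (dform (\<lambda>\<zeta>. of_real (im_vec \<zeta> $ 2))))"

definition canonical_symplectic :: "((real ^ 3) \<times> (real ^ 3)) form" where
  "canonical_symplectic = (\<Sum>j\<in>UNIV.
     dform (\<lambda>(r, \<theta>). of_real (\<theta> $ j)) \<and>\<^sub>d dform (\<lambda>(r, \<theta>). of_real (r $ j)))"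


section \<open>The Fourier-Mukai transform\<close>

text \<open>Complex multilinear extension of \<open>a\<close> to the complexified tangent space; the pair \<open>(u, w)\<close> stands
  for \<open>u \<otimes> 1 + w \<otimes> i\<close>.\<close>

primrec complex_extension :: "('e list \<Rightarrow> complex) \<Rightarrow> ('e \<times> 'e) list \<Rightarrow> complex" where
  "complex_extension a [] = a []"
| "complex_extension a (v # vs) =
     complex_extension (\<lambda>us. a (fst v # us)) vs + \<i> * complex_extension (\<lambda>us. a (snd v # us)) vs"

text \<open>The complex linear map of the complexified tangent space with
  \<open>\<partial>/\<partial>\<theta>'\<^sub>j \<mapsto> \<partial>/\<partial>\<zeta>\<^sub>j = (\<partial>/\<partial>\<theta>'\<^sub>j - i \<partial>/\<partial>r\<^sub>j) / 2\<close> and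
  \<open>\<partial>/\<partial>r\<^sub>j \<mapsto> \<partial>/\<partial>cnj \<zeta>\<^sub>j = (\<partial>/\<partial>\<theta>'\<^sub>j + i \<partial>/\<partial>r\<^sub>j) / 2\<close>. Precomposition with it is the algebra
  homomorphism that replaces \<open>d\<theta>'\<^sub>j + i dr\<^sub>j\<close> by \<open>d\<theta>'\<^sub>j\<close> and \<open>d\<theta>'\<^sub>j - i dr\<^sub>j\<close> by \<open>dr\<^sub>j\<close>.\<close>

definition switch_vec :: "complex ^ 3 \<Rightarrow> (complex ^ 3) \<times> (complex ^ 3)" where
  "switch_vec v = (complex_vec ((1/2) *\<^sub>R (re_vec v + im_vec v)) 0,
                   complex_vec 0 ((1/2) *\<^sub>R (im_vec v - re_vec v)))"

definition polarization_switch :: "(complex ^ 3) form \<Rightarrow> (complex ^ 3) form" where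
  "polarization_switch \<alpha> \<zeta> vs = complex_extension (\<alpha> \<zeta>) (map switch_vec vs)"

lemma frechet_derivative_bounded_linear: "bounded_linear f \<Longrightarrow> frechet_derivative f (at x) = f"
  by (metis bounded_linear_imp_has_derivative frechet_derivative_at)

lemma polarization_switch_dform:
  assumes "bounded_linear f"
  shows "polarization_switch (dform f) \<zeta> vs =
    (case vs of [v] \<Rightarrow> f (fst (switch_vec v)) + \<i> * f (snd (switch_vec v)) | _ \<Rightarrow> 0)"
proof -
  have zero: "complex_extension (\<lambda>us. 0 :: complex) ws = 0" for ws :: "((complex ^ 3) \<times> (complex ^ 3)) list"
    by (induction ws) auto
  show ?thesis
    by (auto simp: polarization_switch_def dform_def frechet_derivative_bounded_linear[OF assms]
        zero split: list.splits)
qed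

lemma polarization_switch_dzeta:
  "polarization_switch (dform (\<lambda>\<zeta>. \<zeta> $ j)) = dform (\<lambda>\<zeta>. of_real (re_vec \<zeta> $ j))"
proof (intro ext)
  fix \<zeta> :: "complex ^ 3" and vs
  have 1: "bounded_linear (\<lambda>\<zeta>::complex ^ 3. \<zeta> $ j)" by (rule bounded_linear_vec_nth)
  have 2: "bounded_linear (\<lambda>\<zeta>::complex ^ 3. complex_of_real (re_vec \<zeta> $ j))"
    unfolding re_vec_def vec_lambda_beta
    by (intro bounded_linear_compose[OF bounded_linear_of_real]
        bounded_linear_compose[OF bounded_linear_Re] bounded_linear_vec_nth)
  show "polarization_switch (dform (\<lambda>\<zeta>. \<zeta> $ j)) \<zeta> vs = dform (\<lambda>\<zeta>. of_real (re_vec \<zeta> $ j)) \<zeta> vs"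
    unfolding polarization_switch_dform[OF 1] dform_def frechet_derivative_bounded_linear[OF 2]
    by (auto split: list.splits simp: switch_vec_def complex_vec_def re_vec_def im_vec_def complex_eq_iff
        field_simps)
qed

lemma polarization_switch_dzeta_cnj:
  "polarization_switch (dform (\<lambda>\<zeta>. cnj (\<zeta> $ j))) = dform (\<lambda>\<zeta>. of_real (im_vec \<zeta> $ j))"
proof (intro ext)
  fix \<zeta> :: "complex ^ 3" and vs
  have 1: "bounded_linear (\<lambda>\<zeta>::complex ^ 3. cnj (\<zeta> $ j))"
    by (intro bounded_linear_compose[OF bounded_linear_cnj] bounded_linear_vec_nth)
  have 2: "bounded_linear (\<lambda>\<zeta>::complex ^ 3. complex_of_real (im_vec \<zeta> $ j))"
    unfolding im_vec_def vec_lambda_beta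
    by (intro bounded_linear_compose[OF bounded_linear_of_real]
        bounded_linear_compose[OF bounded_linear_Im] bounded_linear_vec_nth)
  show "polarization_switch (dform (\<lambda>\<zeta>. cnj (\<zeta> $ j))) \<zeta> vs = dform (\<lambda>\<zeta>. of_real (im_vec \<zeta> $ j)) \<zeta> vs"
    unfolding polarization_switch_dform[OF 1] dform_def frechet_derivative_bounded_linear[OF 2]
    by (auto split: list.splits simp: switch_vec_def complex_vec_def re_vec_def im_vec_def complex_eq_iff
        field_simps)
qed

text \<open>Points of the fibre product are \<open>(r, \<theta>', \<theta>)\<close>. The fibre \<open>\<real>\<^sup>3/\<Lambda>\<close> of the projection to \<open>(r, \<theta>)\<close> is
  oriented by \<open>d\<theta>'\<^sub>0 \<and> d\<theta>'\<^sub>1 \<and> d\<theta>'\<^sub>2\<close>, and integration along the fibre follows Bott-Tu: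
  \<open>\<beta> \<and> f d\<theta>'\<^sub>0 \<and> d\<theta>'\<^sub>1 \<and> d\<theta>'\<^sub>2 \<mapsto> (\<integral> f) \<beta>\<close> for \<open>\<beta>\<close> pulled back from the target. The integral is taken
  over the fundamental parallelepiped of \<open>\<Lambda> = lattice L\<close>. The lift \<open>(fst v, 0, snd v)\<close> of \<open>v\<close> is
  immaterial, as all vertical vectors are inserted.\<close>

definition fibre_integral :: "real ^ 3 ^ 3 \<Rightarrow> ((real ^ 3) \<times> (real ^ 3) \<times> (real ^ 3)) form \<Rightarrow>
    ((real ^ 3) \<times> (real ^ 3)) form" where
  "fibre_integral L \<beta> x vs =
     integral ((*v) L ` cbox 0 1) (\<lambda>\<theta>'. \<beta> (fst x, \<theta>', snd x)
       (map (\<lambda>v. (fst v, 0, snd v)) vs @ [(0, axis 0 1, 0), (0, axis 1 1, 0), (0, axis 2 1, 0)]))"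

definition fourier_mukai :: "real ^ 3 ^ 3 \<Rightarrow> (complex ^ 3) form \<Rightarrow> ((real ^ 3) \<times> (real ^ 3)) form" where
  "fourier_mukai L \<alpha> = fibre_integral L
     (pullback (\<lambda>(r, \<theta>', \<theta>). complex_vec \<theta>' r) (polarization_switch \<alpha>) \<and>\<^sub>d
      fexp (\<Sum>j\<in>UNIV. dform (\<lambda>(r, \<theta>', \<theta>). of_real (\<theta>' $ j)) \<and>\<^sub>d dform (\<lambda>(r, \<theta>', \<theta>). of_real (\<theta> $ j))))"


section \<open>Semi-flat mirror pairs\<close>

definition lagrangian_fibration :: "('x, 'e::euclidean_space) atlas \<Rightarrow> ('x, 'e) mform \<Rightarrow>
    ('b, 'f::euclidean_space) atlas \<Rightarrow> ('x \<Rightarrow> 'b) \<Rightarrow> bool" where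
  "lagrangian_fibration X \<omega> B p \<longleftrightarrow>
     smooth_map X B p \<and> p ` carrier_of X = carrier_of B \<and> DIM('e) = 2 * DIM('f) \<and>
     (\<forall>(U, \<phi>)\<in>X. \<forall>(V, \<psi>)\<in>B. \<forall>x \<in> U \<inter> p -` V.
        surj (frechet_derivative (coord_rep U \<phi> \<psi> p) (at (\<phi> x))) \<and>
        (\<forall>u v. frechet_derivative (coord_rep U \<phi> \<psi> p) (at (\<phi> x)) u = 0 \<and>
               frechet_derivative (coord_rep U \<phi> \<psi> p) (at (\<phi> x)) v = 0 \<longrightarrow> \<omega> \<phi> x [u, v] = 0))"

text \<open>Simultaneous local description of both bundles over an open set \<open>sf_dom\<close> of the base: affine
  coordinates \<open>sf_aff\<close>, a basis \<open>sf_lat\<close> (as columns) of the lattice \<open>\<Lambda>\<close>, and identifications of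
  the two bundles with \<open>TU/\<Lambda>\<close> and \<open>T*U/\<Lambda>*\<close>.\<close>

record ('b, 'y, 'x) semi_flat_chart =
  sf_dom :: "'b set"
  sf_aff :: "'b \<Rightarrow> real ^ 3"
  sf_lat :: "real ^ 3 ^ 3"
  sf_tan :: "'y \<Rightarrow> (complex ^ 3) set"
  sf_cot :: "'x \<Rightarrow> ((real ^ 3) \<times> (real ^ 3)) set"

definition sf_image :: "('b, 'y, 'x) semi_flat_chart \<Rightarrow> (real ^ 3) set" where
  "sf_image c = sf_aff c ` sf_dom c"

definition sf_tan_model :: "('b, 'y, 'x) semi_flat_chart \<Rightarrow> ((complex ^ 3) set, complex ^ 3) atlas" where
  "sf_tan_model c = tangent_torus_bundle (sf_image c) (lattice (sf_lat c))"

definition sf_cot_model ::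
  "('b, 'y, 'x) semi_flat_chart \<Rightarrow> (((real ^ 3) \<times> (real ^ 3)) set, (real ^ 3) \<times> (real ^ 3)) atlas" where
  "sf_cot_model c = cotangent_torus_bundle (sf_image c) (dual_lattice (lattice (sf_lat c)))"

text \<open>In the following \<open>p : X \<rightarrow> B\<close> is the Lagrangian torus bundle and \<open>q : Y \<rightarrow> B\<close> its dual, so
  \<open>(Y, \<Omega>')\<close> is the complex side.\<close>

definition is_semi_flat_chart :: "('b, real ^ 3) atlas \<Rightarrow>
    ('y, complex ^ 3) atlas \<Rightarrow> ('y \<Rightarrow> 'b) \<Rightarrow> ('y, complex ^ 3) mform \<Rightarrow>
    ('x, 'e::euclidean_space) atlas \<Rightarrow> ('x \<Rightarrow> 'b) \<Rightarrow> ('x, 'e) mform \<Rightarrow>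
    ('b, 'y, 'x) semi_flat_chart \<Rightarrow> bool" where
  "is_semi_flat_chart B Y q \<Omega>' X p \<omega> c \<longleftrightarrow>
     manifold_open B (sf_dom c) \<and> open (sf_image c) \<and>
     diffeomorphism (open_submanifold B (sf_dom c)) (euclidean_atlas (sf_image c)) (sf_aff c) \<and>
     invertible (sf_lat c) \<and>
     symplectomorphism (open_submanifold X (p -` sf_dom c)) \<omega>
       (sf_cot_model c) (descend canonical_symplectic) (sf_cot c) \<and>
     (\<forall>x \<in> carrier_of X \<inter> p -` sf_dom c. \<forall>(r, \<theta>) \<in> sf_cot c x. r = sf_aff c (p x)) \<and>
     biholomorphism (open_submanifold Y (q -` sf_dom c)) (sf_tan_model c) (sf_tan c) \<and>
     (\<forall>y \<in> carrier_of Y \<inter> q -` sf_dom c. \<forall>\<zeta> \<in> sf_tan c y. im_vec \<zeta> = sf_aff c (q y)) \<and>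
     is_pullback (open_submanifold Y (q -` sf_dom c)) (sf_tan_model c) (sf_tan c)
       (descend holomorphic_volume) \<Omega>'"

text \<open>\<open>Y\<close> is the dual torus bundle: its fibre over \<open>b\<close> is \<open>T\<^sub>bB/\<Lambda>\<^sub>b\<close> (while that of \<open>X\<close> is a
  torsor of \<open>T\<^sub>b*B/\<Lambda>\<^sub>b*\<close> by the action-angle coordinates), i.e. fibre coordinates
  change like tangent vectors, with no translation.\<close>

definition dual_transitions :: "('y, complex ^ 3) atlas \<Rightarrow> ('y \<Rightarrow> 'b) \<Rightarrow>
    ('b, 'y, 'x) semi_flat_chart set \<Rightarrow> bool" where
  "dual_transitions Y q C \<longleftrightarrow> (\<forall>c\<in>C. \<forall>c'\<in>C. \<forall>y \<in> carrier_of Y \<inter> q -` (sf_dom c \<inter> sf_dom c').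
     \<forall>\<zeta> \<in> sf_tan c y. \<exists>\<zeta>' \<in> sf_tan c' y.
       re_vec \<zeta>' = frechet_derivative (coord_rep (sf_dom c) (sf_aff c) (sf_aff c') (\<lambda>b. b))
                     (at (sf_aff c (q y))) (re_vec \<zeta>))"

definition semi_flat_family :: "('b, real ^ 3) atlas \<Rightarrow>
    ('y, complex ^ 3) atlas \<Rightarrow> ('y \<Rightarrow> 'b) \<Rightarrow> ('y, complex ^ 3) mform \<Rightarrow>
    ('x, 'e::euclidean_space) atlas \<Rightarrow> ('x \<Rightarrow> 'b) \<Rightarrow> ('x, 'e) mform \<Rightarrow>
    ('b, 'y, 'x) semi_flat_chart set \<Rightarrow> bool" where
  "semi_flat_family B Y q \<Omega>' X p \<omega> C \<longleftrightarrow>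
     smooth_manifold B \<and>
     symplectic_manifold X \<omega> \<and> lagrangian_fibration X \<omega> B p \<and>
     complex_manifold Y \<and> smooth_map Y B q \<and> q ` carrier_of Y = carrier_of B \<and>
     differential_form Y \<Omega>' \<and>
     carrier_of B = \<Union> (sf_dom ` C) \<and>
     (\<forall>c\<in>C. is_semi_flat_chart B Y q \<Omega>' X p \<omega> c) \<and>
     dual_transitions Y q C"

definition semi_flat_mirror_pair :: "('b, real ^ 3) atlas \<Rightarrow>
    ('y, complex ^ 3) atlas \<Rightarrow> ('y \<Rightarrow> 'b) \<Rightarrow> ('y, complex ^ 3) mform \<Rightarrow>
    ('x, 'e::euclidean_space) atlas \<Rightarrow> ('x \<Rightarrow> 'b) \<Rightarrow> ('x, 'e) mform \<Rightarrow> bool" where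
  "semi_flat_mirror_pair B Y q \<Omega>' X p \<omega> \<longleftrightarrow> (\<exists>C. semi_flat_family B Y q \<Omega>' X p \<omega> C)"

text \<open>For triples, \<open>\<Omega>\<close> is moreover the Fourier-Mukai transform of \<open>exp(2\<omega>')\<close>, where in the local
  models \<open>\<omega>'\<close> is a form \<open>\<beta>\<close> on \<open>TU/\<Lambda>\<close> with coefficients depending only on the base.\<close>

definition semi_flat_mirror_triple :: "('b, real ^ 3) atlas \<Rightarrow>
    ('y, complex ^ 3) atlas \<Rightarrow> ('y \<Rightarrow> 'b) \<Rightarrow> ('y, complex ^ 3) mform \<Rightarrow> ('y, complex ^ 3) mform \<Rightarrow>
    ('x, 'e::euclidean_space) atlas \<Rightarrow> ('x \<Rightarrow> 'b) \<Rightarrow> ('x, 'e) mform \<Rightarrow> ('x, 'e) mform \<Rightarrow> bool" where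
  "semi_flat_mirror_triple B Y q \<omega>' \<Omega>' X p \<omega> \<Omega> \<longleftrightarrow>
     differential_form Y \<omega>' \<and> differential_form X \<Omega> \<and>
     (\<exists>C. semi_flat_family B Y q \<Omega>' X p \<omega> C \<and>
       (\<forall>c\<in>C. \<exists>\<beta>.
          (\<forall>\<zeta> t. \<beta> (\<zeta> + complex_vec t 0) = \<beta> \<zeta>) \<and>
          is_pullback (open_submanifold Y (q -` sf_dom c)) (sf_tan_model c) (sf_tan c) (descend \<beta>) \<omega>' \<and>
          is_pullback (open_submanifold X (p -` sf_dom c)) (sf_cot_model c) (sf_cot c)
            (descend (fourier_mukai (sf_lat c) (fexp (fscale (\<lambda>_. 2) \<beta>)))) \<Omega>))"


lemma semi_flat_mirror_triple_imp_pair: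
  "semi_flat_mirror_triple B Y q \<omega>' \<Omega>' X p \<omega> \<Omega> \<Longrightarrow> semi_flat_mirror_pair B Y q \<Omega>' X p \<omega>"
  unfolding semi_flat_mirror_triple_def semi_flat_mirror_pair_def by blast


section \<open>The completely solvable Nakamura manifold and its mirror\<close>

text \<open>Points of \<open>\<complex> \<ltimes> \<complex>\<^sup>2\<close> are \<open>vec012 w z\<^sub>1 z\<^sub>2\<close>.\<close>

definition nak_mult :: "real \<Rightarrow> complex ^ 3 \<Rightarrow> complex ^ 3 \<Rightarrow> complex ^ 3" where
  "nak_mult lam g p = vec012 (g $ 0 + p $ 0)
     (of_real (exp (lam * Re (g $ 0))) * p $ 1 + g $ 1)
     (of_real (exp (- lam * Re (g $ 0))) * p $ 2 + g $ 2)"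

text \<open>\<open>(\<int> \<oplus> i s \<int>) \<ltimes> (P \<int>\<^sup>2 \<oplus> i Q \<int>\<^sup>2)\<close>\<close>

definition nak_lattice :: "real \<Rightarrow> real ^ 2 ^ 2 \<Rightarrow> real ^ 2 ^ 2 \<Rightarrow> (complex ^ 3) set" where
  "nak_lattice s P Q = {vec012 (Complex a (s * c))
      (Complex ((P *v m) $ 1) ((Q *v n) $ 1)) (Complex ((P *v m) $ 2) ((Q *v n) $ 2)) | a c m n.
      a \<in> \<int> \<and> c \<in> \<int> \<and> (\<forall>i. m $ i \<in> \<int>) \<and> (\<forall>i. n $ i \<in> \<int>)}"

definition nak_quotient :: "real \<Rightarrow> (complex ^ 3) set \<Rightarrow> ((complex ^ 3) set, complex ^ 3) atlas" where
  "nak_quotient lam \<Gamma> = quotient_atlas UNIV (nak_mult lam ` \<Gamma>)"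

definition N_manifold :: "real \<Rightarrow> real \<Rightarrow> real ^ 2 ^ 2 \<Rightarrow> ((complex ^ 3) set, complex ^ 3) atlas" where
  "N_manifold lam tau P = nak_quotient lam (nak_lattice tau P P)"

definition S_matrix :: "real ^ 2 ^ 2" where
  "S_matrix = vector [vector [0, 1], vector [1, 0]]"

definition M_manifold :: "real \<Rightarrow> real \<Rightarrow> real ^ 2 ^ 2 \<Rightarrow> ((complex ^ 3) set, complex ^ 3) atlas" where
  "M_manifold lam tau P =
     nak_quotient lam (nak_lattice (1 / tau) P (S_matrix ** transpose (matrix_inv P)))"

definition coframe :: "real \<Rightarrow> 3 \<Rightarrow> (complex ^ 3) form" where
  "coframe lam k = fscale (\<lambda>p. of_real (vec012 1 (exp (- lam * Re (p $ 0))) (exp (lam * Re (p $ 0))) $ k))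
     (dform (\<lambda>p. p $ k))"

definition N_omega :: "real \<Rightarrow> (complex ^ 3) form" where
  "N_omega lam = fscale (\<lambda>_. \<i> / 2) (\<Sum>k\<in>UNIV. coframe lam k \<and>\<^sub>d fcnj (coframe lam k))"

definition N_Omega :: "real \<Rightarrow> (complex ^ 3) form" where
  "N_Omega lam = fscale (\<lambda>_. \<i>) (coframe lam 0 \<and>\<^sub>d coframe lam 1 \<and>\<^sub>d coframe lam 2)"

definition M_omega :: "(complex ^ 3) form" where
  "M_omega =
     dform (\<lambda>p. of_real (Re (p $ 0))) \<and>\<^sub>d dform (\<lambda>p. of_real (Im (p $ 0))) +
     dform (\<lambda>p. of_real (Re (p $ 2))) \<and>\<^sub>d dform (\<lambda>p. of_real (Im (p $ 1))) +
     dform (\<lambda>p. of_real (Re (p $ 1))) \<and>\<^sub>d dform (\<lambda>p. of_real (Im (p $ 2)))"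

text \<open>The base \<open>B\<close>, and the two torus fibrations, which map orbits to orbits.\<close>

definition base_act :: "real \<Rightarrow> real ^ 2 ^ 2 \<Rightarrow> real \<Rightarrow> real ^ 2 \<Rightarrow> real ^ 3 \<Rightarrow> real ^ 3" where
  "base_act lam P a b r = vec012 (r $ 0 + a)
     (exp (lam * a) * r $ 1 + P $ 1 $ 1 * b $ 1 + P $ 1 $ 2 * b $ 2)
     (exp (- lam * a) * r $ 2 + P $ 2 $ 1 * b $ 1 + P $ 2 $ 2 * b $ 2)"

definition nak_base :: "real \<Rightarrow> real ^ 2 ^ 2 \<Rightarrow> ((real ^ 3) set, real ^ 3) atlas" where
  "nak_base lam P = quotient_atlas UNIV {base_act lam P a b | a b. a \<in> \<int> \<and> (\<forall>i. b $ i \<in> \<int>)}"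

definition N_fibration :: "(complex ^ 3) set \<Rightarrow> (real ^ 3) set" where
  "N_fibration = image (\<lambda>p. vec012 (Re (p $ 0)) (Im (p $ 1)) (Im (p $ 2)))"

definition M_fibration :: "(complex ^ 3) set \<Rightarrow> (real ^ 3) set" where
  "M_fibration = image (\<lambda>p. vec012 (Re (p $ 0)) (Re (p $ 1)) (Re (p $ 2)))"

text \<open>The basis \<open>torus_lattice s Q\<close> of \<open>s \<int> \<oplus> Q \<int>\<^sup>2\<close>: \<open>\<Lambda> = \<tau> \<int> \<oplus> P \<int>\<^sup>2\<close> and
  \<open>\<Lambda>* = \<tau>\<^sup>-\<^sup>1 \<int> \<oplus> (P\<^sup>-\<^sup>1)\<^sup>T \<int>\<^sup>2\<close>.\<close>

definition torus_lattice :: "real \<Rightarrow> real ^ 2 ^ 2 \<Rightarrow> real ^ 3 ^ 3" where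
  "torus_lattice s Q = vec012 (vec012 s 0 0) (vec012 0 (Q $ 1 $ 1) (Q $ 1 $ 2)) (vec012 0 (Q $ 2 $ 1) (Q $ 2 $ 2))"

text \<open>\<open>T*B/\<Lambda>*\<close>: the fundamental group of \<open>B\<close> acts on cotangent vectors by inverse transposes.\<close>

definition cotangent_quotient :: "real \<Rightarrow> real \<Rightarrow> real ^ 2 ^ 2 \<Rightarrow>
    (((real ^ 3) \<times> (real ^ 3)) set, (real ^ 3) \<times> (real ^ 3)) atlas" where
  "cotangent_quotient lam tau P = quotient_atlas UNIV
     {(\<lambda>(r, \<theta>). (base_act lam P a b r,
         vec012 (\<theta> $ 0) (exp (- lam * a) * \<theta> $ 1) (exp (lam * a) * \<theta> $ 2) + l)) | a b l.
       a \<in> \<int> \<and> (\<forall>i. b $ i \<in> \<int>) \<and> l \<in> lattice (torus_lattice (1 / tau) (transpose (matrix_inv P)))}"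

text \<open>\<open>N = TB/\<Lambda>\<close> via \<open>(\<theta>'\<^sub>0, \<theta>'\<^sub>1, \<theta>'\<^sub>2) = (-y, x\<^sub>1, x\<^sub>2)\<close> and \<open>r = (x, y\<^sub>1, y\<^sub>2)\<close>, i.e.
  \<open>\<zeta> = (i w, z\<^sub>1, z\<^sub>2)\<close>; this is the inverse map.\<close>

definition N_from_tangent :: "complex ^ 3 \<Rightarrow> complex ^ 3" where
  "N_from_tangent \<zeta> = vec012 (- \<i> * \<zeta> $ 0) (\<zeta> $ 1) (\<zeta> $ 2)"

text \<open>\<open>M = T*B/\<Lambda>*\<close> via \<open>r = (x, x\<^sub>1, x\<^sub>2)\<close> and \<open>\<theta> = (-y, -y\<^sub>2, -y\<^sub>1)\<close>, on the covering spaces.\<close>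

definition M_to_cotangent :: "complex ^ 3 \<Rightarrow> (real ^ 3) \<times> (real ^ 3)" where
  "M_to_cotangent p = (vec012 (Re (p $ 0)) (Re (p $ 1)) (Re (p $ 2)),
                       vec012 (- Im (p $ 0)) (- Im (p $ 2)) (- Im (p $ 1)))"

definition M_Omega :: "real \<Rightarrow> real \<Rightarrow> real ^ 2 ^ 2 \<Rightarrow> (complex ^ 3) form" where
  "M_Omega lam tau P = pullback M_to_cotangent
     (fourier_mukai (torus_lattice tau P)
       (fexp (fscale (\<lambda>_. 2) (pullback N_from_tangent (N_omega lam)))))"

end

theory Submission
  imports Defs
begin

text \<open>
  The manifolds \<open>N\<close> and \<open>M\<close>, the base \<open>B\<close> and the models \<open>TU/\<Lambda>\<close>, \<open>T*U/\<Lambda>*\<close> are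
  quotients of open subsets of Euclidean spaces by groups of affine maps that act freely and
  properly, and every map of the statement lifts, at least locally, to an affine map of the covering
  spaces. In quotient charts such a map is locally its lift followed by a deck transformation
  (\<open>coord_rep_lift\<close>). Smoothness is then automatic, holomorphy means that lifts and deck
  transformations are complex affine, and a form is the pullback of another as soon as this holds
  upstairs and the target form is invariant (\<open>is_pullback_lift\<close>). That the quotients are manifolds follows
  from freeness and properness (\<open>smooth_manifold_quotient\<close>).

  The lifts are \<open>N_to_tangent\<close>, with \<open>\<zeta> = (i w, z\<^sub>1, z\<^sub>2)\<close>, and \<open>M_to_cotangent\<close>. Under them, left multiplication
  by a group element with \<open>Re w = a\<close> acts on \<open>r\<close> and on \<open>\<theta>'\<close> with linear part
  \<open>D = diag (1, e\<^sup>\<lambda>\<^sup>a, e\<^sup>-\<^sup>\<lambda>\<^sup>a)\<close>, and on \<open>\<theta>\<close> with linear part \<open>D\<^sup>-\<^sup>1\<close>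
  (\<open>N_to_tangent_mult\<close>, \<open>M_to_cotangent_mult\<close>); the exchange of \<open>y\<^sub>1\<close> and \<open>y\<^sub>2\<close> in \<open>\<theta> = (-y, -y\<^sub>2, -y\<^sub>1)\<close>
  produces the inverse, and is the origin of the matrix \<open>S\<close>. The hypothesis on \<open>P\<close> says that
  \<open>diag (e\<^sup>\<lambda>, e\<^sup>-\<^sup>\<lambda>)\<close> preserves \<open>P \<int>\<^sup>2\<close>, and by transposition \<open>P\<^sup>-\<^sup>T \<int>\<^sup>2\<close> (\<open>invariant_lattices\<close>); hence the two
  lattices are groups, and they induce on \<open>B\<close> the same affine action.

  Over an open set \<open>V\<close> that injects into \<open>B\<close>, two points over \<open>V\<close> in one orbit differ by a deck
  transformation that is trivial on \<open>B\<close>, since the action there is free. These are exactly the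
  translations by \<open>\<Lambda>\<close> and \<open>\<Lambda>*\<close>, so that the part of an orbit lying over \<open>V\<close> is a point of \<open>TV/\<Lambda>\<close> or
  \<open>T*V/\<Lambda>*\<close>. This gives the semi-flat charts (\<open>torus_fibration\<close>, \<open>orbit_restriction\<close>).

  The form \<open>\<Omega>\<close> need not be computed. The integrand of the Fourier-Mukai transform does not depend
  on \<open>\<theta>'\<close>, so the fibre integral is a constant times its value on vertical vectors
  (\<open>fourier_mukai_explicit\<close>). The integrand is natural for maps with linear part \<open>D\<close> on \<open>r\<close> and \<open>\<theta>'\<close> and
  \<open>D\<^sup>-\<^sup>1\<close> on \<open>\<theta>\<close>, because these preserve \<open>\<Sum> d\<theta>'\<^sub>j \<and> d\<theta>\<^sub>j\<close> and commute with the polarization switch, and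
  \<open>det D = 1\<close> takes care of the vertical vectors (\<open>fourier_mukai_invariant\<close>). So the transform of
  \<open>exp (2\<omega>')\<close> is invariant under the deck transformations of \<open>M\<close>, and descends.
\<close>

section \<open>Affine maps and smooth functions\<close>

text \<open>The linear part \<open>v \<mapsto> h v - h 0\<close> is also the derivative of \<open>h\<close> at every point, so no separate name is
  carried around for it.\<close>

definition affine_map :: "('e::real_normed_vector \<Rightarrow> 'f::real_normed_vector) \<Rightarrow> bool" where
  "affine_map h \<longleftrightarrow> bounded_linear (\<lambda>v. h v - h 0)"

lemma affine_mapI:
  assumes "bounded_linear L" and "\<And>x. h x = L x + b"
  shows "affine_map h"
proof -
  have "(\<lambda>v. h v - h 0) = L"
    using assms by (auto simp: linear_simps)
  then show ?thesis using assms(1) by (simp add: affine_map_def)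
qed

lemma affine_map_bounded_linear: "bounded_linear h \<Longrightarrow> affine_map h"
  by (rule affine_mapI[where b=0]) auto

lemma affine_map_id: "affine_map (\<lambda>x. x)"
  by (rule affine_map_bounded_linear) (rule bounded_linear_ident)

lemma affine_map_diff:
  assumes "affine_map h"
  shows "h x - h y = h (x - y) - h 0"
  using linear_diff[OF bounded_linear.linear[OF assms[unfolded affine_map_def]], of x y] by simp

lemma affine_map_has_derivative:
  assumes "affine_map h"
  shows "(h has_derivative (\<lambda>v. h v - h 0)) (at x)"
proof -
  have "((\<lambda>v. (h v - h 0) + h 0) has_derivative (\<lambda>v. h v - h 0)) (at x)"
    by (intro has_derivative_add_const bounded_linear_imp_has_derivative assms[unfolded affine_map_def])
  then show ?thesis by simp
qed

lemma frechet_derivative_affine: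
  assumes "affine_map h"
  shows "frechet_derivative h (at x) = (\<lambda>v. h v - h 0)"
  using frechet_derivative_at[OF affine_map_has_derivative[OF assms]] by simp

lemma continuous_affine: "affine_map h \<Longrightarrow> continuous_on S h"
  by (meson affine_map_has_derivative continuous_at_imp_continuous_on has_derivative_continuous)

lemma affine_map_comp:
  assumes "affine_map h" "affine_map k"
  shows "affine_map (h \<circ> k)"
proof -
  have "(\<lambda>v. (h \<circ> k) v - (h \<circ> k) 0) = (\<lambda>v. h v - h 0) \<circ> (\<lambda>v. k v - k 0)"
    by (simp add: fun_eq_iff flip: affine_map_diff[OF assms(1), where y = "k 0"])
  then show ?thesis
    using assms bounded_linear_compose[of "\<lambda>v. h v - h 0" "\<lambda>v. k v - k 0"]
    by (simp add: affine_map_def comp_def)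
qed

lemma Ck_on_Suc: "Ck_on (Suc k) S f \<Longrightarrow> Ck_on k S f"
proof (induction k arbitrary: f)
  case 0 then show ?case by (auto intro: differentiable_imp_continuous_on)
next
  case (Suc k) then show ?case by (metis Ck_on.simps(2))
qed

text \<open>The derivative at a point depends only on the germ there, so the hypothesis passes from \<open>f\<close> to its
  directional derivatives.\<close>

lemma Ck_on_local:
  assumes "open S"
    and "\<And>x. x \<in> S \<Longrightarrow> \<exists>N g. open N \<and> x \<in> N \<and> Ck_on k UNIV g \<and> (\<forall>y\<in>N. f y = g y)"
  shows "Ck_on k S f"
  using assms(2)
proof (induction k arbitrary: f)
  case 0
  show ?case
    unfolding Ck_on.simps(1) continuous_on_eq_continuous_at[OF assms(1)]
  proof
    fix x assume "x \<in> S"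
    then obtain N g where N: "open N" "x \<in> N" "continuous_on UNIV g" "\<forall>y\<in>N. f y = g y"
      using 0 by force
    then have "isCont g x" by (simp add: continuous_on_eq_continuous_at)
    moreover have "\<forall>\<^sub>F y in nhds x. f y = g y"
      using N by (auto simp: eventually_nhds)
    ultimately show "isCont f x"
      using isCont_cong by blast
  qed
next
  case (Suc k)
  have step: "f differentiable at x \<and> (\<exists>N g. open N \<and> x \<in> N \<and> g differentiable_on UNIV \<and>
      (\<forall>v. Ck_on k UNIV (\<lambda>x. frechet_derivative g (at x) v)) \<and>
      (\<forall>y\<in>N. frechet_derivative f (at y) = frechet_derivative g (at y)))" if xS: "x \<in> S" for x
  proof -
    obtain N g where N: "open N" "x \<in> N" "Ck_on (Suc k) UNIV g" "\<forall>y\<in>N. f y = g y"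
      using Suc.prems[OF xS] by blast
    have D: "(f has_derivative frechet_derivative g (at y)) (at y)" if "y \<in> N" for y
    proof (rule has_derivative_transform_within_open[OF _ N(1) that])
      show "(g has_derivative frechet_derivative g (at y)) (at y)"
        using N(3) by (auto simp: differentiable_on_def frechet_derivative_works[symmetric])
    qed (use N(4) in auto)
    have "\<forall>y\<in>N. frechet_derivative f (at y) = frechet_derivative g (at y)"
      using D frechet_derivative_at by metis
    then show ?thesis using N D[OF N(2)] by (auto simp: differentiable_def)
  qed
  have "Ck_on k S (\<lambda>x. frechet_derivative f (at x) v)" for v
  proof (rule Suc.IH)
    fix x assume "x \<in> S"
    then show "\<exists>N g. open N \<and> x \<in> N \<and> Ck_on k UNIV g \<and> (\<forall>y\<in>N. frechet_derivative f (at y) v = g y)"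
      using step by (metis (no_types, lifting))
  qed
  then show ?case
    using step by (auto simp: differentiable_on_def differentiable_at_withinI)
qed

lemma smooth_on_local:
  assumes "open S"
    and "\<And>x. x \<in> S \<Longrightarrow> \<exists>N g. open N \<and> x \<in> N \<and> smooth_on UNIV g \<and> (\<forall>y\<in>N. f y = g y)"
  shows "smooth_on S f"
  unfolding smooth_on_def
proof
  fix k show "Ck_on k S f"
    by (rule Ck_on_local[OF assms(1)]) (use assms(2) in \<open>force simp: smooth_on_def\<close>)
qed

lemma Ck_on_const: "Ck_on k UNIV (\<lambda>x. c)"
  by (induction k arbitrary: c) auto

lemma smooth_const: "smooth_on UNIV (\<lambda>x. c)"
  by (simp add: smooth_on_def Ck_on_const)

lemma smooth_affine:
  assumes "affine_map h"
  shows "smooth_on UNIV h"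
  unfolding smooth_on_def
proof
  fix k show "Ck_on k UNIV h"
  proof (cases k)
    case 0 then show ?thesis by (simp add: continuous_affine[OF assms])
  next
    case (Suc n) then show ?thesis
      using affine_map_has_derivative[OF assms]
      by (auto simp: differentiable_on_def differentiable_def frechet_derivative_affine[OF assms] Ck_on_const)
  qed
qed

lemma Ck_on_Suc_D:
  assumes "Ck_on (Suc k) UNIV f"
  shows "(f has_derivative frechet_derivative f (at x)) (at x)"
    "Ck_on k UNIV (\<lambda>x. frechet_derivative f (at x) v)" "Ck_on k UNIV f"
  using assms Ck_on_Suc[OF assms]
  by (auto simp: differentiable_on_def frechet_derivative_works[symmetric])

lemma Ck_on_Suc_I:
  assumes "\<And>x. (f has_derivative D x) (at x)" and "\<And>v. Ck_on k UNIV (\<lambda>x. D x v)"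
  shows "Ck_on (Suc k) UNIV f"
proof -
  have "frechet_derivative f (at x) = D x" for x
    using frechet_derivative_at[OF assms(1)] by simp
  then show ?thesis
    using assms by (auto simp: differentiable_on_def differentiable_def)
qed

lemma Ck_on_add: "Ck_on k UNIV f \<Longrightarrow> Ck_on k UNIV g \<Longrightarrow> Ck_on k UNIV (\<lambda>x. f x + g x)"
proof (induction k arbitrary: f g)
  case 0 then show ?case by (auto intro: continuous_intros)
next
  case (Suc k)
  show ?case
    by (rule Ck_on_Suc_I)
      (auto intro!: has_derivative_add Ck_on_Suc_D(1)[OF Suc.prems(1)] Ck_on_Suc_D(1)[OF Suc.prems(2)]
        Suc.IH Ck_on_Suc_D(2)[OF Suc.prems(1)] Ck_on_Suc_D(2)[OF Suc.prems(2)])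
qed

lemma Ck_on_mult:
  fixes f g :: "'e::real_normed_vector \<Rightarrow> 'f::real_normed_algebra"
  shows "Ck_on k UNIV f \<Longrightarrow> Ck_on k UNIV g \<Longrightarrow> Ck_on k UNIV (\<lambda>x. f x * g x)"
proof (induction k arbitrary: f g)
  case 0 then show ?case by (auto intro: continuous_intros)
next
  case (Suc k)
  show ?case
    by (rule Ck_on_Suc_I[OF has_derivative_mult[OF Ck_on_Suc_D(1)[OF Suc.prems(1)] Ck_on_Suc_D(1)[OF Suc.prems(2)]]])
      (intro Ck_on_add Suc.IH Ck_on_Suc_D[OF Suc.prems(1)] Ck_on_Suc_D[OF Suc.prems(2)])
qed

lemma Ck_on_bounded_linear:
  assumes "bounded_linear L"
  shows "Ck_on k UNIV f \<Longrightarrow> Ck_on k UNIV (\<lambda>x. L (f x))"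
proof (induction k arbitrary: f)
  case 0 then show ?case
    using bounded_linear.continuous_on[OF assms] by auto
next
  case (Suc k)
  show ?case
    by (rule Ck_on_Suc_I[OF bounded_linear.has_derivative[OF assms Ck_on_Suc_D(1)[OF Suc.prems]]])
      (rule Suc.IH[OF Ck_on_Suc_D(2)[OF Suc.prems]])
qed

lemma Ck_on_comp_affine:
  assumes "affine_map h"
  shows "Ck_on k UNIV f \<Longrightarrow> Ck_on k UNIV (\<lambda>x. f (h x))"
proof (induction k arbitrary: f)
  case 0 
  then have "continuous_on (range h) f" by (auto intro: continuous_on_subset)
  then show ?case using continuous_on_compose2[OF _ continuous_affine[OF assms]] by auto
next
  case (Suc k)
  show ?case
    by (rule Ck_on_Suc_I[OF has_derivative_compose[OF affine_map_has_derivative[OF assms] Ck_on_Suc_D(1)[OF Suc.prems]]])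
      (rule Suc.IH[OF Ck_on_Suc_D(2)[OF Suc.prems]])
qed

text \<open>The derivative of \<open>exp (L x) * c\<close> in direction \<open>v\<close> has the same shape, with \<open>L v * c\<close> in place of \<open>c\<close>.\<close>

lemma Ck_on_exp:
  fixes L :: "'e::real_normed_vector \<Rightarrow> real"
  assumes "bounded_linear L"
  shows "Ck_on k UNIV (\<lambda>x. exp (L x) * c)"
proof (induction k arbitrary: c)
  case 0 then show ?case
    by (auto intro!: continuous_intros bounded_linear.continuous_on[OF assms])
next
  case (Suc k)
  have D: "((\<lambda>x. exp (L x) * c) has_derivative (\<lambda>v. exp (L x) * (L v * c))) (at x)" for x
    by (auto intro!: derivative_eq_intros bounded_linear_imp_has_derivative[OF assms])
  show ?case by (rule Ck_on_Suc_I[OF D]) (rule Suc)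
qed

lemma smooth_add: "smooth_on UNIV f \<Longrightarrow> smooth_on UNIV g \<Longrightarrow> smooth_on UNIV (\<lambda>x. f x + g x)"
  by (simp add: smooth_on_def Ck_on_add)

lemma smooth_mult:
  fixes f g :: "'e::real_normed_vector \<Rightarrow> 'f::real_normed_algebra"
  shows "smooth_on UNIV f \<Longrightarrow> smooth_on UNIV g \<Longrightarrow> smooth_on UNIV (\<lambda>x. f x * g x)"
  by (simp add: smooth_on_def Ck_on_mult)

lemma smooth_bounded_linear:
  "bounded_linear L \<Longrightarrow> smooth_on UNIV f \<Longrightarrow> smooth_on UNIV (\<lambda>x. L (f x))"
  by (simp add: smooth_on_def Ck_on_bounded_linear)

lemma smooth_comp_affine:
  "affine_map h \<Longrightarrow> smooth_on UNIV f \<Longrightarrow> smooth_on UNIV (\<lambda>x. f (h x))"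
  by (simp add: smooth_on_def Ck_on_comp_affine)

lemma smooth_sum:
  "(\<And>i. i \<in> I \<Longrightarrow> smooth_on UNIV (f i)) \<Longrightarrow> smooth_on UNIV (\<lambda>x. \<Sum>i\<in>I. f i x)"
  by (induction I rule: infinite_finite_induct) (auto intro: smooth_const smooth_add)

lemma smooth_exp:
  fixes L :: "'e::real_normed_vector \<Rightarrow> real"
  assumes "bounded_linear L"
  shows "smooth_on UNIV (\<lambda>x. complex_of_real (exp (L x)))"
  using smooth_bounded_linear[OF bounded_linear_of_real, of "\<lambda>x. exp (L x) * 1"]
    Ck_on_exp[OF assms, where c=1] by (simp add: smooth_on_def)


section \<open>Maps between quotients that lift to affine maps\<close>

text \<open>The coordinate maps are local inverses of a projection \<open>\<pi>\<close> from \<open>S\<close>. For \<open>\<pi> = orbit_of G\<close> these are the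
  charts of a quotient or of an open part of it; for \<open>\<pi> = id\<close> they are those of an open set of a
  Euclidean space.\<close>

definition section_atlas :: "('e \<Rightarrow> 'a) \<Rightarrow> 'e::topological_space set \<Rightarrow> ('a, 'e) atlas \<Rightarrow> bool" where
  "section_atlas \<pi> S A \<longleftrightarrow>
     (\<forall>(U, \<phi>)\<in>A. open (\<phi> ` U) \<and> (\<forall>p\<in>U. \<phi> p \<in> S \<and> \<pi> (\<phi> p) = p))"

definition deck_maps :: "('e \<Rightarrow> 'a) \<Rightarrow> 'e::real_normed_vector set \<Rightarrow> ('e \<Rightarrow> 'e) set \<Rightarrow> bool" where
  "deck_maps \<pi> S G \<longleftrightarrow> (\<forall>g\<in>G. affine_map g) \<and> (\<forall>g\<in>G. \<forall>x\<in>S. g x \<in> S \<and> \<pi> (g x) = \<pi> x) \<and>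
     (\<forall>x\<in>S. \<forall>y\<in>S. \<pi> x = \<pi> y \<longrightarrow> (\<exists>g\<in>G. y = g x))"

text \<open>The lift may depend on the point, as it does when a sheet of the covering has to be chosen. The set
  \<open>H\<close> records which lifts occur, so that forms and complex linearity can be tested on its members.\<close>

definition lifts_to :: "('e \<Rightarrow> 'a) \<Rightarrow> 'e set \<Rightarrow> 'a set \<Rightarrow> ('f \<Rightarrow> 'b) \<Rightarrow> 'f set \<Rightarrow> ('a \<Rightarrow> 'b) \<Rightarrow>
    ('e::real_normed_vector \<Rightarrow> 'f::real_normed_vector) set \<Rightarrow> bool" where
  "lifts_to \<pi> S D \<pi>' S' f H \<longleftrightarrow> (\<forall>x\<in>S. \<pi> x \<in> D \<longrightarrow> (\<exists>h\<in>H. \<exists>N. affine_map h \<and> open N \<and> x \<in> N \<and>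
     (\<forall>x'\<in>N \<inter> S. h x' \<in> S' \<and> f (\<pi> x') = \<pi>' (h x'))))"

lemma section_atlasD:
  assumes "section_atlas \<pi> S A" "(U, \<phi>) \<in> A"
  shows "open (\<phi> ` U)" "p \<in> U \<Longrightarrow> \<phi> p \<in> S" "p \<in> U \<Longrightarrow> \<pi> (\<phi> p) = p" "inj_on \<phi> U"
    "x \<in> \<phi> ` U \<Longrightarrow> inv_into U \<phi> x = \<pi> x" "x \<in> \<phi> ` U \<Longrightarrow> \<pi> x \<in> U \<and> \<phi> (\<pi> x) = x"
proof -
  show 1: "open (\<phi> ` U)" "p \<in> U \<Longrightarrow> \<phi> p \<in> S" "p \<in> U \<Longrightarrow> \<pi> (\<phi> p) = p" for p
    using assms by (auto simp: section_atlas_def)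
  show 2: "inj_on \<phi> U"
    using 1(3) by (metis inj_onI)
  show "x \<in> \<phi> ` U \<Longrightarrow> inv_into U \<phi> x = \<pi> x" "x \<in> \<phi> ` U \<Longrightarrow> \<pi> x \<in> U \<and> \<phi> (\<pi> x) = x"
    using 1(3) 2 by auto
qed

lemma section_atlas_open_submanifold:
  assumes "section_atlas \<pi> UNIV A" "open (\<pi> -` W)"
  shows "section_atlas \<pi> UNIV (open_submanifold A W)"
proof -
  have "open (\<phi> ` (U \<inter> W)) \<and> (\<forall>p\<in>U \<inter> W. \<pi> (\<phi> p) = p)" if U: "(U, \<phi>) \<in> A" for U \<phi>
  proof -
    note sec = section_atlasD[OF assms(1) U]
    have "\<phi> ` (U \<inter> W) = \<phi> ` U \<inter> \<pi> -` W" using sec by auto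
    then show ?thesis using sec(1,3) assms(2) by auto
  qed
  then show ?thesis by (auto simp: section_atlas_def open_submanifold_def)
qed

lemma carrier_open_submanifold: "carrier_of (open_submanifold A W) = carrier_of A \<inter> W"
  by (force simp: carrier_of_def open_submanifold_def)

text \<open>The coordinates \<open>\<psi> (f p)\<close> and the lift \<open>h (\<phi> p)\<close> lie in the same fibre of \<open>\<pi>'\<close>, hence differ by some \<open>g\<close>.
  By continuity \<open>g \<circ> h\<close> stays in the image of \<open>\<psi>\<close> near \<open>\<phi> p\<close>, and there it can only be the coordinate
  expression of \<open>f\<close>.\<close>

lemma coord_rep_lift:
  fixes \<pi> :: "'e::euclidean_space \<Rightarrow> 'a" and \<pi>' :: "'f::euclidean_space \<Rightarrow> 'b"
  assumes A: "section_atlas \<pi> S A" and B: "section_atlas \<pi>' S' B" and G: "deck_maps \<pi>' S' G"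
    and f: "lifts_to \<pi> S (carrier_of A) \<pi>' S' f H"
    and U: "(U, \<phi>) \<in> A" and V: "(V, \<psi>) \<in> B" and p: "p \<in> U" "f p \<in> V"
  obtains g h N where "g \<in> G" "h \<in> H" "affine_map g" "affine_map h" "open N" "\<phi> p \<in> N"
    "N \<subseteq> \<phi> ` (U \<inter> f -` V)" "\<And>x. x \<in> N \<Longrightarrow> coord_rep U \<phi> \<psi> f x = (g \<circ> h) x"
proof -
  note U' = section_atlasD[OF A U] and V' = section_atlasD[OF B V]
  let ?x = "\<phi> p"
  have x: "?x \<in> S" "\<pi> ?x = p" using U' p by auto
  moreover have "p \<in> carrier_of A" using U p by (force simp: carrier_of_def)
  ultimately obtain h N where h: "h \<in> H" "affine_map h" "open N" "?x \<in> N"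
    "\<And>x'. x' \<in> N \<Longrightarrow> x' \<in> S \<Longrightarrow> h x' \<in> S' \<and> f (\<pi> x') = \<pi>' (h x')"
    using f unfolding lifts_to_def by (metis IntI)
  have "\<pi>' (h ?x) = \<pi>' (\<psi> (f p))" using h(5)[OF h(4) x(1)] x V'(3) p by auto
  then obtain g where g: "g \<in> G" "\<psi> (f p) = g (h ?x)"
    using G h(5)[OF h(4) x(1)] V'(2) p unfolding deck_maps_def by metis
  have g_aff: "affine_map g" using G g by (auto simp: deck_maps_def)
  define N' where "N' = N \<inter> \<phi> ` U \<inter> (g \<circ> h) -` (\<psi> ` V)"
  have N': "open N'"
    unfolding N'_def
    by (intro open_Int h(3) U'(1) open_vimage V'(1) continuous_affine affine_map_comp g_aff h(2))
  have xN': "?x \<in> N'" using h(4) p g(2) by (force simp: N'_def)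
  have main: "x' \<in> \<phi> ` (U \<inter> f -` V) \<and> coord_rep U \<phi> \<psi> f x' = (g \<circ> h) x'" if "x' \<in> N'" for x'
  proof -
    have a: "x' \<in> N" "x' \<in> \<phi> ` U" "g (h x') \<in> \<psi> ` V" using that by (auto simp: N'_def)
    have b: "\<pi> x' \<in> U" "\<phi> (\<pi> x') = x'" "inv_into U \<phi> x' = \<pi> x'" using U' a by auto
    then have c: "x' \<in> S" using U'(2) by force
    have d: "h x' \<in> S'" "f (\<pi> x') = \<pi>' (h x')" using h(5)[OF a(1) c] by auto
    have "\<pi>' (g (h x')) = f (\<pi> x')" using G g(1) d by (auto simp: deck_maps_def)
    then have e: "f (\<pi> x') \<in> V" "\<psi> (f (\<pi> x')) = g (h x')" using V'(6)[OF a(3)] by auto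
    show ?thesis using b e by (force simp: coord_rep_def)
  qed
  show thesis
    by (rule that[OF g(1) h(1) g_aff h(2) N' xN']) (use main in auto)
qed

lemma smooth_map_lift:
  fixes \<pi> :: "'e::euclidean_space \<Rightarrow> 'a" and \<pi>' :: "'f::euclidean_space \<Rightarrow> 'b"
  assumes A: "section_atlas \<pi> S A" and B: "section_atlas \<pi>' S' B" and G: "deck_maps \<pi>' S' G"
    and f: "lifts_to \<pi> S (carrier_of A) \<pi>' S' f H" and im: "f ` carrier_of A \<subseteq> carrier_of B"
  shows "smooth_map A B f"
proof -
  have "open (\<phi> ` (U \<inter> f -` V)) \<and> smooth_on (\<phi> ` (U \<inter> f -` V)) (coord_rep U \<phi> \<psi> f)"
    if U: "(U, \<phi>) \<in> A" and V: "(V, \<psi>) \<in> B" for U \<phi> V \<psi>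
  proof -
    have *: "\<exists>N k. open N \<and> x \<in> N \<and> N \<subseteq> \<phi> ` (U \<inter> f -` V) \<and> smooth_on UNIV k \<and>
        (\<forall>y\<in>N. coord_rep U \<phi> \<psi> f y = k y)" if "x \<in> \<phi> ` (U \<inter> f -` V)" for x
    proof -
      from that obtain p where p: "p \<in> U" "f p \<in> V" "x = \<phi> p" by auto
      obtain g h N where k: "g \<in> G" "h \<in> H" "affine_map g" "affine_map h" "open N" "\<phi> p \<in> N"
        "N \<subseteq> \<phi> ` (U \<inter> f -` V)" "\<And>x. x \<in> N \<Longrightarrow> coord_rep U \<phi> \<psi> f x = (g \<circ> h) x"
        using coord_rep_lift[OF A B G f U V p(1,2)] by metis
      show ?thesis
        using k p smooth_affine[OF affine_map_comp[OF k(3,4)]] by blast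
    qed
    have op: "open (\<phi> ` (U \<inter> f -` V))"
      by (subst open_subopen) (use * in blast)
    moreover have "smooth_on (\<phi> ` (U \<inter> f -` V)) (coord_rep U \<phi> \<psi> f)"
      by (rule smooth_on_local[OF op]) (use * in blast)
    ultimately show ?thesis by blast
  qed
  then show ?thesis using im by (auto simp: smooth_map_def)
qed

lemma coord_rep_lift_derivative:
  fixes \<pi> :: "'e::euclidean_space \<Rightarrow> 'a" and \<pi>' :: "'f::euclidean_space \<Rightarrow> 'b"
  assumes A: "section_atlas \<pi> S A" and B: "section_atlas \<pi>' S' B" and G: "deck_maps \<pi>' S' G"
    and f: "lifts_to \<pi> S (carrier_of A) \<pi>' S' f H"
    and U: "(U, \<phi>) \<in> A" and V: "(V, \<psi>) \<in> B" and p: "p \<in> U" "f p \<in> V"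
  obtains g h where "g \<in> G" "h \<in> H" "affine_map g" "affine_map h" "\<psi> (f p) = g (h (\<phi> p))"
    "frechet_derivative (coord_rep U \<phi> \<psi> f) (at (\<phi> p)) = frechet_derivative (g \<circ> h) (at (\<phi> p))"
    "\<And>v. frechet_derivative (coord_rep U \<phi> \<psi> f) (at (\<phi> p)) v = (g (h v) - g (h 0))"
proof -
  note U' = section_atlasD[OF A U]
  obtain g h N where k: "g \<in> G" "h \<in> H" "affine_map g" "affine_map h" "open N" "\<phi> p \<in> N"
        "N \<subseteq> \<phi> ` (U \<inter> f -` V)" "\<And>x. x \<in> N \<Longrightarrow> coord_rep U \<phi> \<psi> f x = (g \<circ> h) x"
    using coord_rep_lift[OF A B G f U V p] by metis
  note gh = affine_map_comp[OF k(3,4)]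
  have "(coord_rep U \<phi> \<psi> f has_derivative (\<lambda>v. (g \<circ> h) v - (g \<circ> h) 0)) (at (\<phi> p))"
    by (rule has_derivative_transform_within_open[OF affine_map_has_derivative[OF gh] k(5,6)])
      (simp add: k(8))
  then have D: "frechet_derivative (coord_rep U \<phi> \<psi> f) (at (\<phi> p)) = (\<lambda>v. (g \<circ> h) v - (g \<circ> h) 0)"
    using frechet_derivative_at by metis
  have "\<psi> (f p) = g (h (\<phi> p))"
    using k(8)[OF k(6)] U'(3,5) p by (simp add: coord_rep_def)
  then show thesis
    by (intro that[OF k(1-4)]) (auto simp: D frechet_derivative_affine[OF gh])
qed

lemma pullback_affine:
  "affine_map h \<Longrightarrow> pullback h \<alpha> x vs = \<alpha> (h x) (map (\<lambda>v. h v - h 0) vs)"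
  by (simp add: pullback_def frechet_derivative_affine)

lemma pullback_comp_affine:
  assumes "affine_map g" "affine_map h"
  shows "pullback (g \<circ> h) \<alpha> = pullback h (pullback g \<alpha>)"
proof (intro ext)
  fix x vs
  have "(\<lambda>v. (g \<circ> h) v - (g \<circ> h) 0) = (\<lambda>v. g v - g 0) \<circ> (\<lambda>v. h v - h 0)"
    by (simp add: fun_eq_iff flip: affine_map_diff[OF assms(1), where y = "h 0"])
  then show "pullback (g \<circ> h) \<alpha> x vs = pullback h (pullback g \<alpha>) x vs"
    unfolding pullback_affine[OF affine_map_comp[OF assms]] pullback_affine[OF assms(1)] pullback_affine[OF assms(2)]
    by simp
qed

text \<open>In coordinates \<open>f\<close> is locally \<open>g \<circ> h\<close>, and the deck transformation \<open>g\<close> does not change \<open>\<beta>\<close>.\<close>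

lemma is_pullback_lift:
  fixes \<pi> :: "'e::euclidean_space \<Rightarrow> 'e set" and \<pi>' :: "'f::euclidean_space \<Rightarrow> 'f set"
  assumes A: "section_atlas \<pi> S A" and B: "section_atlas \<pi>' S' B" and G: "deck_maps \<pi>' S' G"
    and f: "lifts_to \<pi> S (carrier_of A) \<pi>' S' f H"
    and inv: "\<And>g. g \<in> G \<Longrightarrow> pullback g \<beta> = \<beta>" and h: "\<And>h. h \<in> H \<Longrightarrow> pullback h \<beta> = \<alpha>"
  shows "is_pullback A B f (descend \<beta>) (descend \<alpha>)"
  unfolding is_pullback_def
proof (safe)
  fix U \<phi> V \<psi> p vs
  assume UV: "(U, \<phi>) \<in> A" "(V, \<psi>) \<in> B" "p \<in> U" "f p \<in> V"
  obtain g h where k: "g \<in> G" "h \<in> H" "affine_map g" "affine_map h" "\<psi> (f p) = g (h (\<phi> p))"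
    "frechet_derivative (coord_rep U \<phi> \<psi> f) (at (\<phi> p)) = frechet_derivative (g \<circ> h) (at (\<phi> p))"
    using coord_rep_lift_derivative[OF A B G f UV] by metis
  have "descend \<beta> \<psi> (f p) (map (frechet_derivative (coord_rep U \<phi> \<psi> f) (at (\<phi> p))) vs)
     = pullback (g \<circ> h) \<beta> (\<phi> p) vs"
    by (simp add: descend_def pullback_def k(5,6))
  then show "descend \<alpha> \<phi> p vs =
       descend \<beta> \<psi> (f p) (map (frechet_derivative (coord_rep U \<phi> \<psi> f) (at (\<phi> p))) vs)"
    by (simp add: pullback_comp_affine[OF k(3,4)] inv[OF k(1)] h[OF k(2)] descend_def)
qed

definition complex_affine :: "(complex ^ 'n \<Rightarrow> complex ^ 'm) \<Rightarrow> bool" where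
  "complex_affine h \<longleftrightarrow> (\<forall>v. h (\<i> *s v) - h 0 = \<i> *s (h v - h 0))"

lemma holomorphic_map_lift:
  fixes \<pi> :: "complex ^ 'n \<Rightarrow> 'a" and \<pi>' :: "complex ^ 'm \<Rightarrow> 'b"
  assumes A: "section_atlas \<pi> S A" and B: "section_atlas \<pi>' S' B" and G: "deck_maps \<pi>' S' G"
    and f: "lifts_to \<pi> S (carrier_of A) \<pi>' S' f H" and im: "f ` carrier_of A \<subseteq> carrier_of B"
    and hol: "\<And>g. g \<in> G \<Longrightarrow> complex_affine g" "\<And>h. h \<in> H \<Longrightarrow> complex_affine h"
  shows "holomorphic_map A B f"
  unfolding holomorphic_map_def
proof (intro conjI smooth_map_lift[OF A B G f im]; safe)
  fix U \<phi> V \<psi> p v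
  assume UV: "(U, \<phi>) \<in> A" "(V, \<psi>) \<in> B" "p \<in> U" "f p \<in> V"
  obtain g h where k: "g \<in> G" "h \<in> H" "affine_map g" "affine_map h"
    "\<And>v. frechet_derivative (coord_rep U \<phi> \<psi> f) (at (\<phi> p)) v = (g (h v) - g (h 0))"
    using coord_rep_lift_derivative[OF A B G f UV] by metis
  have "g (h (\<i> *s v)) - g (h 0) = g (\<i> *s (h v - h 0)) - g 0"
    using hol(2)[OF k(2)] by (simp add: affine_map_diff[OF k(3), where y = "h 0"] complex_affine_def)
  also have "\<dots> = \<i> *s (g (h v) - g (h 0))"
    using hol(1)[OF k(1)] affine_map_diff[OF k(3)] unfolding complex_affine_def by metis
  finally show "frechet_derivative (coord_rep U \<phi> \<psi> f) (at (\<phi> p)) (\<i> *s v) =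
       \<i> *s frechet_derivative (coord_rep U \<phi> \<psi> f) (at (\<phi> p)) v"
    by (simp add: k(5))
qed

lemma lifts_to_identity:
  assumes "id \<in> H"
  shows "lifts_to \<pi> S D \<pi> S (\<lambda>x. x) H"
  unfolding lifts_to_def
proof (intro ballI impI)
  fix x :: 'a assume "x \<in> S"
  show "\<exists>h\<in>H. \<exists>N. affine_map h \<and> open N \<and> x \<in> N \<and> (\<forall>x'\<in>N \<inter> S. h x' \<in> S \<and> \<pi> x' = \<pi> (h x'))"
    by (rule bexI[OF _ assms], rule exI[of _ UNIV]) (auto simp: id_def affine_map_id)
qed


section \<open>Quotients by groups of affine maps\<close>

definition affine_group :: "('e::real_normed_vector \<Rightarrow> 'e) set \<Rightarrow> bool" where
  "affine_group G \<longleftrightarrow> (\<forall>g\<in>G. affine_map g) \<and> id \<in> G \<and> (\<forall>g\<in>G. \<forall>h\<in>G. g \<circ> h \<in> G) \<and>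
     (\<forall>g\<in>G. \<exists>h\<in>G. h \<circ> g = id)"

text \<open>Properness is demanded for pairs of points, since this yields disjoint neighbourhoods of different
  orbits as well as evenly covered neighbourhoods of a single point.\<close>

definition free_proper :: "('e::topological_space \<Rightarrow> 'e) set \<Rightarrow> bool" where
  "free_proper G \<longleftrightarrow> (\<forall>g\<in>G. \<forall>x. g x = x \<longrightarrow> g = id) \<and>
     (\<forall>x y. \<exists>V W. open V \<and> x \<in> V \<and> open W \<and> y \<in> W \<and> finite {g\<in>G. g ` V \<inter> W \<noteq> {}})"

lemma affine_groupD:
  assumes "affine_group G"
  shows "g \<in> G \<Longrightarrow> affine_map g" "id \<in> G" "g \<in> G \<Longrightarrow> h \<in> G \<Longrightarrow> g \<circ> h \<in> G"
    "g \<in> G \<Longrightarrow> \<exists>h\<in>G. \<forall>x. h (g x) = x" 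
  using assms by (auto simp: affine_group_def fun_eq_iff)

lemma orbit_of_eq_iff:
  assumes "affine_group G"
  shows "orbit_of G x = orbit_of G y \<longleftrightarrow> (\<exists>g\<in>G. y = g x)"
proof
  assume *: "orbit_of G x = orbit_of G y"
  have "y \<in> orbit_of G y"
    unfolding orbit_of_def by (rule image_eqI[OF _ affine_groupD(2)[OF assms]]) simp
  then have "y \<in> orbit_of G x" using * by simp
  then show "\<exists>g\<in>G. y = g x" by (auto simp: orbit_of_def)
next
  have sub: "orbit_of G (g x) \<subseteq> orbit_of G x" if "g \<in> G" for g x
  proof
    fix z assume "z \<in> orbit_of G (g x)"
    then obtain k where "k \<in> G" "z = (k \<circ> g) x" by (auto simp: orbit_of_def)
    then show "z \<in> orbit_of G x"
      unfolding orbit_of_def using affine_groupD(3)[OF assms _ that] by blast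
  qed
  assume "\<exists>g\<in>G. y = g x"
  then obtain g where g: "g \<in> G" "y = g x" by blast
  obtain h where h: "h \<in> G" "h y = x" using affine_groupD(4)[OF assms g(1)] g(2) by metis
  show "orbit_of G x = orbit_of G y"
    using sub[OF g(1), of x] sub[OF h(1), of y] g(2) h(2) by auto
qed

lemma orbit_of_self: "affine_group G \<Longrightarrow> x \<in> orbit_of G x"
  unfolding orbit_of_def by (rule image_eqI[where x = id]) (auto intro: affine_groupD(2))

lemma orbit_of_mem_iff:
  assumes "affine_group G"
  shows "y \<in> orbit_of G x \<longleftrightarrow> orbit_of G x = orbit_of G y"
  unfolding orbit_of_eq_iff[OF assms] by (auto simp: orbit_of_def)

lemma deck_maps_orbit_of:
  assumes "affine_group G" and "\<And>g x. g \<in> G \<Longrightarrow> x \<in> S \<Longrightarrow> g x \<in> S"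
  shows "deck_maps (orbit_of G) S G"
  using assms(2) affine_groupD(1)[OF assms(1)] orbit_of_eq_iff[OF assms(1)]
  unfolding deck_maps_def by metis

lemma section_atlas_quotient: "section_atlas (orbit_of G) S (quotient_atlas S G)"
  by (auto simp: section_atlas_def quotient_atlas_def inv_into_f_f)

lemma separate_from_finite:
  fixes F :: "('e::t2_space \<Rightarrow> 'e) set"
  assumes "finite F" "\<And>g. g \<in> F \<Longrightarrow> continuous_on UNIV g" "\<And>g. g \<in> F \<Longrightarrow> g x \<noteq> y"
  shows "\<exists>V W. open V \<and> x \<in> V \<and> open W \<and> y \<in> W \<and> (\<forall>g\<in>F. g ` V \<inter> W = {})"
  using assms
proof (induction F rule: finite_induct)
  case empty then show ?case by (auto intro: exI[of _ UNIV])
next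
  case (insert g F)
  then obtain V W where VW: "open V" "x \<in> V" "open W" "y \<in> W" "\<forall>g\<in>F. g ` V \<inter> W = {}"
    by auto
  obtain A B where AB: "open A" "open B" "g x \<in> A" "y \<in> B" "A \<inter> B = {}"
    using hausdorff[of "g x" y] insert.prems by auto
  have "open (g -` A)" using insert.prems AB(1) by (auto intro: open_vimage)
  then show ?case
    using VW AB by (intro exI[of _ "V \<inter> g -` A"] exI[of _ "W \<inter> B"]) (auto intro!: open_Int)
qed

text \<open>Properness leaves only finitely many \<open>g\<close> to be avoided by shrinking. With \<open>P\<close> always true this separates
  two orbits; with \<open>P g\<close> saying \<open>g \<noteq> id\<close> and \<open>x = y\<close> it makes the projection injective near \<open>x\<close>.\<close>

lemma free_proper_separated:
  fixes G :: "('e::{real_normed_vector} \<Rightarrow> 'e) set"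
  assumes "affine_group G" "free_proper G" and "\<forall>g\<in>G. P g \<longrightarrow> g x \<noteq> y"
  shows "\<exists>V W. open V \<and> x \<in> V \<and> open W \<and> y \<in> W \<and> (\<forall>g\<in>G. P g \<longrightarrow> g ` V \<inter> W = {})"
proof -
  obtain V W where VW: "open V" "x \<in> V" "open W" "y \<in> W" "finite {g\<in>G. g ` V \<inter> W \<noteq> {}}"
    using assms(2)[unfolded free_proper_def, THEN conjunct2, rule_format, of x y] by blast
  let ?F = "{g\<in>G. P g \<and> g ` V \<inter> W \<noteq> {}}"
  have "finite ?F" by (rule finite_subset[OF _ VW(5)]) auto
  moreover have "continuous_on UNIV g" "g x \<noteq> y" if "g \<in> ?F" for g
    using that assms(3) continuous_affine[OF affine_groupD(1)[OF assms(1)]] by auto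
  ultimately have "\<exists>A B. open A \<and> x \<in> A \<and> open B \<and> y \<in> B \<and> (\<forall>g\<in>?F. g ` A \<inter> B = {})"
    by (rule separate_from_finite)
  then obtain A B where AB: "open A" "x \<in> A" "open B" "y \<in> B" "\<forall>g\<in>?F. g ` A \<inter> B = {}"
    by blast
  have "\<forall>g\<in>G. P g \<longrightarrow> g ` (V \<inter> A) \<inter> (W \<inter> B) = {}"
    using AB(5) by blast
  then show ?thesis
    using VW AB by (intro exI[of _ "V \<inter> A"] exI[of _ "W \<inter> B"]) auto
qed

lemma locally_injective_orbit:
  fixes G :: "('e::{real_normed_vector} \<Rightarrow> 'e) set"
  assumes "affine_group G" "free_proper G"
  shows "\<exists>V. open V \<and> x \<in> V \<and> inj_on (orbit_of G) V"
proof -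
  have "\<forall>g\<in>G. g \<noteq> id \<longrightarrow> g x \<noteq> x"
    using assms(2) unfolding free_proper_def by blast
  from free_proper_separated[where P = "\<lambda>g. g \<noteq> id" and x = x and y = x, OF assms this]
  obtain V W where VW: "open V" "x \<in> V" "open W" "x \<in> W" "\<forall>g\<in>G. g \<noteq> id \<longrightarrow> g ` V \<inter> W = {}"
    by blast
  have "inj_on (orbit_of G) (V \<inter> W)"
  proof (rule inj_onI)
    fix y z assume yz: "y \<in> V \<inter> W" "z \<in> V \<inter> W" "orbit_of G y = orbit_of G z"
    then obtain g where "g \<in> G" "z = g y" using orbit_of_eq_iff[OF assms(1)] by auto
    then have "g = id" using yz VW(5) by blast
    then show "y = z" using \<open>z = g y\<close> by simp
  qed
  then show ?thesis using VW by (intro exI[of _ "V \<inter> W"]) auto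
qed

lemma carrier_quotient_atlas:
  fixes G :: "('e::euclidean_space \<Rightarrow> 'e) set"
  assumes "affine_group G" "free_proper G" "open S"
  shows "carrier_of (quotient_atlas S G) = orbit_of G ` S"
proof
  show "carrier_of (quotient_atlas S G) \<subseteq> orbit_of G ` S"
    unfolding carrier_of_def quotient_atlas_def by fastforce
  show "orbit_of G ` S \<subseteq> carrier_of (quotient_atlas S G)"
  proof
    fix p assume "p \<in> orbit_of G ` S"
    then obtain x where x: "x \<in> S" "p = orbit_of G x" by auto
    obtain V where "open V" "x \<in> V" "inj_on (orbit_of G) V"
      using locally_injective_orbit[OF assms(1,2)] by blast
    then have "open (V \<inter> S)" "V \<inter> S \<subseteq> S" "inj_on (orbit_of G) (V \<inter> S)" "x \<in> V \<inter> S"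
      using assms(3) x by (auto intro: inj_on_subset)
    moreover from this have "(orbit_of G ` (V \<inter> S), inv_into (V \<inter> S) (orbit_of G)) \<in> quotient_atlas S G"
      unfolding quotient_atlas_def by blast
    ultimately show "p \<in> carrier_of (quotient_atlas S G)"
      unfolding carrier_of_def x(2) by (metis UN_I fst_conv imageI)
  qed
qed

lemma quotient_smooth_map_identity:
  fixes G :: "('e::euclidean_space \<Rightarrow> 'e) set"
  assumes "affine_group G"
  shows "smooth_map (quotient_atlas UNIV G) (quotient_atlas UNIV G) (\<lambda>x. x)"
  by (rule smooth_map_lift[OF section_atlas_quotient section_atlas_quotient deck_maps_orbit_of[OF assms]
        lifts_to_identity[of "{id}"]]) auto

text \<open>The manifold topology is the quotient topology: near each point a chart domain upstairs is open, and
  the coordinate map of a chart inverts the projection.\<close>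

lemma manifold_open_quotient_iff:
  fixes G :: "('e::euclidean_space \<Rightarrow> 'e) set"
  assumes "affine_group G" "free_proper G"
  shows "manifold_open (quotient_atlas UNIV G) W \<longleftrightarrow> W \<subseteq> range (orbit_of G) \<and> open (orbit_of G -` W)"
    (is "?L \<longleftrightarrow> ?R")
proof
  have sec: "\<phi> ` (U \<inter> W) = \<phi> ` U \<inter> orbit_of G -` W" if "(U, \<phi>) \<in> quotient_atlas UNIV G" for U \<phi>
    using section_atlasD[OF section_atlas_quotient that] by auto
  show ?L if ?R
  proof -
    have "open (\<phi> ` (U \<inter> W))" if U: "(U, \<phi>) \<in> quotient_atlas UNIV G" for U \<phi>
      unfolding sec[OF U] using \<open>?R\<close> section_atlasD(1)[OF section_atlas_quotient U] by auto
    then show ?L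
      using \<open>?R\<close> carrier_quotient_atlas[OF assms open_UNIV] by (auto simp: manifold_open_def)
  qed
  assume L: ?L
  have "\<exists>T. open T \<and> x \<in> T \<and> T \<subseteq> orbit_of G -` W" if x: "orbit_of G x \<in> W" for x
  proof -
    obtain V where V: "open V" "x \<in> V" "inj_on (orbit_of G) V"
      using locally_injective_orbit[OF assms(1,2)] by blast
    then have U: "(orbit_of G ` V, inv_into V (orbit_of G)) \<in> quotient_atlas UNIV G"
      by (auto simp: quotient_atlas_def)
    have "open (inv_into V (orbit_of G) ` (orbit_of G ` V \<inter> W))"
      using L U by (auto simp: manifold_open_def)
    moreover have "inv_into V (orbit_of G) ` (orbit_of G ` V) = V"
      using V(3) by (force simp: image_iff)
    ultimately show ?thesis
      unfolding sec[OF U] using x V by (intro exI[of _ "V \<inter> orbit_of G -` W"]) auto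
  qed
  then have "open (orbit_of G -` W)" by (subst open_subopen) auto
  then show ?R using L carrier_quotient_atlas[OF assms open_UNIV] by (auto simp: manifold_open_def)
qed

lemma open_orbit_preimage:
  fixes G :: "('e::real_normed_vector \<Rightarrow> 'e) set"
  assumes G: "affine_group G" and V: "open V"
  shows "open (orbit_of G -` (orbit_of G ` V))"
proof -
  have "orbit_of G -` (orbit_of G ` V) = (\<Union>g\<in>G. g -` V)"
  proof (intro equalityI subsetI)
    fix x assume "x \<in> orbit_of G -` (orbit_of G ` V)"
    then obtain v where "v \<in> V" "orbit_of G x = orbit_of G v" by auto
    then show "x \<in> (\<Union>g\<in>G. g -` V)" by (auto simp: orbit_of_eq_iff[OF G])
  next
    fix x assume "x \<in> (\<Union>g\<in>G. g -` V)"
    then obtain g where g: "g \<in> G" "g x \<in> V" by auto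
    then have "orbit_of G x = orbit_of G (g x)" by (auto simp: orbit_of_eq_iff[OF G])
    then show "x \<in> orbit_of G -` (orbit_of G ` V)" using g(2) by auto
  qed
  moreover have "open (g -` V)" if "g \<in> G" for g
    using V continuous_affine[OF affine_groupD(1)[OF G that]] by (rule open_vimage)
  ultimately show ?thesis by auto
qed

lemma smooth_manifold_quotient:
  fixes G :: "('e::euclidean_space \<Rightarrow> 'e) set"
  assumes G: "affine_group G" "free_proper G"
  shows "smooth_manifold (quotient_atlas UNIV G)"
proof -
  let ?Q = "quotient_atlas UNIV G" and ?\<pi> = "orbit_of G"
  have op: "istopology (manifold_open ?Q)"
    unfolding istopology_def manifold_open_quotient_iff[OF G] vimage_Union vimage_Int by blast
  define X where "X = topology (manifold_open ?Q)"
  have X: "openin X W \<longleftrightarrow> W \<subseteq> range ?\<pi> \<and> open (?\<pi> -` W)" for W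
    unfolding X_def topology_inverse'[OF op] by (rule manifold_open_quotient_iff[OF G])
  have top: "topspace X = range ?\<pi>"
  proof
    show "topspace X \<subseteq> range ?\<pi>" using openin_topspace[of X] unfolding X by blast
    have "openin X (range ?\<pi>)" unfolding X by (simp add: vimage_def)
    then show "range ?\<pi> \<subseteq> topspace X" by (rule openin_subset)
  qed
  have img: "openin X (?\<pi> ` V)" if "open V" for V
    unfolding X using open_orbit_preimage[OF G(1) that] by auto
  have haus: "Hausdorff_space X"
    unfolding Hausdorff_space_def
  proof (intro allI impI; elim conjE)
    fix p q assume "p \<in> topspace X" "q \<in> topspace X" and ne: "p \<noteq> q"
    then obtain x y where xy: "p = ?\<pi> x" "q = ?\<pi> y" unfolding top by blast
    have "\<forall>g\<in>G. True \<longrightarrow> g x \<noteq> y"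
      using ne xy orbit_of_eq_iff[OF G(1), of x y] by auto
    from free_proper_separated[where P = "\<lambda>g. True" and x = x and y = y, OF G this]
    obtain V W where VW: "open V" "x \<in> V" "open W" "y \<in> W" "\<forall>g\<in>G. g ` V \<inter> W = {}"
      by simp blast
    have "disjnt (?\<pi> ` V) (?\<pi> ` W)"
    proof (rule ccontr)
      assume "\<not> disjnt (?\<pi> ` V) (?\<pi> ` W)"
      then have "\<exists>u. u \<in> ?\<pi> ` V \<and> u \<in> ?\<pi> ` W" unfolding disjnt_def by blast
      then obtain v w where v: "v \<in> V" and w: "w \<in> W" and "?\<pi> v = ?\<pi> w"
        by (elim exE conjE imageE) simp
      then have "\<exists>g\<in>G. w = g v" by (subst orbit_of_eq_iff[OF G(1), symmetric])
      then obtain g where g: "g \<in> G" "w = g v" ..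
      have "w \<in> g ` V \<inter> W" using v w g(2) by simp
      then show False using bspec[OF VW(5) g(1)] by simp
    qed
    then show "\<exists>U V. openin X U \<and> openin X V \<and> p \<in> U \<and> q \<in> V \<and> disjnt U V"
      using img VW xy by blast
  qed
  have "second_countable X"
  proof (rule second_countable_open_map_image[of "euclidean :: 'e topology" X ?\<pi>])
    show "continuous_map euclidean X ?\<pi>"
      unfolding continuous_map_def top using X by (auto simp: vimage_def)
    show "open_map euclidean X ?\<pi>"
      unfolding open_map_def using img by auto
    show "?\<pi> ` topspace euclidean = topspace X" unfolding top by simp
    obtain B :: "'e set set" where B: "countable B" "topological_basis B"
      using ex_countable_basis by blast
    then show "second_countable (euclidean :: 'e topology)"
      unfolding second_countable_def
      by (intro exI[of _ B]) (metis open_openin topological_basisE topological_basis_open)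
  qed
  moreover have "inj_on \<phi> U \<and> open (\<phi> ` U)" if "(U, \<phi>) \<in> ?Q" for U \<phi>
    using section_atlasD[OF section_atlas_quotient that] by blast
  ultimately show ?thesis
    unfolding smooth_manifold_def
    using quotient_smooth_map_identity[OF G(1)] haus by (auto simp: X_def)
qed


section \<open>Transfer of group actions along equivariant maps\<close>

text \<open>A member of \<open>G'\<close> is determined by its effect on the image of \<open>r\<close>, so the group laws can be checked in \<open>G\<close>.\<close>

lemma affine_group_surj:
  assumes G: "affine_group G" and "surj r" and aff: "\<And>g'. g' \<in> G' \<Longrightarrow> affine_map g'"
    and down: "\<And>g. g \<in> G \<Longrightarrow> \<exists>g'\<in>G'. \<forall>x. g' (r x) = r (g x)"
    and up: "\<And>g'. g' \<in> G' \<Longrightarrow> \<exists>g\<in>G. \<forall>x. g' (r x) = r (g x)"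
  shows "affine_group G'"
proof -
  have eq: "g' = h'" if "\<And>x. g' (r x) = h' (r x)" for g' h' :: "'b \<Rightarrow> 'b"
    using that \<open>surj r\<close> by (metis ext surjD)
  have "id \<in> G'"
  proof -
    obtain g' where "g' \<in> G'" "\<forall>x. g' (r x) = r (id x)" using down affine_groupD(2)[OF G] by blast
    then show ?thesis using eq[of g' id] by auto
  qed
  moreover have "g' \<circ> h' \<in> G'" if "g' \<in> G'" "h' \<in> G'" for g' h'
  proof -
    obtain g h where gh: "g \<in> G" "h \<in> G" "\<forall>x. g' (r x) = r (g x)" "\<forall>x. h' (r x) = r (h x)"
      using up[OF \<open>g' \<in> G'\<close>] up[OF \<open>h' \<in> G'\<close>] by blast
    obtain k' where k': "k' \<in> G'" "\<forall>x. k' (r x) = r ((g \<circ> h) x)"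
      using down[OF affine_groupD(3)[OF G gh(1,2)]] by blast
    have "k' = g' \<circ> h'" by (rule eq) (use gh k' in auto)
    then show ?thesis using k'(1) by simp
  qed
  moreover have "\<exists>h'\<in>G'. h' \<circ> g' = id" if g': "g' \<in> G'" for g'
  proof -
    obtain g where g: "g \<in> G" "\<forall>x. g' (r x) = r (g x)" using up[OF g'] by blast
    obtain h where h: "h \<in> G" "\<forall>x. h (g x) = x" using affine_groupD(4)[OF G g(1)] by blast
    obtain h' where h': "h' \<in> G'" "\<forall>x. h' (r x) = r (h x)" using down[OF h(1)] by blast
    have "h' \<circ> g' = id" by (rule eq) (use g h h' in auto)
    then show ?thesis using h'(1) by blast
  qed
  ultimately show ?thesis using aff by (simp add: affine_group_def)
qed

text \<open>As \<open>j\<close> is injective, the element of \<open>G\<close> that extends \<open>g'\<close> determines \<open>g'\<close>; so finiteness is inherited.\<close>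

lemma free_proper_inj:
  fixes j :: "'f::real_normed_vector \<Rightarrow> 'e::real_normed_vector"
  assumes G: "free_proper G" and "inj j" "continuous_on UNIV j"
    and up: "\<And>g'. g' \<in> G' \<Longrightarrow> \<exists>g\<in>G. \<forall>x. j (g' x) = g (j x)"
  shows "free_proper G'"
  unfolding free_proper_def
proof (intro conjI ballI allI impI)
  fix g' x assume "g' \<in> G'" "g' x = x"
  moreover from this obtain g where g: "g \<in> G" "\<forall>x. j (g' x) = g (j x)" using up by blast
  ultimately have "g (j x) = j x" by metis
  then have "g = id" using G g(1) unfolding free_proper_def by blast
  then have "j (g' y) = j y" for y using g(2) by simp
  then show "g' = id" using \<open>inj j\<close> by (auto simp: fun_eq_iff dest: injD)
next
  fix x y
  obtain V W where VW: "open V" "j x \<in> V" "open W" "j y \<in> W" "finite {g\<in>G. g ` V \<inter> W \<noteq> {}}"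
    using G[unfolded free_proper_def, THEN conjunct2, rule_format, of "j x" "j y"] by blast
  obtain e where e: "\<And>g'. g' \<in> G' \<Longrightarrow> e g' \<in> G" "\<And>g' x. g' \<in> G' \<Longrightarrow> j (g' x) = e g' (j x)"
    using up by metis
  let ?F = "{g'\<in>G'. g' ` (j -` V) \<inter> j -` W \<noteq> {}}"
  have "e ` ?F \<subseteq> {g\<in>G. g ` V \<inter> W \<noteq> {}}"
  proof
    fix g assume "g \<in> e ` ?F"
    then obtain g' z where "g = e g'" "g' \<in> G'" "j z \<in> V" "j (g' z) \<in> W" by auto
    then have "g \<in> G" "g (j z) \<in> W" "j z \<in> V" using e[of g'] by metis+
    then show "g \<in> {g\<in>G. g ` V \<inter> W \<noteq> {}}" by blast
  qed
  then have "finite (e ` ?F)" using VW(5) finite_subset by blast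
  moreover have "inj_on e ?F"
  proof (rule inj_onI)
    fix g h assume gh: "g \<in> ?F" "h \<in> ?F" "e g = e h"
    then have "j (g z) = j (h z)" for z using e(2)[of g z] e(2)[of h z] by simp
    then show "g = h" using \<open>inj j\<close> by (auto simp: fun_eq_iff dest: injD)
  qed
  ultimately have "finite ?F" by (rule finite_imageD)
  then show "\<exists>V W. open V \<and> x \<in> V \<and> open W \<and> y \<in> W \<and> finite {g\<in>G'. g ` V \<inter> W \<noteq> {}}"
    using VW(1-4) \<open>continuous_on UNIV j\<close>
    by (intro exI[of _ "j -` V"] exI[of _ "j -` W"] conjI) (auto intro: open_vimage)
qed

section \<open>Trivialising a quotient over an open set\<close>

text \<open>The coordinate change \<open>J\<close>, with inverse \<open>K\<close>, turns the action of \<open>G\<close> into one for which the points of an orbit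
  that lie in \<open>S'\<close> form a single orbit of a smaller group \<open>H\<close>. The part \<open>W\<close> of the quotient by \<open>G\<close> consisting of
  the orbits that meet \<open>S'\<close> is then identified with \<open>S'\<close> modulo \<open>H\<close>, by sending an orbit to its part in \<open>S'\<close>.\<close>

locale orbit_restriction =
  fixes G :: "('e::euclidean_space \<Rightarrow> 'e) set" and H :: "('f::euclidean_space \<Rightarrow> 'f) set"
    and J :: "'e \<Rightarrow> 'f" and K :: "'f \<Rightarrow> 'e" and S' :: "'f set" and W :: "'e set set"
  assumes G: "affine_group G" "free_proper G" and H: "affine_group H" "free_proper H"
    and S': "open S'" and J: "affine_map J" and K: "affine_map K"
    and KJ: "\<And>x. K (J x) = x" and JK: "\<And>z. J (K z) = z"
    and orb: "\<And>z. z \<in> S' \<Longrightarrow> orbit_of H z = J ` orbit_of G (K z) \<inter> S'"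
    and W: "\<And>x. orbit_of G x \<in> W \<longleftrightarrow> (\<exists>g\<in>G. J (g x) \<in> S')"
begin

abbreviation "source \<equiv> open_submanifold (quotient_atlas UNIV G) W"
abbreviation "target \<equiv> quotient_atlas S' H"
abbreviation "trivialise y \<equiv> J ` y \<inter> S'"

lemma deck_source: "deck_maps (orbit_of G) UNIV G"
  by (rule deck_maps_orbit_of[OF G(1)]) auto

lemma deck_target: "deck_maps (orbit_of H) S' H"
proof (rule deck_maps_orbit_of[OF H(1)])
  fix h z assume "h \<in> H" "z \<in> S'"
  then have "h z \<in> orbit_of H z" by (auto simp: orbit_of_def)
  then show "h z \<in> S'" using orb[OF \<open>z \<in> S'\<close>] by auto
qed

lemma sections_target: "section_atlas (orbit_of H) S' target"
  by (rule section_atlas_quotient)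

lemma sections_source: "section_atlas (orbit_of G) UNIV source"
proof -
  have eq: "orbit_of G -` W = (\<Union>g\<in>G. (J \<circ> g) -` S')" using W by auto
  have "open ((J \<circ> g) -` S')" if "g \<in> G" for g
    by (intro open_vimage S' continuous_affine affine_map_comp J affine_groupD(1)[OF G(1) that])
  then have op: "open (orbit_of G -` W)" unfolding eq by auto
  show ?thesis by (rule section_atlas_open_submanifold[OF section_atlas_quotient op])
qed

lemma W_K: "z \<in> S' \<Longrightarrow> orbit_of G (K z) \<in> W"
  unfolding W by (rule bexI[OF _ affine_groupD(2)[OF G(1)]]) (simp add: JK)

lemma W_D:
  assumes "orbit_of G x \<in> W"
  obtains g where "g \<in> G" "J (g x) \<in> S'" "orbit_of G x = orbit_of G (K (J (g x)))"
proof -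
  obtain g where g: "g \<in> G" "J (g x) \<in> S'" using assms unfolding W by blast
  then have "orbit_of G x = orbit_of G (g x)" by (auto simp: orbit_of_eq_iff[OF G(1)])
  then show thesis using that g by (simp add: KJ)
qed

lemma carrier_source: "carrier_of source = (\<lambda>z. orbit_of G (K z)) ` S'"
proof -
  have "carrier_of source = carrier_of (quotient_atlas UNIV G) \<inter> W"
    by (rule carrier_open_submanifold)
  also have "\<dots> = (\<lambda>z. orbit_of G (K z)) ` S'"
    unfolding carrier_quotient_atlas[OF G open_UNIV] using W_K by (auto elim!: W_D)
  finally show ?thesis .
qed

lemma carrier_target: "carrier_of target = orbit_of H ` S'"
  by (rule carrier_quotient_atlas[OF H S'])

lemma trivialise_orbit: "z \<in> S' \<Longrightarrow> trivialise (orbit_of G (K z)) = orbit_of H z"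
  using orb by simp

lemma orbit_H_eq:
  assumes "z \<in> S'" "z' \<in> S'" "orbit_of H z = orbit_of H z'"
  shows "orbit_of G (K z) = orbit_of G (K z')"
proof -
  have "z' \<in> J ` orbit_of G (K z)"
    using orbit_of_self[OF H(1), of z'] assms orb by auto
  then have "K z' \<in> orbit_of G (K z)" using KJ by auto
  then show ?thesis by (simp add: orbit_of_mem_iff[OF G(1)])
qed

lemma bij_trivialise: "bij_betw trivialise (carrier_of source) (carrier_of target)"
  unfolding bij_betw_def
proof
  show "inj_on trivialise (carrier_of source)"
  proof (rule inj_onI)
    fix a b assume ab: "a \<in> carrier_of source" "b \<in> carrier_of source" "trivialise a = trivialise b"
    from ab(1,2) obtain z w where z: "z \<in> S'" "a = orbit_of G (K z)" and w: "w \<in> S'" "b = orbit_of G (K w)"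
      unfolding carrier_source by blast
    have "orbit_of H z = orbit_of H w"
      using ab(3) unfolding z(2) w(2) trivialise_orbit[OF z(1)] trivialise_orbit[OF w(1)] .
    then show "a = b" unfolding z(2) w(2) by (rule orbit_H_eq[OF z(1) w(1)])
  qed
  show "trivialise ` carrier_of source = carrier_of target"
    unfolding carrier_source carrier_target image_image by (rule image_cong[OF refl trivialise_orbit])
qed

lemma inv_trivialise:
  assumes "z \<in> S'"
  shows "inv_into (carrier_of source) trivialise (orbit_of H z) = orbit_of G (K z)"
proof -
  have "orbit_of G (K z) \<in> carrier_of source" using assms by (auto simp: carrier_source)
  from bij_betw_inv_into_left[OF bij_trivialise this] show ?thesis
    by (simp add: trivialise_orbit[OF assms])
qed

text \<open>Near \<open>x\<close> a lift is obtained by first moving \<open>x\<close> into \<open>S'\<close> by a member of \<open>G\<close>.\<close>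

lemma trivialise_lifts:
  "lifts_to (orbit_of G) UNIV (carrier_of source) (orbit_of H) S' trivialise {J \<circ> g | g. g \<in> G}"
  unfolding lifts_to_def
proof (intro ballI impI)
  fix x assume "orbit_of G x \<in> carrier_of source"
  then have "orbit_of G x \<in> W" using W_K by (auto simp: carrier_source)
  then obtain g where g: "g \<in> G" "J (g x) \<in> S'" by (rule W_D)
  have aff: "affine_map (J \<circ> g)" by (intro affine_map_comp J affine_groupD(1)[OF G(1) g(1)])
  let ?N = "(J \<circ> g) -` S'"
  have "trivialise (orbit_of G x') = orbit_of H ((J \<circ> g) x')" if "x' \<in> ?N" for x'
  proof -
    have "orbit_of G x' = orbit_of G (K ((J \<circ> g) x'))"
      using g(1) by (auto simp: orbit_of_eq_iff[OF G(1)] KJ)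
    then show ?thesis using trivialise_orbit[of "(J \<circ> g) x'"] that by simp
  qed
  moreover have "open ?N" by (intro open_vimage S' continuous_affine aff)
  ultimately show "\<exists>h\<in>{J \<circ> g | g. g \<in> G}. \<exists>N. affine_map h \<and> open N \<and> x \<in> N \<and>
      (\<forall>x'\<in>N \<inter> UNIV. h x' \<in> S' \<and> trivialise (orbit_of G x') = orbit_of H (h x'))"
    by (intro bexI[of _ "J \<circ> g"] exI[of _ ?N] conjI aff) (use g in auto)
qed

lemma inv_trivialise_lifts:
  "lifts_to (orbit_of H) S' (carrier_of target) (orbit_of G) UNIV
     (inv_into (carrier_of source) trivialise) {K}"
  unfolding lifts_to_def
proof (intro ballI impI)
  fix x assume "x \<in> S'"
  show "\<exists>h\<in>{K}. \<exists>N. affine_map h \<and> open N \<and> x \<in> N \<and> (\<forall>x'\<in>N \<inter> S'. h x' \<in> UNIV \<and>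
       inv_into (carrier_of source) trivialise (orbit_of H x') = orbit_of G (h x'))"
    by (rule bexI[of _ K], rule exI[of _ UNIV]) (simp_all add: K inv_trivialise)
qed

lemma inv_trivialise_image:
  "inv_into (carrier_of source) trivialise ` carrier_of target \<subseteq> carrier_of source"
  using bij_betw_inv_into[OF bij_trivialise] by (simp add: bij_betw_def)

lemma trivialise_image: "trivialise ` carrier_of source \<subseteq> carrier_of target"
  using bij_trivialise by (simp add: bij_betw_def)

theorem diffeomorphism_trivialise: "diffeomorphism source target trivialise"
  unfolding diffeomorphism_def
  using bij_trivialise
    smooth_map_lift[OF sections_source sections_target deck_target trivialise_lifts trivialise_image]
    smooth_map_lift[OF sections_target sections_source deck_source inv_trivialise_lifts inv_trivialise_image]
  by blast

theorem is_pullback_trivialise: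
  assumes "\<And>h. h \<in> H \<Longrightarrow> pullback h \<beta> = \<beta>" "\<And>g. g \<in> G \<Longrightarrow> pullback g \<alpha> = \<alpha>" "pullback J \<beta> = \<alpha>"
  shows "is_pullback source target trivialise (descend \<beta>) (descend \<alpha>)"
proof (rule is_pullback_lift[OF sections_source sections_target deck_target trivialise_lifts assms(1)])
  fix h assume "h \<in> {J \<circ> g | g. g \<in> G}"
  then obtain g where "g \<in> G" "h = J \<circ> g" by blast
  then show "pullback h \<beta> = \<alpha>"
    using assms(2,3) by (simp add: pullback_comp_affine[OF J affine_groupD(1)[OF G(1)]])
qed

end

lemma complex_affine_comp:
  assumes "complex_affine h" "complex_affine k" "affine_map h"
  shows "complex_affine (h \<circ> k)"
proof -
  have "h (k (\<i> *s v)) - h (k 0) = \<i> *s (h (k v) - h (k 0))" for v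
  proof -
    have "h (k (\<i> *s v)) - h (k 0) = h (\<i> *s (k v - k 0)) - h 0"
      unfolding affine_map_diff[OF assms(3), of _ "k 0"] assms(2)[unfolded complex_affine_def, rule_format] ..
    also have "\<dots> = \<i> *s (h (k v - k 0) - h 0)"
      by (rule assms(1)[unfolded complex_affine_def, rule_format])
    finally show ?thesis unfolding affine_map_diff[OF assms(3), of _ "k 0"] .
  qed
  then show ?thesis by (simp add: complex_affine_def)
qed

theorem biholomorphism_trivialise:
  fixes G :: "(complex ^ 'n \<Rightarrow> complex ^ 'n) set" and H :: "(complex ^ 'm \<Rightarrow> complex ^ 'm) set"
  assumes "orbit_restriction G H J K S' W"
    and hol: "\<And>g. g \<in> G \<Longrightarrow> complex_affine g" "\<And>h. h \<in> H \<Longrightarrow> complex_affine h"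
      "complex_affine J" "complex_affine K"
  shows "biholomorphism (open_submanifold (quotient_atlas UNIV G) W) (quotient_atlas S' H) (\<lambda>y. J ` y \<inter> S')"
proof -
  interpret orbit_restriction G H J K S' W by fact
  have hol_lift: "complex_affine h" if "h \<in> {J \<circ> g | g. g \<in> G}" for h
    using that hol(1,3) complex_affine_comp[OF _ _ J] by blast
  have "holomorphic_map source target trivialise"
    by (rule holomorphic_map_lift[OF sections_source sections_target deck_target trivialise_lifts
        trivialise_image hol(2) hol_lift])
  moreover have "holomorphic_map target source (inv_into (carrier_of source) trivialise)"
    by (rule holomorphic_map_lift[OF sections_target sections_source deck_source inv_trivialise_lifts
        inv_trivialise_image hol(1)]) (use hol(4) in auto)
  ultimately show ?thesis using bij_trivialise by (simp add: biholomorphism_def)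
qed


section \<open>The algebra of differential forms\<close>

definition alternating_form :: "'e::real_vector form \<Rightarrow> bool" where
  "alternating_form \<alpha> \<longleftrightarrow> (\<forall>x. alternating (\<alpha> x))"

definition smooth_form :: "'e::real_normed_vector form \<Rightarrow> bool" where
  "smooth_form \<alpha> \<longleftrightarrow> (\<forall>vs. smooth_on UNIV (\<lambda>x. \<alpha> x vs))"

lemma alternating_formD:
  assumes "alternating_form \<alpha>"
  shows "linear (\<lambda>v. \<alpha> x (us @ v # vs))" "\<alpha> x (us @ v # v # vs) = 0"
  using assms by (auto simp: alternating_form_def alternating_def)

lemma alternating_formI:
  assumes "\<And>x us vs. linear (\<lambda>v. \<alpha> x (us @ v # vs))" "\<And>x us v vs. \<alpha> x (us @ v # v # vs) = 0"
  shows "alternating_form \<alpha>"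
  using assms by (auto simp: alternating_form_def alternating_def)

lemma nths_two_adjacent:
  "nths (us @ u # v # ws) I = nths us I @ (if length us \<in> I then [u] else []) @
     (if Suc (length us) \<in> I then [v] else []) @ nths ws {j. j + length us + 2 \<in> I}"
  by (simp add: nths_append nths_Cons add.commute add.left_commute)

lemma nths_one:
  "nths (us @ v # ws) I = nths us I @ (if length us \<in> I then [v] else []) @
     nths ws {j. j + Suc (length us) \<in> I}"
  by (simp add: nths_append nths_Cons)

lemma nths_cong_index: "(\<And>i. i < length us \<Longrightarrow> i \<in> I \<longleftrightarrow> i \<in> J) \<Longrightarrow> nths us I = nths us J"
proof (induction us arbitrary: I J)
  case (Cons u us)
  have "nths us {j. Suc j \<in> I} = nths us {j. Suc j \<in> J}"
    by (rule Cons.IH) (use Cons.prems in auto)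
  then show ?case using Cons.prems[of 0] by (simp add: nths_Cons)
qed simp

text \<open>Their number gives the sign of the shuffle that moves the positions in \<open>I\<close> to the front.\<close>

definition inversions :: "nat set \<Rightarrow> nat \<Rightarrow> (nat \<times> nat) set" where
  "inversions I n = {(i, j). i \<in> I \<and> j < n \<and> j \<notin> I \<and> j < i}"

lemma wedge_inversions:
  "(\<alpha> \<and>\<^sub>d \<beta>) x vs = (\<Sum>I\<in>Pow {..<length vs}. (-1) ^ card (inversions I (length vs)) *
     \<alpha> x (nths vs I) * \<beta> x (nths vs (- I)))"
  by (simp add: wedge_def inversions_def)

text \<open>Exchanging \<open>m\<close> and \<open>Suc m\<close> carries the old inversions to new ones, and \<open>(Suc m, m)\<close> is the only new
  inversion that does not arise in this way.\<close>

lemma card_inversions_swap: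
  assumes "m \<in> I" "Suc m \<notin> I" "I \<subseteq> {..<n}" "Suc m < n"
  shows "card (inversions (insert (Suc m) (I - {m})) n) = Suc (card (inversions I n))"
proof -
  define \<tau> where "\<tau> = (\<lambda>i. if i = m then Suc m else if i = Suc m then m else i)"
  have \<tau>: "\<tau> m = Suc m" "\<tau> (Suc m) = m" "i \<noteq> m \<Longrightarrow> i \<noteq> Suc m \<Longrightarrow> \<tau> i = i" for i
    by (auto simp: \<tau>_def)
  have \<tau>\<tau>: "\<tau> (\<tau> i) = i" for i by (auto simp: \<tau>_def)
  have bij: "map_prod \<tau> \<tau> p = q \<longleftrightarrow> p = map_prod \<tau> \<tau> q" for p q
    using \<tau>\<tau> by (cases p; cases q) auto
  have fin: "finite (inversions I n)"
    by (rule finite_subset[of _ "{..<n} \<times> {..<n}"]) (use assms(3) in \<open>auto simp: inversions_def\<close>)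
  have "inversions (insert (Suc m) (I - {m})) n = insert (Suc m, m) (map_prod \<tau> \<tau> ` inversions I n)"
  proof (intro equalityI subsetI)
    fix p assume "p \<in> inversions (insert (Suc m) (I - {m})) n"
    then obtain i j where p: "p = (i, j)" "i \<in> insert (Suc m) (I - {m})" "j < n"
      "j \<notin> insert (Suc m) (I - {m})" "j < i" by (auto simp: inversions_def)
    show "p \<in> insert (Suc m, m) (map_prod \<tau> \<tau> ` inversions I n)"
    proof (cases "p = (Suc m, m)")
      case False
      have "(\<tau> i, \<tau> j) \<in> inversions I n"
      proof (cases "i = Suc m")
        case True
        then have "\<tau> i = m" "\<tau> j = j" "j < m" "j \<notin> I" using p False \<tau> by auto
        then show ?thesis using assms p by (auto simp: inversions_def)
      next
        case i: False
        then have "\<tau> i = i" "i \<in> I" using p \<tau> by auto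
        then show ?thesis using assms p i \<tau> by (cases "j = m") (auto simp: inversions_def)
      qed
      then have "map_prod \<tau> \<tau> (\<tau> i, \<tau> j) \<in> map_prod \<tau> \<tau> ` inversions I n" by (rule imageI)
      then show ?thesis by (simp add: \<tau>\<tau> p(1))
    qed simp
  next
    fix p assume "p \<in> insert (Suc m, m) (map_prod \<tau> \<tau> ` inversions I n)"
    then consider "p = (Suc m, m)" | i j where "p = (\<tau> i, \<tau> j)" "(i, j) \<in> inversions I n" by auto
    then show "p \<in> inversions (insert (Suc m) (I - {m})) n"
    proof cases
      case 1 then show ?thesis using assms by (auto simp: inversions_def)
    next
      case 2
      then have ij: "i \<in> I" "j < n" "j \<notin> I" "j < i" "j \<noteq> m" "i \<noteq> Suc m"
        using assms by (auto simp: inversions_def)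
      show ?thesis
      proof (cases "i = m")
        case True
        then have "\<tau> i = Suc m" "\<tau> j = j" using ij \<tau> by auto
        then show ?thesis using assms ij 2(1) True by (auto simp: inversions_def)
      next
        case False
        then have "\<tau> i = i" using ij \<tau> by auto
        then show ?thesis using assms ij 2(1) False \<tau> by (cases "j = Suc m") (auto simp: inversions_def)
      qed
    qed
  qed
  moreover have "(Suc m, m) \<notin> map_prod \<tau> \<tau> ` inversions I n"
  proof
    assume "(Suc m, m) \<in> map_prod \<tau> \<tau> ` inversions I n"
    then obtain p where p: "(Suc m, m) = map_prod \<tau> \<tau> p" "p \<in> inversions I n" by (rule imageE)
    have "p = map_prod \<tau> \<tau> (Suc m, m)" by (rule bij[THEN iffD1, OF p(1)[symmetric]])
    then have "p = (m, Suc m)" by (simp add: \<tau>(1,2))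
    then show False using p(2) by (simp add: inversions_def)
  qed
  moreover have "inj (map_prod \<tau> \<tau>)"
  proof (rule injI)
    fix p q assume "map_prod \<tau> \<tau> p = map_prod \<tau> \<tau> q"
    then have "p = map_prod \<tau> \<tau> (map_prod \<tau> \<tau> q)" by (rule bij[THEN iffD1])
    then show "p = q" by (cases q) (simp add: \<tau>\<tau>)
  qed
  ultimately show ?thesis
    using fin by (simp add: card_image inj_on_subset)
qed

text \<open>If two adjacent arguments agree, the terms in which both go to the same factor vanish. The others
  cancel in pairs: moving the other one of the two equal arguments to \<open>\<alpha>\<close> selects the same lists and
  changes the number of inversions by one.\<close>

lemma alternating_wedge:
  assumes \<alpha>: "alternating_form \<alpha>" and \<beta>: "alternating_form \<beta>"
  shows "alternating_form (\<alpha> \<and>\<^sub>d \<beta>)"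
proof (rule alternating_formI)
  fix x us vs
  show "linear (\<lambda>v. (\<alpha> \<and>\<^sub>d \<beta>) x (us @ v # vs))"
  proof -
    have "linear (\<lambda>v. c * \<alpha> x (nths (us @ v # vs) I) * \<beta> x (nths (us @ v # vs) (- I)))" for c I
    proof (cases "length us \<in> I")
      case True
      have "linear (\<lambda>v. (c * \<beta> x (nths us (- I) @ nths vs {j. j + Suc (length us) \<in> - I})) *
          \<alpha> x (nths us I @ v # nths vs {j. j + Suc (length us) \<in> I}))"
        by (intro linear_compose[OF alternating_formD(1)[OF \<alpha>], unfolded comp_def] bounded_linear.linear bounded_linear_mult_right)
      then show ?thesis using True by (simp add: nths_one mult_ac)
    next
      case False
      have "linear (\<lambda>v. (c * \<alpha> x (nths us I @ nths vs {j. j + Suc (length us) \<in> I})) *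
          \<beta> x (nths us (- I) @ v # nths vs {j. j + Suc (length us) \<in> - I}))"
        by (intro linear_compose[OF alternating_formD(1)[OF \<beta>], unfolded comp_def] bounded_linear.linear bounded_linear_mult_right)
      then show ?thesis using False by (simp add: nths_one mult_ac)
    qed
    then show ?thesis
      unfolding wedge_inversions length_append list.size by (intro linear_compose_sum) auto
  qed
next
  fix x us v and ws :: "'a list"
  let ?vs = "us @ v # v # ws"
  define n where "n = length ?vs"
  define m where "m = length us"
  have m: "Suc m < n" by (simp add: m_def n_def)
  define t where "t = (\<lambda>I. (-1) ^ card (inversions I n) * \<alpha> x (nths ?vs I) * \<beta> x (nths ?vs (- I)))"
  define A where "A = {I\<in>Pow {..<n}. m \<in> I \<and> Suc m \<notin> I}"
  define B where "B = {I\<in>Pow {..<n}. Suc m \<in> I \<and> m \<notin> I}"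
  have fin: "finite (Pow {..<n})" by simp
  have AB: "finite A" "finite B" "A \<inter> B = {}" "A \<union> B \<subseteq> Pow {..<n}"
    by (auto simp: A_def B_def)
  have zero: "t I = 0" if "I \<in> Pow {..<n} - (A \<union> B)" for I
  proof (cases "m \<in> I")
    case True
    then have "Suc m \<in> I" using that by (auto simp: A_def)
    then have "\<alpha> x (nths ?vs I) = 0"
      using True alternating_formD(2)[OF \<alpha>] by (simp add: nths_two_adjacent m_def)
    then show ?thesis by (simp add: t_def)
  next
    case False
    then have "Suc m \<notin> I" using that by (auto simp: B_def)
    then have "\<beta> x (nths ?vs (- I)) = 0"
      using False alternating_formD(2)[OF \<beta>] by (simp add: nths_two_adjacent m_def)
    then show ?thesis by (simp add: t_def)
  qed
  define s where "s = (\<lambda>I. insert (Suc m) (I - {m}))"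
  have "bij_betw s A B"
    by (rule bij_betw_byWitness[where f' = "\<lambda>I. insert m (I - {Suc m})"])
      (use m in \<open>auto simp: A_def B_def s_def\<close>)
  then have "sum t B = (\<Sum>I\<in>A. t (s I))" by (simp add: sum.reindex_bij_betw)
  also have "\<dots> = (\<Sum>I\<in>A. - t I)"
  proof (rule sum.cong)
    fix I assume I: "I \<in> A"
    have "nths us (s I) = nths us I" "nths us (- s I) = nths us (- I)"
      by (rule nths_cong_index; simp add: s_def m_def)+
    moreover have "{j. j + m + 2 \<in> s I} = {j. j + m + 2 \<in> I}" "{j. j + m + 2 \<in> - s I} = {j. j + m + 2 \<in> - I}"
      by (auto simp: s_def)
    ultimately have "nths ?vs (s I) = nths ?vs I" "nths ?vs (- s I) = nths ?vs (- I)"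
      using I unfolding nths_two_adjacent by (auto simp: A_def s_def m_def)
    moreover have "card (inversions (s I) n) = Suc (card (inversions I n))"
      using I m card_inversions_swap unfolding A_def s_def by auto
    ultimately show "t (s I) = - t I" by (simp add: t_def)
  qed simp
  finally have "sum t A + sum t B = 0" by (simp add: sum_negf)
  then have "sum t (A \<union> B) = 0" using AB by (simp add: sum.union_disjoint)
  then have "sum t (Pow {..<n}) = 0"
    by (subst sum.mono_neutral_right[OF fin AB(4)]) (use zero in auto)
  then show "(\<alpha> \<and>\<^sub>d \<beta>) x ?vs = 0" by (simp add: wedge_inversions t_def n_def)
qed

lemma alternating_add: "alternating_form \<alpha> \<Longrightarrow> alternating_form \<beta> \<Longrightarrow> alternating_form (\<alpha> + \<beta>)"
  by (rule alternating_formI) (auto simp: alternating_formD intro: linear_compose_add)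

lemma alternating_zero: "alternating_form 0"
  by (rule alternating_formI) (auto intro: module_hom_zero)

lemma alternating_sum: "(\<And>i. i \<in> I \<Longrightarrow> alternating_form (\<alpha> i)) \<Longrightarrow> alternating_form (\<Sum>i\<in>I. \<alpha> i)"
  by (induction I rule: infinite_finite_induct) (auto intro: alternating_zero alternating_add)

lemma linear_mult_const: "linear f \<Longrightarrow> linear (\<lambda>v. c * f v :: complex)"
  using linear_compose[of f "(*) c"] by (simp add: comp_def bounded_linear.linear bounded_linear_mult_right)

lemma alternating_fscale: "alternating_form \<alpha> \<Longrightarrow> alternating_form (fscale f \<alpha>)"
  by (rule alternating_formI) (auto simp: alternating_formD fscale_def intro: linear_mult_const)

lemma alternating_fcnj: "alternating_form \<alpha> \<Longrightarrow> alternating_form (fcnj \<alpha>)"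
  by (rule alternating_formI)
    (auto simp: alternating_formD fcnj_def intro!: linear_compose[of _ cnj, unfolded comp_def]
      bounded_linear.linear bounded_linear_cnj)

lemma dform_bounded_linear:
  "bounded_linear f \<Longrightarrow> dform f x vs = (case vs of [v] \<Rightarrow> f v | _ \<Rightarrow> 0)"
  unfolding dform_def by (simp add: frechet_derivative_bounded_linear cong: list.case_cong)

lemma alternating_dform:
  assumes "bounded_linear f"
  shows "alternating_form (dform f)"
proof (rule alternating_formI)
  fix x us vs
  have "dform f x (us @ v # vs) = (if us = [] \<and> vs = [] then f v else 0)" for v
    by (cases us; cases "tl us"; cases vs) (auto simp: dform_def frechet_derivative_bounded_linear[OF assms])
  then show "linear (\<lambda>v. dform f x (us @ v # vs))"
    using bounded_linear.linear[OF assms] by (cases "us = [] \<and> vs = []") (auto intro: module_hom_zero)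
  show "dform f x (us @ v # v # vs) = 0" for v
    by (cases us) (auto simp: dform_def split: list.split)
qed

lemma alternating_wedge_power: "alternating_form \<alpha> \<Longrightarrow> alternating_form (wedge_power \<alpha> k)"
proof (induction k)
  case 0 then show ?case by (intro alternating_formI) (auto intro: module_hom_zero)
next
  case (Suc k) then show ?case by (simp add: alternating_wedge)
qed

lemma alternating_fexp:
  assumes "alternating_form \<alpha>"
  shows "alternating_form (fexp \<alpha>)"
proof (rule alternating_formI)
  note wp = alternating_formD[OF alternating_wedge_power[OF assms]]
  fix x us vs
  have "linear (\<lambda>v. wedge_power \<alpha> k x (us @ v # vs) / fact k)" for k
    using linear_mult_const[OF wp(1), of "1 / fact k"] by simp
  then show "linear (\<lambda>v. fexp \<alpha> x (us @ v # vs))"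
    unfolding fexp_def length_append list.size by (intro linear_compose_sum) auto
  show "fexp \<alpha> x (us @ v # v # vs) = 0" for v
    by (simp add: fexp_def wp(2))
qed

lemma alternating_pullback:
  assumes "affine_map h" "alternating_form \<alpha>"
  shows "alternating_form (pullback h \<alpha>)"
proof (rule alternating_formI)
  have "linear (\<lambda>v. h v - h 0)"
    using assms(1) by (simp add: affine_map_def bounded_linear.linear)
  from linear_compose[OF this alternating_formD(1)[OF assms(2)]]
  show "linear (\<lambda>v. pullback h \<alpha> x (us @ v # vs))" for x us vs
    by (simp add: pullback_def frechet_derivative_affine[OF assms(1)] comp_def)
  show "pullback h \<alpha> x (us @ v # v # vs) = 0" for x us v vs
    by (simp add: pullback_def alternating_formD(2)[OF assms(2)])
qed

lemma smooth_wedge: "smooth_form \<alpha> \<Longrightarrow> smooth_form \<beta> \<Longrightarrow> smooth_form (\<alpha> \<and>\<^sub>d \<beta>)"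
  unfolding smooth_form_def wedge_inversions by (auto intro!: smooth_sum smooth_mult smooth_const)

lemma smooth_form_add: "smooth_form \<alpha> \<Longrightarrow> smooth_form \<beta> \<Longrightarrow> smooth_form (\<alpha> + \<beta>)"
  unfolding smooth_form_def by (auto intro!: smooth_add)

lemma smooth_form_sum: "(\<And>i. i \<in> I \<Longrightarrow> smooth_form (\<alpha> i)) \<Longrightarrow> smooth_form (\<Sum>i\<in>I. \<alpha> i)"
proof (induction I rule: infinite_finite_induct)
  case (insert i I) then show ?case
    unfolding sum.insert[OF insert(1,2)] by (intro smooth_form_add) auto
qed (simp_all add: smooth_form_def smooth_const)

lemma smooth_fscale: "smooth_on UNIV f \<Longrightarrow> smooth_form \<alpha> \<Longrightarrow> smooth_form (fscale f \<alpha>)"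
  unfolding smooth_form_def fscale_def by (auto intro!: smooth_mult)

lemma smooth_fcnj: "smooth_form \<alpha> \<Longrightarrow> smooth_form (fcnj \<alpha>)"
  unfolding smooth_form_def fcnj_def by (auto intro: smooth_bounded_linear[OF bounded_linear_cnj])

lemma smooth_dform: "bounded_linear f \<Longrightarrow> smooth_form (dform f)"
  by (simp add: smooth_form_def dform_bounded_linear smooth_const)

lemma smooth_wedge_power: "smooth_form \<alpha> \<Longrightarrow> smooth_form (wedge_power \<alpha> k)"
proof (induction k)
  case 0 show ?case by (simp add: smooth_form_def smooth_const)
next
  case (Suc k) then show ?case by (simp add: smooth_wedge)
qed

lemma smooth_fexp: "smooth_form \<alpha> \<Longrightarrow> smooth_form (fexp \<alpha>)"
  using smooth_wedge_power unfolding smooth_form_def fexp_def divide_inverse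
  by (auto intro!: smooth_sum smooth_mult smooth_const)

lemma smooth_pullback: "affine_map h \<Longrightarrow> smooth_form \<alpha> \<Longrightarrow> smooth_form (pullback h \<alpha>)"
  unfolding smooth_form_def pullback_def
  by (simp add: frechet_derivative_affine smooth_comp_affine[of h "\<lambda>x. \<alpha> x _"])

lemma pullback_wedge: "pullback h (\<alpha> \<and>\<^sub>d \<beta>) = pullback h \<alpha> \<and>\<^sub>d pullback h \<beta>"
  by (intro ext) (simp add: pullback_def wedge_def nths_map)

lemma pullback_add: "pullback h (\<alpha> + \<beta>) = pullback h \<alpha> + pullback h \<beta>"
  by (intro ext) (simp add: pullback_def)

lemma pullback_sum: "pullback h (\<Sum>i\<in>I. \<alpha> i) = (\<Sum>i\<in>I. pullback h (\<alpha> i))"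
proof (induction I rule: infinite_finite_induct)
  case (insert i I) then show ?case
    unfolding sum.insert[OF insert(1,2)] pullback_add by simp
qed (simp_all add: pullback_def fun_eq_iff)

lemma pullback_fscale: "pullback h (fscale f \<alpha>) = fscale (f \<circ> h) (pullback h \<alpha>)"
  by (intro ext) (simp add: pullback_def fscale_def)

lemma pullback_fcnj: "pullback h (fcnj \<alpha>) = fcnj (pullback h \<alpha>)"
  by (intro ext) (simp add: pullback_def fcnj_def)

lemma pullback_wedge_power: "pullback h (wedge_power \<alpha> k) = wedge_power (pullback h \<alpha>) k"
proof (induction k)
  case 0 show ?case by (simp add: pullback_def fun_eq_iff)
next
  case (Suc k) then show ?case by (simp add: pullback_wedge)
qed

lemma pullback_fexp: "pullback h (fexp \<alpha>) = fexp (pullback h \<alpha>)"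
  unfolding fexp_def pullback_wedge_power[symmetric] by (intro ext) (simp add: pullback_def)

lemma pullback_dform:
  assumes "affine_map h" "bounded_linear f"
  shows "pullback h (dform f) = dform (\<lambda>v. f (h v - h 0))"
proof (intro ext)
  fix x vs
  have "bounded_linear (\<lambda>v. f (h v - h 0))"
    using bounded_linear_compose[OF assms(2) assms(1)[unfolded affine_map_def]] .
  then show "pullback h (dform f) x vs = dform (\<lambda>v. f (h v - h 0)) x vs"
    by (auto simp: pullback_def dform_def frechet_derivative_affine[OF assms(1)]
        frechet_derivative_bounded_linear assms(2) split: list.split)
qed

lemma fscale_wedge_fscale: "fscale f \<alpha> \<and>\<^sub>d fscale g \<beta> = fscale (\<lambda>x. f x * g x) (\<alpha> \<and>\<^sub>d \<beta>)"
  by (intro ext) (simp add: fscale_def wedge_def sum_distrib_left mult_ac)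

lemma wedge_degree_one:
  assumes "\<And>x vs. length vs \<noteq> 1 \<Longrightarrow> \<alpha> x vs = 0" "\<And>x vs. length vs \<noteq> 1 \<Longrightarrow> \<beta> x vs = 0"
  shows "(\<alpha> \<and>\<^sub>d \<beta>) x vs = (case vs of [u, v] \<Rightarrow> \<alpha> x [u] * \<beta> x [v] - \<alpha> x [v] * \<beta> x [u] | _ \<Rightarrow> 0)"
proof (cases "length vs = 2")
  case True
  then obtain u v where vs: "vs = [u, v]" by (auto simp: numeral_2_eq_2 length_Suc_conv)
  have P: "Pow {..<2} = {{}, {0}, {1}, {0, 1::nat}}"
    by (auto simp: lessThan_nat_numeral lessThan_Suc numeral_2_eq_2)
  have inv: "inversions {} 2 = {}" "inversions {0} 2 = {}" "inversions {1} 2 = {(1, 0)}"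
    "inversions {0, 1} 2 = {}"
    by (auto simp: inversions_def)
  have "(\<alpha> \<and>\<^sub>d \<beta>) x [u, v] = (\<Sum>I\<in>{{}, {0}, {1}, {0, 1}}. (-1) ^ card (inversions I 2) *
      \<alpha> x (nths [u, v] I) * \<beta> x (nths [u, v] (- I)))"
    unfolding wedge_inversions by (simp only: P list.size numeral_2_eq_2[symmetric] add_0 One_nat_def[symmetric] one_add_one)
  also have "\<dots> = \<alpha> x [u] * \<beta> x [v] - \<alpha> x [v] * \<beta> x [u]"
    using inv by (simp add: nths_Cons assms doubleton_eq_iff)
  finally show ?thesis by (simp add: vs)
next
  case False
  have "\<alpha> x (nths vs I) * \<beta> x (nths vs (- I)) = 0" for I
  proof (rule ccontr)
    assume "\<alpha> x (nths vs I) * \<beta> x (nths vs (- I)) \<noteq> 0"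
    then have "length (nths vs I) = 1" "length (nths vs (- I)) = 1" using assms by auto
    moreover have "length (nths vs I) + length (nths vs (- I)) = length vs"
      by (induction vs arbitrary: I) (auto simp: nths_Cons Collect_neg_eq)
    ultimately show False using False by simp
  qed
  then have "(\<alpha> \<and>\<^sub>d \<beta>) x vs = 0" 
    unfolding wedge_def mult.assoc by (simp only: mult_zero_right sum.neutral_const)
  then show ?thesis using False by (auto split: list.split)
qed


section \<open>Invariance of the Fourier-Mukai transform\<close>

text \<open>Coordinates are numbered from 0, and the numeral 3 of the type \<open>3\<close> is 0.\<close>

lemma index_3_cases: "(j :: 3) = 0 \<or> j = 1 \<or> j = 2"
proof -
  have "(3 :: 3) = 0" by simp
  then show ?thesis using exhaust_3[of j] by auto
qed

lemma affine_map_linear: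
  fixes L :: "'e::euclidean_space \<Rightarrow> 'f::real_normed_vector"
  assumes "linear L" "\<And>x. h x = L x + b"
  shows "affine_map h"
  using assms by (intro affine_mapI) (auto simp: linear_conv_bounded_linear)

lemma dform_scale:
  "bounded_linear f \<Longrightarrow> dform (\<lambda>v. c * f v) = fscale (\<lambda>_. c) (dform f)"
  by (intro ext) (auto simp: dform_bounded_linear bounded_linear_compose[OF bounded_linear_mult_right, of f c]
      fscale_def split: list.split)

lemma complex_extension_add:
  "complex_extension (\<lambda>l. a l + b l) ps = complex_extension a ps + complex_extension b ps"
  by (induction ps arbitrary: a b) (auto simp: algebra_simps)

lemma complex_extension_scale: "complex_extension (\<lambda>l. c * a l) ps = c * complex_extension a ps"
  by (induction ps arbitrary: a) (auto simp: algebra_simps)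

lemma complex_extension_map:
  "complex_extension a (map (map_prod f f) ps) = complex_extension (\<lambda>l. a (map f l)) ps"
  by (induction ps arbitrary: a) auto

lemma alternating_insert:
  assumes "alternating a"
  shows "alternating (\<lambda>l. a (u # l))"
proof -
  have "linear (\<lambda>v. a ((u # us) @ v # vs))" "a ((u # us) @ v # v # vs) = 0" for us v vs
    using assms by (simp_all only: alternating_def)
  then show ?thesis by (simp add: alternating_def)
qed

text \<open>In the expansion for two equal pairs \<open>(u, w)\<close> the terms with \<open>u, u\<close> and \<open>w, w\<close> vanish, and those with \<open>u, w\<close>
  and \<open>w, u\<close> cancel.\<close>

lemma alternating_complex_extension:
  assumes "alternating a"
  shows "linear (\<lambda>p. complex_extension a (us @ p # vs))" "complex_extension a (us @ p # p # vs) = 0"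
proof -
  have "linear (\<lambda>p. complex_extension a (us @ p # vs)) \<and> complex_extension a (us @ p # p # vs) = 0"
    using assms
  proof (induction us arbitrary: a)
    case Nil
    have lin: "linear (\<lambda>v. a (ws @ v # l))" and zero: "a (ws @ v # v # l) = 0" for ws v l
      using Nil by (auto simp: alternating_def)
    have add: "a ((x + y) # l) = a (x # l) + a (y # l)" for x y l
      using linear_add[OF lin[of "[]"]] by simp
    have add2: "a (z # (x + y) # l) = a (z # x # l) + a (z # y # l)" for x y z l
      using linear_add[OF lin[of "[z]"]] by simp
    have scale: "a (r *\<^sub>R x # l) = of_real r * a (x # l)" for r x l
      using linear_cmul[OF lin[of "[]"]] by (simp add: scaleR_conv_of_real)
    have anti: "a (x # y # l) = - 1 * a (y # x # l)" for x y l
    proof -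
      have "a ((x + y) # (x + y) # l) = 0" using zero[of "[]"] by simp
      then have "a (x # y # l) + a (y # x # l) = 0"
        using zero[of "[]"] by (simp add: add add2 add.commute)
      then show ?thesis by (simp add: add_eq_0_iff)
    qed
    have swap: "complex_extension (\<lambda>l. a (x # y # l)) vs = - complex_extension (\<lambda>l. a (y # x # l)) vs" for x y
      unfolding anti[of x y] complex_extension_scale by simp
    have self: "complex_extension (\<lambda>l. a (x # x # l)) vs = 0" for x
      using swap[of x x] by simp
    have "linear (\<lambda>p. complex_extension a (p # vs))"
    proof (rule linearI)
      fix p q :: "'a \<times> 'a" and r :: real
      show "complex_extension a ((p + q) # vs) = complex_extension a (p # vs) + complex_extension a (q # vs)"
        by (simp add: add complex_extension_add algebra_simps)
      show "complex_extension a ((r *\<^sub>R p) # vs) = r *\<^sub>R complex_extension a (p # vs)"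
        by (simp add: scale complex_extension_scale algebra_simps scaleR_conv_of_real)
    qed
    moreover have "complex_extension a (p # p # vs) = 0"
      using swap[of "fst p" "snd p"] self by (simp add: algebra_simps)
    ultimately show ?case by simp
  next
    case (Cons u us)
    have IH: "linear (\<lambda>p. complex_extension (\<lambda>l. a (w # l)) (us @ p # vs))"
      "complex_extension (\<lambda>l. a (w # l)) (us @ p # p # vs) = 0" for w
      using Cons.IH[OF alternating_insert[OF Cons.prems]] by auto
    have "linear (\<lambda>p. complex_extension (\<lambda>l. a (fst u # l)) (us @ p # vs) +
        \<i> * complex_extension (\<lambda>l. a (snd u # l)) (us @ p # vs))"
      by (intro linear_compose_add linear_mult_const IH)
    then show ?case by (simp add: IH)
  qed
  then show "linear (\<lambda>p. complex_extension a (us @ p # vs))" "complex_extension a (us @ p # p # vs) = 0"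
    by auto
qed

lemma linear_switch_vec: "linear switch_vec"
  by (rule linearI)
    (auto simp: switch_vec_def complex_vec_def re_vec_def im_vec_def vec_eq_iff complex_eq_iff algebra_simps)

lemma alternating_polarization_switch:
  assumes "alternating_form \<alpha>"
  shows "alternating_form (polarization_switch \<alpha>)"
proof (rule alternating_formI)
  have alt: "alternating (\<alpha> x)" for x using assms by (simp add: alternating_form_def)
  show "linear (\<lambda>v. polarization_switch \<alpha> x (us @ v # vs))" for x us vs
    using linear_compose[OF linear_switch_vec alternating_complex_extension(1)[OF alt]]
    by (simp add: polarization_switch_def comp_def)
  show "polarization_switch \<alpha> x (us @ v # v # vs) = 0" for x us v vs
    by (simp add: polarization_switch_def alternating_complex_extension(2)[OF alt])
qed

lemma smooth_polarization_switch:
  assumes "smooth_form \<alpha>"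
  shows "smooth_form (polarization_switch \<alpha>)"
proof -
  have "smooth_on UNIV (\<lambda>x. complex_extension (\<gamma> x) ps)"
    if "\<And>l. smooth_on UNIV (\<lambda>x. \<gamma> x l)" for \<gamma> :: "complex ^ 3 \<Rightarrow> (complex ^ 3) list \<Rightarrow> complex" and ps
    using that
  proof (induction ps arbitrary: \<gamma>)
    case (Cons p ps)
    show ?case
      unfolding complex_extension.simps by (intro smooth_add smooth_mult smooth_const Cons)
  qed simp
  then show ?thesis using assms unfolding smooth_form_def polarization_switch_def by blast
qed

text \<open>The polarization switch only sees the splitting of the tangent space of \<open>TU\<close> into two copies of
  \<open>\<real>\<^sup>3\<close>; it is therefore natural for maps that act on both copies by the same linear map.\<close>

lemma polarization_switch_pullback:
  assumes h: "affine_map h" and B: "linear B"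
    and hB: "\<And>v. h v - h 0 = complex_vec (B (re_vec v)) (B (im_vec v))"
  shows "polarization_switch (pullback h \<alpha>) = pullback h (polarization_switch \<alpha>)"
proof (intro ext)
  fix x vs
  let ?A = "\<lambda>v. h v - h 0"
  have rv: "re_vec (complex_vec u w) = u" "im_vec (complex_vec u w) = w" for u w
    by (auto simp: re_vec_def im_vec_def complex_vec_def)
  have "switch_vec (?A v) = map_prod ?A ?A (switch_vec v)" for v
    unfolding hB
    by (simp add: switch_vec_def rv linear_0[OF B] linear_add[OF B] linear_diff[OF B] linear_cmul[OF B])
  then have "map switch_vec (map ?A vs) = map (map_prod ?A ?A) (map switch_vec vs)" by simp
  then have "pullback h (polarization_switch \<alpha>) x vs =
      complex_extension (\<alpha> (h x)) (map (map_prod ?A ?A) (map switch_vec vs))"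
    by (simp only: pullback_affine[OF h] polarization_switch_def)
  also have "\<dots> = polarization_switch (pullback h \<alpha>) x vs"
    by (simp only: complex_extension_map polarization_switch_def pullback_affine[OF h, abs_def])
  finally show "polarization_switch (pullback h \<alpha>) x vs = pullback h (polarization_switch \<alpha>) x vs" ..
qed

type_synonym fibre_point = "(real ^ 3) \<times> (real ^ 3) \<times> (real ^ 3)"

definition to_tangent :: "fibre_point \<Rightarrow> complex ^ 3" where
  "to_tangent = (\<lambda>(r, \<theta>', \<theta>). complex_vec \<theta>' r)"

definition poincare_form :: "fibre_point form" where
  "poincare_form = (\<Sum>j\<in>UNIV. dform (\<lambda>(r, \<theta>', \<theta>). of_real (\<theta>' $ j)) \<and>\<^sub>d dform (\<lambda>(r, \<theta>', \<theta>). of_real (\<theta> $ j)))"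

definition fourier_kernel :: "(complex ^ 3) form \<Rightarrow> fibre_point form" where
  "fourier_kernel \<alpha> = pullback to_tangent (polarization_switch \<alpha>) \<and>\<^sub>d fexp poincare_form"

lemma fourier_mukai_kernel: "fourier_mukai L \<alpha> = fibre_integral L (fourier_kernel \<alpha>)"
  by (simp add: fourier_mukai_def fourier_kernel_def to_tangent_def poincare_form_def)

lemma linear_to_tangent: "linear to_tangent"
  by (rule linearI) (auto simp: to_tangent_def complex_vec_def vec_eq_iff complex_eq_iff)

lemma affine_to_tangent: "affine_map to_tangent"
  by (rule affine_map_linear[OF linear_to_tangent, where b=0]) simp

lemma bounded_linear_fibre_coordinates:
  "bounded_linear ((\<lambda>(r, \<theta>', \<theta>). of_real (\<theta>' $ j)) :: fibre_point \<Rightarrow> complex)" (is "bounded_linear ?f")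
  "bounded_linear ((\<lambda>(r, \<theta>', \<theta>). of_real (\<theta> $ j)) :: fibre_point \<Rightarrow> complex)" (is "bounded_linear ?g")
proof -
  have "linear ?f" "linear ?g" by (auto intro!: linearI simp: complex_eq_iff)
  then show "bounded_linear ?f" "bounded_linear ?g" unfolding linear_conv_bounded_linear by this+
qed

lemma alternating_poincare: "alternating_form poincare_form"
  unfolding poincare_form_def
  by (intro alternating_sum alternating_wedge alternating_dform bounded_linear_fibre_coordinates)

lemma smooth_poincare: "smooth_form poincare_form"
  unfolding poincare_form_def
  by (intro smooth_form_sum smooth_wedge smooth_dform bounded_linear_fibre_coordinates)

lemma alternating_fourier_kernel: "alternating_form \<alpha> \<Longrightarrow> alternating_form (fourier_kernel \<alpha>)"
  unfolding fourier_kernel_def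
  by (intro alternating_wedge alternating_pullback affine_to_tangent alternating_polarization_switch
      alternating_fexp alternating_poincare)

lemma smooth_fourier_kernel: "smooth_form \<alpha> \<Longrightarrow> smooth_form (fourier_kernel \<alpha>)"
  unfolding fourier_kernel_def
  by (intro smooth_wedge smooth_pullback affine_to_tangent smooth_polarization_switch
      smooth_fexp smooth_poincare)

definition diag_act :: "real ^ 3 \<Rightarrow> real ^ 3 \<Rightarrow> real ^ 3" where
  "diag_act d v = (\<chi> j. d $ j * v $ j)"

lemma linear_diag_act: "linear (diag_act d)"
  by (rule linearI) (auto simp: diag_act_def vec_eq_iff algebra_simps)

lemma diag_act_zero [simp]: "diag_act d 0 = 0"
  by (rule linear_0[OF linear_diag_act])

definition inv_vec :: "real ^ 3 \<Rightarrow> real ^ 3" where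
  "inv_vec d = (\<chi> j. inverse (d $ j))"

text \<open>The affine maps induced by a deck transformation of the base with diagonal linear part \<open>d\<close>: tangent
  vectors transform by \<open>d\<close> and cotangent vectors by its inverse, up to translations in the fibres. The third
  map is the common lift of the first two to the fibre product.\<close>

definition tangent_act :: "real ^ 3 \<Rightarrow> real ^ 3 \<Rightarrow> real ^ 3 \<Rightarrow> complex ^ 3 \<Rightarrow> complex ^ 3" where
  "tangent_act d t t' \<zeta> = complex_vec (diag_act d (re_vec \<zeta>) + t') (diag_act d (im_vec \<zeta>) + t)"

definition cotangent_act :: "real ^ 3 \<Rightarrow> real ^ 3 \<Rightarrow> real ^ 3 \<Rightarrow> (real ^ 3) \<times> (real ^ 3) \<Rightarrow> (real ^ 3) \<times> (real ^ 3)" where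
  "cotangent_act d t l p = (diag_act d (fst p) + t, diag_act (inv_vec d) (snd p) + l)"

definition fibre_act :: "real ^ 3 \<Rightarrow> real ^ 3 \<Rightarrow> real ^ 3 \<Rightarrow> real ^ 3 \<Rightarrow> fibre_point \<Rightarrow> fibre_point" where
  "fibre_act d t t' l p = (diag_act d (fst p) + t, diag_act d (fst (snd p)) + t',
     diag_act (inv_vec d) (snd (snd p)) + l)"

lemma tangent_act_linear_part:
  "tangent_act d t t' v - tangent_act d t t' 0 = complex_vec (diag_act d (re_vec v)) (diag_act d (im_vec v))"
  by (simp add: tangent_act_def diag_act_def complex_vec_def re_vec_def im_vec_def vec_eq_iff complex_eq_iff)

lemma affine_tangent_act: "affine_map (tangent_act d t t')"
proof (rule affine_map_linear[where b = "complex_vec t' t"])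
  show "linear (\<lambda>\<zeta>. complex_vec (diag_act d (re_vec \<zeta>)) (diag_act d (im_vec \<zeta>)))"
    by (rule linearI) (auto simp: diag_act_def complex_vec_def re_vec_def im_vec_def vec_eq_iff complex_eq_iff algebra_simps)
qed (simp add: tangent_act_def complex_vec_def vec_eq_iff complex_eq_iff)

lemma cotangent_act_linear_part:
  "cotangent_act d t l v - cotangent_act d t l 0 = (diag_act d (fst v), diag_act (inv_vec d) (snd v))"
  by (simp add: cotangent_act_def)

lemma affine_cotangent_act: "affine_map (cotangent_act d t l)"
proof (rule affine_map_linear[where b = "(t, l)"])
  show "linear (\<lambda>p. (diag_act d (fst p), diag_act (inv_vec d) (snd p)))"
    by (rule linearI) (auto simp: linear_add[OF linear_diag_act] linear_cmul[OF linear_diag_act])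
qed (simp add: cotangent_act_def)

lemma fibre_act_linear_part:
  "fibre_act d t t' l v - fibre_act d t t' l 0 =
    (diag_act d (fst v), diag_act d (fst (snd v)), diag_act (inv_vec d) (snd (snd v)))"
  by (simp add: fibre_act_def)

lemma affine_fibre_act: "affine_map (fibre_act d t t' l)"
proof (rule affine_map_linear[where b = "(t, t', l)"])
  show "linear (\<lambda>p. (diag_act d (fst p), diag_act d (fst (snd p)), diag_act (inv_vec d) (snd (snd p))))"
    by (rule linearI) (auto simp: linear_add[OF linear_diag_act] linear_cmul[OF linear_diag_act])
qed (simp add: fibre_act_def)

lemma fscale_one: "fscale (\<lambda>_. 1) \<alpha> = \<alpha>"
  by (intro ext) (simp add: fscale_def)

text \<open>The factors \<open>d\<^sub>j\<close> from \<open>d\<theta>'\<^sub>j\<close> and \<open>1 / d\<^sub>j\<close> from \<open>d\<theta>\<^sub>j\<close> cancel.\<close>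

lemma poincare_form_invariant:
  assumes "\<And>j. d $ j \<noteq> 0"
  shows "pullback (fibre_act d t t' l) poincare_form = poincare_form"
proof -
  have "pullback (fibre_act d t t' l) (dform (\<lambda>(r, \<theta>', \<theta>). of_real (\<theta>' $ j))) =
      fscale (\<lambda>_. of_real (d $ j)) (dform (\<lambda>(r, \<theta>', \<theta>). of_real (\<theta>' $ j)))"
    "pullback (fibre_act d t t' l) (dform (\<lambda>(r, \<theta>', \<theta>). of_real (\<theta> $ j))) =
      fscale (\<lambda>_. of_real (inverse (d $ j))) (dform (\<lambda>(r, \<theta>', \<theta>). of_real (\<theta> $ j)))" for j
    unfolding pullback_dform[OF affine_fibre_act bounded_linear_fibre_coordinates(1)]
      pullback_dform[OF affine_fibre_act bounded_linear_fibre_coordinates(2)] fibre_act_linear_part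
      dform_scale[OF bounded_linear_fibre_coordinates(1), symmetric]
      dform_scale[OF bounded_linear_fibre_coordinates(2), symmetric]
    by (simp_all add: diag_act_def inv_vec_def case_prod_beta)
  then show ?thesis
    using assms
    unfolding poincare_form_def pullback_sum pullback_wedge
    by (simp add: fscale_wedge_fscale fscale_one flip: of_real_inverse of_real_mult)
qed

lemma fourier_kernel_invariant:
  assumes d: "\<And>j. d $ j \<noteq> 0" and inv: "pullback (tangent_act d t t') \<alpha> = \<alpha>"
  shows "pullback (fibre_act d t t' l) (fourier_kernel \<alpha>) = fourier_kernel \<alpha>"
proof -
  have comm: "to_tangent \<circ> fibre_act d t t' l = tangent_act d t t' \<circ> to_tangent"
    by (auto simp: fun_eq_iff to_tangent_def fibre_act_def tangent_act_def re_vec_def im_vec_def complex_vec_def)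
  have "pullback (fibre_act d t t' l) (pullback to_tangent (polarization_switch \<alpha>)) =
      pullback to_tangent (pullback (tangent_act d t t') (polarization_switch \<alpha>))"
    by (simp add: comm affine_to_tangent affine_fibre_act affine_tangent_act flip: pullback_comp_affine)
  also have "pullback (tangent_act d t t') (polarization_switch \<alpha>) = polarization_switch \<alpha>"
    using polarization_switch_pullback[OF affine_tangent_act linear_diag_act tangent_act_linear_part, of d t t' \<alpha>]
    by (simp add: inv)
  finally show ?thesis
    by (simp add: fourier_kernel_def pullback_wedge pullback_fexp poincare_form_invariant[OF d])
qed

lemma integral_parallelepiped_const:
  fixes L :: "real ^ 3 ^ 3" and c :: complex
  shows "integral ((*v) L ` cbox 0 1) (\<lambda>_. c) = of_real (measure lebesgue ((*v) L ` cbox 0 1)) * c"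
proof -
  let ?S = "(*v) L ` cbox 0 1"
  have "compact ?S"
    by (intro compact_continuous_image compact_cbox linear_continuous_on matrix_vector_mul_bounded_linear)
  then have S: "?S \<in> lmeasurable" by (rule lmeasurable_compact)
  have "integral ?S ((\<lambda>r. r *\<^sub>R c) \<circ> (\<lambda>_. 1)) = integral ?S (\<lambda>_. 1) *\<^sub>R c"
    by (rule integral_linear[OF integrable_on_const[OF S] bounded_linear_scaleR_left])
  then show ?thesis
    by (simp add: comp_def lmeasure_integral[OF S] scaleR_conv_of_real)
qed

text \<open>The lift of a tangent vector of \<open>T*B/\<Lambda>*\<close> used in \<open>fibre_integral\<close>; it also lifts points to the zero section.\<close>

definition zero_lift :: "(real ^ 3) \<times> (real ^ 3) \<Rightarrow> fibre_point" where
  "zero_lift v = (fst v, 0, snd v)"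

definition fibre_frame :: "fibre_point list" where
  "fibre_frame = [(0, axis 0 1, 0), (0, axis 1 1, 0), (0, axis 2 1, 0)]"

lemma linear_zero_lift: "linear zero_lift"
  by (rule linearI) (auto simp: zero_lift_def)

text \<open>The kernel is invariant under translations in \<open>\<theta>'\<close> because \<open>\<alpha>\<close> is, so a constant is integrated.\<close>

lemma fourier_mukai_explicit:
  assumes "\<And>t'. pullback (tangent_act 1 0 t') \<alpha> = \<alpha>"
  shows "fourier_mukai L \<alpha> x vs = of_real (measure lebesgue ((*v) L ` cbox 0 1)) *
    fourier_kernel \<alpha> (zero_lift x) (map zero_lift vs @ fibre_frame)"
proof -
  have lin1: "diag_act 1 v = v" "diag_act (inv_vec 1) v = v" for v
    by (auto simp: diag_act_def inv_vec_def vec_eq_iff)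
  have const: "fourier_kernel \<alpha> (fst x, \<theta>', snd x) ws = fourier_kernel \<alpha> (zero_lift x) ws" for \<theta>' ws
  proof -
    have "fourier_kernel \<alpha> (zero_lift x) ws =
        pullback (fibre_act 1 0 \<theta>' 0) (fourier_kernel \<alpha>) (zero_lift x) ws"
      by (subst fourier_kernel_invariant[OF _ assms]) auto
    also have "\<dots> = fourier_kernel \<alpha> (fst x, \<theta>', snd x) ws"
      unfolding pullback_affine[OF affine_fibre_act] fibre_act_linear_part
      by (simp add: lin1 fibre_act_def zero_lift_def)
    finally show ?thesis ..
  qed
  have "fourier_mukai L \<alpha> x vs = integral ((*v) L ` cbox 0 1)
      (\<lambda>\<theta>'. fourier_kernel \<alpha> (fst x, \<theta>', snd x) (map zero_lift vs @ fibre_frame))"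
    by (simp add: fourier_mukai_kernel fibre_integral_def fibre_frame_def zero_lift_def[abs_def])
  then show ?thesis by (simp only: const integral_parallelepiped_const)
qed

lemma alternating_fourier_mukai:
  assumes "\<And>t'. pullback (tangent_act 1 0 t') \<alpha> = \<alpha>" and "alternating_form \<alpha>"
  shows "alternating_form (fourier_mukai L \<alpha>)"
proof (rule alternating_formI)
  note alt = alternating_formD[OF alternating_fourier_kernel[OF assms(2)]]
  have "linear (\<lambda>v. fourier_kernel \<alpha> (zero_lift x) (map zero_lift us @ zero_lift v # (map zero_lift vs @ fibre_frame)))"
    for x us vs
    by (rule linear_compose[OF linear_zero_lift alt(1), unfolded comp_def])
  then show "linear (\<lambda>v. fourier_mukai L \<alpha> x (us @ v # vs))" for x us vs
    unfolding fourier_mukai_explicit[OF assms(1)] by (intro linear_mult_const) simp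
  show "fourier_mukai L \<alpha> x (us @ v # v # vs) = 0" for x us v vs
    unfolding fourier_mukai_explicit[OF assms(1)] by (simp add: alt(2))
qed

lemma smooth_fourier_mukai:
  assumes "\<And>t'. pullback (tangent_act 1 0 t') \<alpha> = \<alpha>" and "smooth_form \<alpha>"
  shows "smooth_form (fourier_mukai L \<alpha>)"
proof -
  have aff: "affine_map zero_lift"
    by (rule affine_map_linear[OF linear_zero_lift, where b=0]) simp
  have "smooth_on UNIV (\<lambda>x. fourier_kernel \<alpha> x ws)" for ws
    using smooth_fourier_kernel[OF assms(2)] unfolding smooth_form_def by blast
  from smooth_mult[OF smooth_const smooth_comp_affine[OF aff this]]
  show ?thesis
    unfolding smooth_form_def fourier_mukai_explicit[OF assms(1)] by blast
qed

text \<open>By naturality of the kernel, replacing the frame \<open>e\<^sub>j\<close> of the fibre by its image \<open>d\<^sub>j e\<^sub>j\<close> gives the value at the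
  original point. By multilinearity that replacement contributes the factor \<open>d\<^sub>0 d\<^sub>1 d\<^sub>2 = 1\<close>.\<close>

lemma fourier_mukai_invariant:
  assumes trans: "\<And>t'. pullback (tangent_act 1 0 t') \<alpha> = \<alpha>" and alt: "alternating_form \<alpha>"
    and inv: "pullback (tangent_act d t 0) \<alpha> = \<alpha>" and d: "d $ 0 * d $ 1 * d $ 2 = 1"
  shows "pullback (cotangent_act d t l) (fourier_mukai L \<alpha>) = fourier_mukai L \<alpha>"
proof (intro ext)
  fix x vs
  let ?\<beta> = "fourier_kernel \<alpha>" and ?F = "fibre_act d t 0 l"
  let ?F' = "\<lambda>v. ?F v - ?F 0"
  have d0: "d $ j \<noteq> 0" for j using d index_3_cases[of j] by auto
  note lin = linear_cmul[OF alternating_formD(1)[OF alternating_fourier_kernel[OF alt]]]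
  let ?e = "\<lambda>j. (0, axis j 1, 0) :: fibre_point"
  have frame: "?F' (?e j) = d $ j *\<^sub>R ?e j" for j
    unfolding fibre_act_linear_part by (auto simp: diag_act_def vec_eq_iff axis_def)
  have "?\<beta> y (ws @ map ?F' fibre_frame) = ?\<beta> y (ws @ fibre_frame)" for y ws
  proof -
    have "?\<beta> y (ws @ map ?F' fibre_frame) = ?\<beta> y (ws @ [d $ 0 *\<^sub>R ?e 0, d $ 1 *\<^sub>R ?e 1, d $ 2 *\<^sub>R ?e 2])"
      unfolding fibre_frame_def list.map frame ..
    also have "\<dots> = d $ 0 *\<^sub>R ?\<beta> y (ws @ [?e 0, d $ 1 *\<^sub>R ?e 1, d $ 2 *\<^sub>R ?e 2])"
      by (rule lin)
    also have "?\<beta> y (ws @ [?e 0, d $ 1 *\<^sub>R ?e 1, d $ 2 *\<^sub>R ?e 2]) =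
        d $ 1 *\<^sub>R ?\<beta> y (ws @ [?e 0, ?e 1, d $ 2 *\<^sub>R ?e 2])"
      using lin[of y "ws @ [?e 0]" "d $ 1" "?e 1" "[d $ 2 *\<^sub>R ?e 2]"] by simp
    also have "?\<beta> y (ws @ [?e 0, ?e 1, d $ 2 *\<^sub>R ?e 2]) = d $ 2 *\<^sub>R ?\<beta> y (ws @ [?e 0, ?e 1, ?e 2])"
      using lin[of y "ws @ [?e 0, ?e 1]" "d $ 2" "?e 2" "[]"] by simp
    finally show ?thesis using d by (simp add: fibre_frame_def mult.assoc)
  qed
  moreover have "zero_lift (cotangent_act d t l v - cotangent_act d t l 0) = ?F' (zero_lift v)" for v
    unfolding cotangent_act_linear_part fibre_act_linear_part by (simp add: zero_lift_def)
  then have "map zero_lift (map (\<lambda>v. cotangent_act d t l v - cotangent_act d t l 0) vs) = map ?F' (map zero_lift vs)"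
    by simp
  moreover have "zero_lift (cotangent_act d t l x) = ?F (zero_lift x)"
    by (simp add: zero_lift_def cotangent_act_def fibre_act_def)
  ultimately have "?\<beta> (zero_lift (cotangent_act d t l x))
      (map zero_lift (map (\<lambda>v. cotangent_act d t l v - cotangent_act d t l 0) vs) @ fibre_frame) =
    ?\<beta> (?F (zero_lift x)) (map ?F' (map zero_lift vs @ fibre_frame))"
    by (simp only: map_append)
  also have "\<dots> = pullback ?F ?\<beta> (zero_lift x) (map zero_lift vs @ fibre_frame)"
    by (simp only: pullback_affine[OF affine_fibre_act])
  also have "\<dots> = ?\<beta> (zero_lift x) (map zero_lift vs @ fibre_frame)"
    by (simp only: fourier_kernel_invariant[OF d0 inv])
  finally show "pullback (cotangent_act d t l) (fourier_mukai L \<alpha>) x vs = fourier_mukai L \<alpha> x vs"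
    unfolding pullback_affine[OF affine_cotangent_act] fourier_mukai_explicit[OF trans] by simp
qed


section \<open>Torus fibrations over a quotient of the base\<close>

lemma section_atlas_euclidean: "open V \<Longrightarrow> section_atlas (\<lambda>x. x) V (euclidean_atlas V)"
  by (auto simp: section_atlas_def euclidean_atlas_def)

lemma deck_maps_identity: "deck_maps (\<lambda>x. x) V {id}"
  by (auto simp: deck_maps_def affine_map_id id_def)

text \<open>Near \<open>x\<close> the chart is the deck transformation that takes \<open>x\<close> into \<open>V\<close>.\<close>

lemma orbit_chart_lifts:
  fixes G :: "('e::euclidean_space \<Rightarrow> 'e) set"
  assumes G: "affine_group G" and V: "open V" "inj_on (orbit_of G) V"
  shows "lifts_to (orbit_of G) UNIV (orbit_of G ` V) (\<lambda>x. x) V (inv_into V (orbit_of G)) G"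
  unfolding lifts_to_def
proof (intro ballI impI)
  fix x assume "orbit_of G x \<in> orbit_of G ` V"
  then obtain v where v: "v \<in> V" "orbit_of G x = orbit_of G v" by auto
  then have "\<exists>g\<in>G. v = g x" by (simp add: orbit_of_eq_iff[OF G])
  then obtain g where g: "g \<in> G" "v = g x" by blast
  have aff: "affine_map g" by (rule affine_groupD(1)[OF G g(1)])
  have "inv_into V (orbit_of G) (orbit_of G x') = g x'" if "x' \<in> g -` V" for x'
  proof -
    have "orbit_of G x' = orbit_of G (g x')" using g(1) by (auto simp: orbit_of_eq_iff[OF G])
    then show ?thesis using that V(2) by simp
  qed
  moreover have "open (g -` V)" by (intro open_vimage V(1) continuous_affine aff)
  ultimately show "\<exists>h\<in>G. \<exists>N. affine_map h \<and> open N \<and> x \<in> N \<and>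
      (\<forall>x'\<in>N \<inter> UNIV. h x' \<in> V \<and> inv_into V (orbit_of G) (orbit_of G x') = h x')"
    by (intro bexI[of _ g] exI[of _ "g -` V"] conjI aff) (use g v in auto)
qed

lemma diffeomorphism_orbit_chart:
  fixes G :: "('e::euclidean_space \<Rightarrow> 'e) set"
  assumes G: "affine_group G" "free_proper G" and V: "open V" "inj_on (orbit_of G) V"
  shows "diffeomorphism (open_submanifold (quotient_atlas UNIV G) (orbit_of G ` V)) (euclidean_atlas V)
    (inv_into V (orbit_of G))"
proof -
  let ?A = "open_submanifold (quotient_atlas UNIV G) (orbit_of G ` V)"
  let ?f = "inv_into V (orbit_of G)"
  have A: "section_atlas (orbit_of G) UNIV ?A"
    by (intro section_atlas_open_submanifold section_atlas_quotient open_orbit_preimage G V)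
  have carA: "carrier_of ?A = orbit_of G ` V"
    unfolding carrier_open_submanifold carrier_quotient_atlas[OF G open_UNIV] by auto
  have carE: "carrier_of (euclidean_atlas V) = V"
    by (simp add: carrier_of_def euclidean_atlas_def)
  have bij: "bij_betw ?f (orbit_of G ` V) V"
    using V(2) by (simp add: bij_betw_inv_into inj_on_imp_bij_betw)
  have inv: "inv_into (orbit_of G ` V) ?f x = orbit_of G x" if "x \<in> V" for x
    using that V(2) bij by (intro inv_into_f_eq) (auto simp: bij_betw_def)
  have "smooth_map ?A (euclidean_atlas V) ?f"
    by (rule smooth_map_lift[OF A section_atlas_euclidean[OF V(1)] deck_maps_identity])
      (use orbit_chart_lifts[OF G(1) V] bij in \<open>simp_all add: carA carE bij_betw_def\<close>)
  moreover have "smooth_map (euclidean_atlas V) ?A (inv_into (carrier_of ?A) ?f)"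
  proof (rule smooth_map_lift[OF section_atlas_euclidean[OF V(1)] A deck_maps_orbit_of[OF G(1)]])
    show "lifts_to (\<lambda>x. x) V (carrier_of (euclidean_atlas V)) (orbit_of G) UNIV
        (inv_into (carrier_of ?A) ?f) {\<lambda>x. x}"
      unfolding lifts_to_def
    proof (intro ballI impI)
      fix x assume "x \<in> V"
      show "\<exists>h\<in>{\<lambda>x. x}. \<exists>N. affine_map h \<and> open N \<and> x \<in> N \<and>
          (\<forall>x'\<in>N \<inter> V. h x' \<in> UNIV \<and> inv_into (carrier_of ?A) ?f x' = orbit_of G (h x'))"
        by (rule bexI[of _ "\<lambda>x. x"], rule exI[of _ UNIV]) (simp_all add: affine_map_id inv carA)
    qed
    show "inv_into (carrier_of ?A) ?f ` carrier_of (euclidean_atlas V) \<subseteq> carrier_of ?A"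
      by (auto simp: carE carA inv)
  qed auto
  ultimately show ?thesis using bij by (simp add: diffeomorphism_def carA carE)
qed

text \<open>In the coordinates given by \<open>J\<close> the fibration is induced by \<open>b\<close>. The group \<open>B\<close> is the group of transformations
  that \<open>G\<close> induces on the base, and \<open>H\<close> is the subgroup of \<open>G\<close> acting trivially there, written in the coordinates
  of \<open>J\<close>.\<close>

locale torus_fibration =
  fixes G :: "('e::euclidean_space \<Rightarrow> 'e) set" and H :: "('f::euclidean_space \<Rightarrow> 'f) set"
    and J :: "'e \<Rightarrow> 'f" and K :: "'f \<Rightarrow> 'e" and b :: "'f \<Rightarrow> 'b::euclidean_space" and B :: "('b \<Rightarrow> 'b) set"
  assumes G: "affine_group G" "free_proper G" and B: "affine_group B" "free_proper B"
    and H: "affine_group H" and J: "affine_map J" and K: "affine_map K" and b: "affine_map b" "surj b"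
    and KJ: "\<And>x. K (J x) = x" and JK: "\<And>z. J (K z) = z"
    and down: "\<And>g. g \<in> G \<Longrightarrow> \<exists>g'\<in>B. \<forall>x. b (J (g x)) = g' (b (J x))"
    and up: "\<And>g'. g' \<in> B \<Longrightarrow> \<exists>g\<in>G. \<forall>x. b (J (g x)) = g' (b (J x))"
    and H_up: "\<And>h. h \<in> H \<Longrightarrow> \<exists>g\<in>G. \<forall>z. J (g (K z)) = h z \<and> b (h z) = b z"
    and H_down: "\<And>g. g \<in> G \<Longrightarrow> (\<And>x. b (J (g x)) = b (J x)) \<Longrightarrow> \<exists>h\<in>H. \<forall>z. J (g (K z)) = h z"
begin

abbreviation fibration :: "'e set \<Rightarrow> 'b set" where
  "fibration \<equiv> image (b \<circ> J)"

text \<open>The transformations in \<open>B\<close> are exactly those induced by \<open>G\<close>, so a whole orbit of \<open>B\<close> is reached.\<close>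

lemma fibration_orbit: "fibration (orbit_of G x) = orbit_of B (b (J x))"
proof (intro equalityI subsetI)
  fix r assume "r \<in> fibration (orbit_of G x)"
  then obtain g where g: "g \<in> G" "r = b (J (g x))" by (auto simp: orbit_of_def)
  then obtain g' where "g' \<in> B" "r = g' (b (J x))" using down[OF g(1)] by metis
  then show "r \<in> orbit_of B (b (J x))" by (auto simp: orbit_of_def)
next
  fix r assume "r \<in> orbit_of B (b (J x))"
  then obtain g' where g': "g' \<in> B" "r = g' (b (J x))" by (auto simp: orbit_of_def)
  then obtain g where "g \<in> G" "r = b (J (g x))" using up[OF g'(1)] by metis
  then show "r \<in> fibration (orbit_of G x)" by (auto simp: orbit_of_def)
qed

lemma fibration_lifts: "lifts_to (orbit_of G) UNIV D (orbit_of B) UNIV fibration {b \<circ> J}"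
  unfolding lifts_to_def
proof (intro ballI impI)
  fix x assume "orbit_of G x \<in> D"
  show "\<exists>h\<in>{b \<circ> J}. \<exists>N. affine_map h \<and> open N \<and> x \<in> N \<and>
      (\<forall>x'\<in>N \<inter> UNIV. h x' \<in> UNIV \<and> fibration (orbit_of G x') = orbit_of B (h x'))"
    by (rule bexI[of _ "b \<circ> J"], rule exI[of _ UNIV])
      (use affine_map_comp[OF b(1) J] fibration_orbit in \<open>simp_all add: comp_def\<close>)
qed

lemma fibration_carrier:
  "fibration ` carrier_of (quotient_atlas UNIV G) = carrier_of (quotient_atlas UNIV B)"
proof -
  have "surj (b \<circ> J)" using b(2) JK by (metis comp_surj surjI)
  then have "range (\<lambda>x. orbit_of B ((b \<circ> J) x)) = range (orbit_of B)" by (metis image_image)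
  then show ?thesis
    unfolding carrier_quotient_atlas[OF G open_UNIV] carrier_quotient_atlas[OF B open_UNIV] image_image
    by (simp only: fibration_orbit[unfolded image_def] fibration_orbit comp_apply)
qed

lemma smooth_map_fibration: "smooth_map (quotient_atlas UNIV G) (quotient_atlas UNIV B) fibration"
  by (rule smooth_map_lift[OF section_atlas_quotient section_atlas_quotient deck_maps_orbit_of[OF B(1)]
        fibration_lifts]) (use fibration_carrier in auto)

lemma free_proper_fibre_group: "free_proper H"
proof (rule free_proper_inj[OF G(2), of K])
  show "inj K" by (metis JK injI)
  show "continuous_on UNIV K" by (rule continuous_affine[OF K])
  fix h assume "h \<in> H"
  then obtain g where g: "g \<in> G" "\<And>z. J (g (K z)) = h z" using H_up by blast
  have "K (h z) = g (K z)" for z using KJ[of "g (K z)"] by (simp add: g(2))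
  then show "\<exists>g\<in>G. \<forall>z. K (h z) = g (K z)" using g(1) by blast
qed

text \<open>A member of \<open>G\<close> that relates two points over \<open>V\<close> induces a transformation that relates their base points.
  These coincide because \<open>V\<close> injects into the base, and a transformation of \<open>B\<close> with a fixed point is trivial;
  so the given member of \<open>G\<close> comes from \<open>H\<close>.\<close>

lemma orbit_restriction_chart:
  assumes V: "open V" "inj_on (orbit_of B) V"
  shows "orbit_restriction G H J K (b -` V) (fibration -` (orbit_of B ` V))"
proof
  show "open (b -` V)" by (intro open_vimage V continuous_affine b)
  fix z assume z: "z \<in> b -` V"
  show "orbit_of H z = J ` orbit_of G (K z) \<inter> b -` V"
  proof (intro equalityI subsetI)
    fix w assume "w \<in> orbit_of H z"
    then obtain h where h: "h \<in> H" "w = h z" by (auto simp: orbit_of_def)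
    obtain g where g: "g \<in> G" "J (g (K z)) = h z" "b (h z) = b z" using H_up[OF h(1)] by blast
    have "g (K z) \<in> orbit_of G (K z)" using g(1) by (auto simp: orbit_of_def)
    then have "J (g (K z)) \<in> J ` orbit_of G (K z)" by (rule imageI)
    then show "w \<in> J ` orbit_of G (K z) \<inter> b -` V" using g h z by simp
  next
    fix w assume "w \<in> J ` orbit_of G (K z) \<inter> b -` V"
    then obtain g where g: "g \<in> G" "w = J (g (K z))" "b w \<in> V" by (auto simp: orbit_of_def)
    obtain g' where g': "g' \<in> B" "\<And>x. b (J (g x)) = g' (b (J x))" using down[OF g(1)] by blast
    have bw: "b w = g' (b z)" using g'(2)[of "K z"] g(2) by (simp add: JK)
    then have "orbit_of B (b z) = orbit_of B (b w)" using g'(1) by (auto simp: orbit_of_eq_iff[OF B(1)])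
    then have "b w = b z" using inj_onD[OF V(2)] g(3) z by auto
    then have "g' = id" using B(2) g'(1) bw unfolding free_proper_def by metis
    then have "\<And>x. b (J (g x)) = b (J x)" using g'(2) by simp
    then obtain h where "h \<in> H" "J (g (K z)) = h z" using H_down[OF g(1)] by blast
    then show "w \<in> orbit_of H z" using g(2) by (auto simp: orbit_of_def)
  qed
next
  fix x
  have "orbit_of G x \<in> fibration -` (orbit_of B ` V) \<longleftrightarrow> (\<exists>g'\<in>B. g' (b (J x)) \<in> V)"
  proof -
    have "orbit_of G x \<in> fibration -` (orbit_of B ` V) \<longleftrightarrow> (\<exists>v\<in>V. orbit_of B (b (J x)) = orbit_of B v)"
      unfolding vimage_eq fibration_orbit by (simp only: image_iff)
    then show ?thesis unfolding orbit_of_eq_iff[OF B(1)] by blast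
  qed
  also have "\<dots> \<longleftrightarrow> (\<exists>g\<in>G. J (g x) \<in> b -` V)"
  proof
    assume "\<exists>g'\<in>B. g' (b (J x)) \<in> V"
    then obtain g' where g': "g' \<in> B" "g' (b (J x)) \<in> V" by blast
    obtain g where "g \<in> G" "b (J (g x)) = g' (b (J x))" using up[OF g'(1)] by blast
    then show "\<exists>g\<in>G. J (g x) \<in> b -` V"
      using g'(2) by (intro bexI[of _ g]) simp_all
  next
    assume "\<exists>g\<in>G. J (g x) \<in> b -` V"
    then obtain g where g: "g \<in> G" "b (J (g x)) \<in> V" by auto
    obtain g' where "g' \<in> B" "b (J (g x)) = g' (b (J x))" using down[OF g(1)] by blast
    then show "\<exists>g'\<in>B. g' (b (J x)) \<in> V"
      using g(2) by (intro bexI[of _ g']) simp_all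
  qed
  finally show "orbit_of G x \<in> fibration -` (orbit_of B ` V) \<longleftrightarrow> (\<exists>g\<in>G. J (g x) \<in> b -` V)" .
qed (use G H J K KJ JK free_proper_fibre_group in auto)

lemma base_of_trivialisation:
  assumes V: "inj_on (orbit_of B) V"
    and y: "y \<in> carrier_of (quotient_atlas UNIV G)" and z: "z \<in> J ` y \<inter> b -` V"
  shows "b z = inv_into V (orbit_of B) (fibration y)"
proof -
  obtain x where x: "y = orbit_of G x" using y carrier_quotient_atlas[OF G open_UNIV] by blast
  obtain x' where x': "x' \<in> orbit_of G x" "z = J x'" using z x by blast
  have "y = orbit_of G x'" using x x'(1) orbit_of_mem_iff[OF G(1)] by blast
  then have "fibration y = orbit_of B (b z)" by (simp only: fibration_orbit x'(2))
  then show ?thesis using V z by simp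
qed

end


section \<open>The Nakamura groups\<close>

lemma vec012_nth [simp]: "vec012 a b c $ 0 = a" "vec012 a b c $ 1 = b" "vec012 a b c $ 2 = c"
  by (simp_all add: vec012_def)

lemma vec3_eq_iff: "(x :: 'a ^ 3) = y \<longleftrightarrow> x $ 0 = y $ 0 \<and> x $ 1 = y $ 1 \<and> x $ 2 = y $ 2"
proof
  assume "x $ 0 = y $ 0 \<and> x $ 1 = y $ 1 \<and> x $ 2 = y $ 2"
  then have "x $ k = y $ k" for k using index_3_cases[of k] by (elim disjE) simp_all
  then show "x = y" by (simp add: vec_eq_iff)
qed simp

lemma sum_3: "(\<Sum>j\<in>UNIV. f (j :: 3)) = f 0 + f 1 + f 2"
proof -
  have U: "UNIV = {0, 1, 2 :: 3}" using index_3_cases by auto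
  show ?thesis by (subst U) (simp add: add.assoc)
qed

lemma vec2_eq_iff: "(x :: 'a ^ 2) = y \<longleftrightarrow> x $ 1 = y $ 1 \<and> x $ 2 = y $ 2"
proof
  assume "x $ 1 = y $ 1 \<and> x $ 2 = y $ 2"
  then have "x $ k = y $ k" for k using exhaust_2[of k] by (elim disjE) simp_all
  then show "x = y" by (simp add: vec_eq_iff)
qed simp

definition integral_vec :: "real ^ 'n \<Rightarrow> bool" where
  "integral_vec m \<longleftrightarrow> (\<forall>i. m $ i \<in> \<int>)"

lemma integral_vec_simps [intro]:
  "integral_vec 0" "integral_vec m \<Longrightarrow> integral_vec n \<Longrightarrow> integral_vec (m + n)"
  "integral_vec m \<Longrightarrow> integral_vec (- m)"
  by (auto simp: integral_vec_def)

definition hyp_vec :: "real \<Rightarrow> real \<Rightarrow> real ^ 3" where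
  "hyp_vec lam a = vec012 1 (exp (lam * a)) (exp (- lam * a))"

lemma hyp_vec_zero: "hyp_vec lam 0 = 1"
  by (simp add: hyp_vec_def vec3_eq_iff)

lemma inv_hyp_vec: "inv_vec (hyp_vec lam a) = vec012 1 (exp (- lam * a)) (exp (lam * a))"
  by (simp add: hyp_vec_def vec3_eq_iff inv_vec_def exp_minus)

text \<open>Invariance of \<open>Q \<int>\<^sup>2\<close> under the integral powers of \<open>diag (e\<^sup>\<lambda>, e\<^sup>-\<^sup>\<lambda>)\<close>, which is what the group law of
  \<open>\<complex> \<ltimes> \<complex>\<^sup>2\<close> requires of the lattices in the second factor.\<close>

definition invariant_lattice :: "real \<Rightarrow> real ^ 2 ^ 2 \<Rightarrow> bool" where
  "invariant_lattice lam Q \<longleftrightarrow> (\<forall>a\<in>\<int>. \<forall>m. integral_vec m \<longrightarrow> (\<exists>m'. integral_vec m' \<and>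
     (Q *v m') $ 1 = exp (lam * a) * (Q *v m) $ 1 \<and> (Q *v m') $ 2 = exp (- lam * a) * (Q *v m) $ 2))"

definition nak_el :: "real \<Rightarrow> real \<Rightarrow> real ^ 2 \<Rightarrow> real ^ 2 \<Rightarrow> complex ^ 3" where
  "nak_el a c u v = vec012 (Complex a c) (Complex (u $ 1) (v $ 1)) (Complex (u $ 2) (v $ 2))"

lemma nak_lattice_el:
  "nak_lattice s P Q = {nak_el a (s * c) (P *v m) (Q *v n) | a c m n.
     a \<in> \<int> \<and> c \<in> \<int> \<and> integral_vec m \<and> integral_vec n}"
  by (simp add: nak_lattice_def nak_el_def integral_vec_def)

lemma nak_latticeI:
  assumes "a \<in> \<int>" "c \<in> \<int>" "integral_vec m" "integral_vec n"
  shows "nak_el a (s * c) (P *v m) (Q *v n) \<in> nak_lattice s P Q"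
  unfolding nak_lattice_el using assms by blast

lemma nak_mult_assoc: "nak_mult lam (nak_mult lam g h) p = nak_mult lam g (nak_mult lam h p)"
  by (simp add: nak_mult_def vec3_eq_iff exp_add exp_diff exp_minus divide_inverse algebra_simps)

lemma nak_mult_zero: "nak_mult lam 0 = id"
  by (simp add: nak_mult_def vec3_eq_iff fun_eq_iff)

lemma affine_nak_mult: "affine_map (nak_mult lam g)"
proof (rule affine_map_linear[where b = g])
  show "linear (\<lambda>p. vec012 (p $ 0) (of_real (exp (lam * Re (g $ 0))) * p $ 1)
     (of_real (exp (- lam * Re (g $ 0))) * p $ 2) :: complex ^ 3)"
    by (rule linearI) (auto simp: vec3_eq_iff algebra_simps)
qed (simp add: nak_mult_def vec3_eq_iff)

lemma neg_vec: "A *v (- v) = - (A *v v)" for A :: "real ^ 'n ^ 'm" and v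
  using matrix_vector_mult_diff_distrib[of A 0 v] by simp

lemma affine_group_nak:
  assumes P: "invariant_lattice lam P" and Q: "invariant_lattice lam Q"
  shows "affine_group (nak_mult lam ` nak_lattice s P Q)"
proof -
  let ?\<Gamma> = "nak_lattice s P Q"
  have "nak_el 0 (s * 0) (P *v 0) (Q *v 0) \<in> ?\<Gamma>" 
    by (intro nak_latticeI) auto
  moreover have "nak_el 0 (s * 0) (P *v 0) (Q *v 0) = 0"
    by (simp add: nak_el_def vec3_eq_iff complex_eq_iff)
  ultimately have zero: "0 \<in> ?\<Gamma>" by simp
  have closed: "nak_mult lam g h \<in> ?\<Gamma>" if "g \<in> ?\<Gamma>" "h \<in> ?\<Gamma>" for g h
  proof -
    from that(1) obtain a c m n where g: "g = nak_el a (s * c) (P *v m) (Q *v n)"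
      "a \<in> \<int>" "c \<in> \<int>" "integral_vec m" "integral_vec n"
      unfolding nak_lattice_el by blast
    from that(2) obtain a' c' m' n' where h: "h = nak_el a' (s * c') (P *v m') (Q *v n')"
      "a' \<in> \<int>" "c' \<in> \<int>" "integral_vec m'" "integral_vec n'"
      unfolding nak_lattice_el by blast
    obtain m'' where m'': "integral_vec m''" "(P *v m'') $ 1 = exp (lam * a) * (P *v m') $ 1"
      "(P *v m'') $ 2 = exp (- lam * a) * (P *v m') $ 2"
      using P g(2) h(4) unfolding invariant_lattice_def by blast
    obtain n'' where n'': "integral_vec n''" "(Q *v n'') $ 1 = exp (lam * a) * (Q *v n') $ 1"
      "(Q *v n'') $ 2 = exp (- lam * a) * (Q *v n') $ 2"
      using Q g(2) h(5) unfolding invariant_lattice_def by blast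
    have "nak_mult lam g h = nak_el (a + a') (s * (c + c')) (P *v (m'' + m)) (Q *v (n'' + n))"
      by (simp add: g(1) h(1) nak_mult_def nak_el_def vec3_eq_iff complex_eq_iff m'' n''
          matrix_vector_right_distrib algebra_simps)
    then show ?thesis
      using g h m''(1) n''(1) by (auto intro!: nak_latticeI)
  qed
  have inverse: "\<exists>h\<in>?\<Gamma>. nak_mult lam h g = 0" if "g \<in> ?\<Gamma>" for g
  proof -
    from that obtain a c m n where g: "g = nak_el a (s * c) (P *v m) (Q *v n)"
      "a \<in> \<int>" "c \<in> \<int>" "integral_vec m" "integral_vec n"
      unfolding nak_lattice_el by blast
    have a: "- a \<in> \<int>" using g(2) by simp
    obtain m'' where m'': "integral_vec m''" "(P *v m'') $ 1 = exp (lam * - a) * (P *v m) $ 1"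
      "(P *v m'') $ 2 = exp (- lam * - a) * (P *v m) $ 2"
      using P a g(4) unfolding invariant_lattice_def by blast
    obtain n'' where n'': "integral_vec n''" "(Q *v n'') $ 1 = exp (lam * - a) * (Q *v n) $ 1"
      "(Q *v n'') $ 2 = exp (- lam * - a) * (Q *v n) $ 2"
      using Q a g(5) unfolding invariant_lattice_def by blast
    let ?h = "nak_el (- a) (s * (- c)) (P *v (- m'')) (Q *v (- n''))"
    have "?h \<in> ?\<Gamma>"
      using a g m''(1) n''(1) by (intro nak_latticeI) auto
    moreover have "nak_mult lam ?h g = 0"
      by (simp add: g(1) nak_mult_def nak_el_def vec3_eq_iff complex_eq_iff m'' n'' neg_vec)
    ultimately show ?thesis by blast
  qed
  show ?thesis
    unfolding affine_group_def
  proof (intro conjI ballI)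
    show "id \<in> nak_mult lam ` ?\<Gamma>" using zero nak_mult_zero[of lam] by (metis imageI)
    fix f assume "f \<in> nak_mult lam ` ?\<Gamma>"
    then obtain g where g: "g \<in> ?\<Gamma>" "f = nak_mult lam g" by blast
    show "affine_map f" unfolding g(2) by (rule affine_nak_mult)
    obtain h where h: "h \<in> ?\<Gamma>" "nak_mult lam h g = 0" using inverse[OF g(1)] by blast
    have "nak_mult lam h \<circ> f = id"
      using nak_mult_assoc[of lam h g] unfolding g(2) h(2) nak_mult_zero by (simp add: fun_eq_iff)
    then show "\<exists>h\<in>nak_mult lam ` ?\<Gamma>. h \<circ> f = id" using h(1) by blast
    fix f' assume "f' \<in> nak_mult lam ` ?\<Gamma>"
    then obtain g' where g': "g' \<in> ?\<Gamma>" "f' = nak_mult lam g'" by blast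
    have "f \<circ> f' = nak_mult lam (nak_mult lam g g')"
      by (simp add: fun_eq_iff g(2) g'(2) nak_mult_assoc)
    then show "f \<circ> f' \<in> nak_mult lam ` ?\<Gamma>" using closed[OF g(1) g'(1)] by blast
  qed
qed

lemma matrix_inv_inverse:
  assumes "invertible A"
  shows "A ** matrix_inv A = mat 1" "matrix_inv A ** A = mat 1"
  using someI_ex[OF assms[unfolded invertible_def]] unfolding matrix_inv_def by auto

lemma finite_lattice_points:
  fixes Q :: "real ^ 2 ^ 2"
  assumes "invertible Q"
  shows "finite {m. integral_vec m \<and> (\<forall>i. \<bar>(Q *v m) $ i\<bar> \<le> R)}"
proof -
  define R' where "R' = \<bar>R\<bar>"
  define C where "C = (\<Sum>i\<in>UNIV. \<Sum>j\<in>UNIV. \<bar>matrix_inv Q $ i $ j\<bar> * R')"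
  let ?F = "{k :: real. k \<in> \<int> \<and> \<bar>k\<bar> \<le> C}"
  have "m \<in> (\<lambda>(x, y). vector [x, y]) ` (?F \<times> ?F)" if m: "integral_vec m" "\<forall>i. \<bar>(Q *v m) $ i\<bar> \<le> R" for m
  proof -
    have bound: "\<bar>m $ i\<bar> \<le> C" for i
    proof -
      have "m = matrix_inv Q *v (Q *v m)"
        by (simp add: matrix_vector_mul_assoc matrix_inv_inverse[OF assms])
      then have "m $ i = (matrix_inv Q *v (Q *v m)) $ i" by simp
      then have "m $ i = (\<Sum>j\<in>UNIV. matrix_inv Q $ i $ j * (Q *v m) $ j)"
        by (simp only: matrix_vector_mult_def[of "matrix_inv Q"] vec_lambda_beta)
      then have "\<bar>m $ i\<bar> \<le> (\<Sum>j\<in>UNIV. \<bar>matrix_inv Q $ i $ j * (Q *v m) $ j\<bar>)"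
        by (metis sum_abs)
      also have "\<dots> \<le> (\<Sum>j\<in>UNIV. \<bar>matrix_inv Q $ i $ j\<bar> * R')"
        unfolding abs_mult R'_def using m(2) by (intro sum_mono mult_left_mono) (auto intro: order_trans)
      also have "\<dots> \<le> C"
        unfolding C_def by (rule member_le_sum) (auto simp: R'_def intro!: sum_nonneg mult_nonneg_nonneg)
      finally show ?thesis .
    qed
    have "m = (\<lambda>(x, y). vector [x, y]) (m $ 1, m $ 2)"
      by (simp add: vec2_eq_iff)
    moreover have "(m $ 1, m $ 2) \<in> ?F \<times> ?F" using m(1) bound by (auto simp: integral_vec_def)
    ultimately show ?thesis by (rule image_eqI)
  qed
  then have "{m. integral_vec m \<and> (\<forall>i. \<bar>(Q *v m) $ i\<bar> \<le> R)} \<subseteq> (\<lambda>(x, y). vector [x, y]) ` (?F \<times> ?F)"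
    by blast
  moreover have "finite ?F" by (rule finite_abs_int_segment)
  ultimately show ?thesis by (meson finite_SigmaI finite_imageI finite_subset)
qed

lemma finite_nak_lattice_bounded:
  assumes s: "s \<noteq> 0" and PQ: "invertible P" "invertible Q"
  shows "finite {g \<in> nak_lattice s P Q. \<forall>k. norm (g $ k) \<le> R}"
proof -
  let ?A = "{a :: real. a \<in> \<int> \<and> \<bar>a\<bar> \<le> R}" and ?C = "{c :: real. c \<in> \<int> \<and> \<bar>c\<bar> \<le> R / \<bar>s\<bar>}"
  let ?M = "\<lambda>Q. {m. integral_vec m \<and> (\<forall>i. \<bar>(Q *v m) $ i\<bar> \<le> R)} :: (real ^ 2) set"
  let ?f = "\<lambda>(a, c, m, n). nak_el a (s * c) (P *v m) (Q *v n)"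
  have "g \<in> ?f ` (?A \<times> ?C \<times> ?M P \<times> ?M Q)" if "g \<in> nak_lattice s P Q" "\<forall>k. norm (g $ k) \<le> R" for g
  proof -
    from that(1) obtain a c m n where g: "g = nak_el a (s * c) (P *v m) (Q *v n)"
      "a \<in> \<int>" "c \<in> \<int>" "integral_vec m" "integral_vec n"
      unfolding nak_lattice_el by blast
    have le: "\<bar>Re (g $ k)\<bar> \<le> R" "\<bar>Im (g $ k)\<bar> \<le> R" for k
      using that(2) abs_Re_le_cmod[of "g $ k"] abs_Im_le_cmod[of "g $ k"] by (meson order_trans)+
    have "\<bar>a\<bar> \<le> R" "\<bar>s * c\<bar> \<le> R" using le[of 0] by (auto simp: g(1) nak_el_def)
    moreover have "\<bar>(P *v m) $ i\<bar> \<le> R" "\<bar>(Q *v n) $ i\<bar> \<le> R" for i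
      using le[of 1] le[of 2] exhaust_2[of i] by (auto simp: g(1) nak_el_def)
    ultimately have "(a, c, m, n) \<in> ?A \<times> ?C \<times> ?M P \<times> ?M Q"
      using g s by (auto simp: abs_mult field_simps)
    then show ?thesis using g(1) by (intro image_eqI[of _ _ "(a, c, m, n)"]) auto
  qed
  then have "{g \<in> nak_lattice s P Q. \<forall>k. norm (g $ k) \<le> R} \<subseteq> ?f ` (?A \<times> ?C \<times> ?M P \<times> ?M Q)"
    by blast
  moreover have "finite (?A \<times> ?C \<times> ?M P \<times> ?M Q)"
    by (intro finite_cartesian_product finite_abs_int_segment finite_lattice_points PQ)
  ultimately show ?thesis by (meson finite_imageI finite_subset)
qed

text \<open>The first component of \<open>g\<close> is a difference of components of the two points. This bounds the exponential
  factors, and then the remaining components of \<open>g\<close>.\<close>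

lemma nak_mult_bound:
  assumes "norm (p - x) < 1" "norm (nak_mult lam g p - y) < 1"
  shows "norm (g $ k) \<le> norm y + 1 + exp (\<bar>lam\<bar> * (norm x + norm y + 2)) * (norm x + 1)"
proof -
  let ?q = "nak_mult lam g p"
  have p: "norm (p $ k) \<le> norm x + 1" for k
    using Finite_Cartesian_Product.norm_nth_le[of p k] norm_triangle_sub[of p x] assms(1) by linarith
  have q: "norm (?q $ k) \<le> norm y + 1" for k
    using Finite_Cartesian_Product.norm_nth_le[of ?q k] norm_triangle_sub[of ?q y] assms(2) by linarith
  define E where "E = exp (\<bar>lam\<bar> * (norm x + norm y + 2))"
  have E: "1 \<le> E" unfolding E_def by simp
  have g0: "norm (g $ 0) \<le> norm x + norm y + 2"
  proof -
    have "g $ 0 = ?q $ 0 - p $ 0" by (simp add: nak_mult_def)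
    then have "norm (g $ 0) \<le> norm (?q $ 0) + norm (p $ 0)" by (metis norm_triangle_ineq4)
    then show ?thesis using p[of 0] q[of 0] by linarith
  qed
  have exp_le: "exp (l * Re (g $ 0)) \<le> E" if "\<bar>l\<bar> = \<bar>lam\<bar>" for l
  proof -
    have "l * Re (g $ 0) \<le> \<bar>l\<bar> * \<bar>Re (g $ 0)\<bar>" by (metis abs_ge_self abs_mult)
    also have "\<dots> \<le> \<bar>lam\<bar> * (norm x + norm y + 2)"
      unfolding that using abs_Re_le_cmod[of "g $ 0"] g0 by (intro mult_left_mono) auto
    finally show ?thesis by (simp add: E_def)
  qed
  have comp: "norm (g $ k) \<le> norm y + 1 + E * (norm x + 1)"
    if "g $ k = ?q $ k - of_real (exp (l * Re (g $ 0))) * p $ k" "\<bar>l\<bar> = \<bar>lam\<bar>" for k l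
  proof -
    have "norm (g $ k) \<le> norm (?q $ k) + norm (of_real (exp (l * Re (g $ 0))) * p $ k)"
      using that(1) by (metis norm_triangle_ineq4)
    also have "norm (of_real (exp (l * Re (g $ 0))) * p $ k) = exp (l * Re (g $ 0)) * norm (p $ k)"
      by (simp add: norm_mult)
    also have "\<dots> \<le> E * (norm x + 1)"
      using exp_le[OF that(2)] p[of k] E by (intro mult_mono) auto
    finally show ?thesis using q[of k] by linarith
  qed
  have "norm (g $ 0) \<le> norm y + 1 + E * (norm x + 1)"
  proof -
    have "norm x + 1 \<le> E * (norm x + 1)" using E mult_right_mono[of 1 E "norm x + 1"] by simp
    then show ?thesis using g0 by linarith
  qed
  moreover have "norm (g $ 1) \<le> norm y + 1 + E * (norm x + 1)"
    by (rule comp[where l = lam]) (simp_all add: nak_mult_def)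
  moreover have "norm (g $ 2) \<le> norm y + 1 + E * (norm x + 1)"
    by (rule comp[where l = "- lam"]) (simp_all add: nak_mult_def)
  ultimately show ?thesis using index_3_cases[of k] unfolding E_def by auto
qed

text \<open>If \<open>g\<close> has a fixed point, its first component vanishes, so the exponential factors are 1 and the other
  components vanish as well. If \<open>g\<close> moves one unit ball to meet another, \<open>g\<close> is bounded, and the lattice is discrete.\<close>

lemma free_proper_nak:
  assumes s: "s \<noteq> 0" and PQ: "invertible P" "invertible Q"
  shows "free_proper (nak_mult lam ` nak_lattice s P Q)"
  unfolding free_proper_def
proof (intro conjI ballI allI impI)
  fix f x assume "f \<in> nak_mult lam ` nak_lattice s P Q" and fx: "f x = x"
  then obtain g where g: "f = nak_mult lam g" by blast
  have eq: "nak_mult lam g x $ k = x $ k" for k using fx g by simp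
  have "g $ 0 = 0" using eq[of 0] by (simp add: nak_mult_def)
  then have "g = 0"
    using eq[of 1] eq[of 2] by (simp add: nak_mult_def vec3_eq_iff)
  then show "f = id" by (simp add: g nak_mult_zero)
next
  fix x y :: "complex ^ 3"
  define R where "R = norm y + 1 + exp (\<bar>lam\<bar> * (norm x + norm y + 2)) * (norm x + 1)"
  let ?F = "{f \<in> nak_mult lam ` nak_lattice s P Q. f ` ball x 1 \<inter> ball y 1 \<noteq> {}}"
  have "?F \<subseteq> nak_mult lam ` {g \<in> nak_lattice s P Q. \<forall>k. norm (g $ k) \<le> R}"
  proof
    fix f assume "f \<in> ?F"
    then obtain g p where g: "g \<in> nak_lattice s P Q" "f = nak_mult lam g"
      "p \<in> ball x 1" "nak_mult lam g p \<in> ball y 1" by blast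
    have "norm (g $ k) \<le> R" for k
      unfolding R_def by (rule nak_mult_bound[of p]) (use g in \<open>simp_all add: dist_norm norm_minus_commute\<close>)
    then show "f \<in> nak_mult lam ` {g \<in> nak_lattice s P Q. \<forall>k. norm (g $ k) \<le> R}"
      using g by blast
  qed
  then have "finite ?F"
    using finite_nak_lattice_bounded[OF assms] by (meson finite_imageI finite_subset)
  then show "\<exists>V W. open V \<and> x \<in> V \<and> open W \<and> y \<in> W \<and>
      finite {f \<in> nak_mult lam ` nak_lattice s P Q. f ` V \<inter> W \<noteq> {}}"
    by (intro exI[of _ "ball x 1"] exI[of _ "ball y 1"]) auto
qed


lemma mult_vec2: "(Q *v n) $ i = Q $ i $ 1 * n $ 1 + Q $ i $ 2 * n $ (2 :: 2)" for Q :: "real ^ 2 ^ 'm"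
  by (simp add: matrix_vector_mult_def UNIV_2)

definition hyp_matrix :: "real \<Rightarrow> real ^ 2 ^ 2" where
  "hyp_matrix lam = vector [vector [exp lam, 0], vector [0, exp (- lam)]]"

lemma hyp_matrix_vec: "(hyp_matrix lam *v u) $ 1 = exp lam * u $ 1" "(hyp_matrix lam *v u) $ 2 = exp (- lam) * u $ 2"
  by (simp_all add: hyp_matrix_def mult_vec2)

lemma integral_matrix_vec:
  fixes A :: "real ^ 'n ^ 'm"
  assumes "\<And>i j. A $ i $ j \<in> \<int>" "integral_vec m"
  shows "integral_vec (A *v m)"
  using assms unfolding integral_vec_def matrix_vector_mult_def by (auto intro!: Ints_sum Ints_mult)

text \<open>Applied with \<open>lam\<close> and with \<open>- lam\<close> this covers all integral powers.\<close>

lemma lattice_step_power: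
  assumes step: "\<And>m. integral_vec m \<Longrightarrow> \<exists>m'. integral_vec m' \<and>
     (Q *v m') $ 1 = exp lam * (Q *v m) $ 1 \<and> (Q *v m') $ 2 = exp (- lam) * (Q *v m) $ 2"
    and m: "integral_vec m"
  shows "\<exists>m'. integral_vec m' \<and> (Q *v m') $ 1 = exp (lam * real n) * (Q *v m) $ 1 \<and>
     (Q *v m') $ 2 = exp (- lam * real n) * (Q *v m) $ (2 :: 2)"
proof (induction n)
  case 0 show ?case using m by (intro exI[of _ m]) auto
next
  case (Suc n)
  then obtain k where k: "integral_vec k" "(Q *v k) $ 1 = exp (lam * real n) * (Q *v m) $ 1"
     "(Q *v k) $ 2 = exp (- lam * real n) * (Q *v m) $ 2" by blast
  obtain k' where k': "integral_vec k'" "(Q *v k') $ 1 = exp lam * (Q *v k) $ 1"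
     "(Q *v k') $ 2 = exp (- lam) * (Q *v k) $ 2" using step[OF k(1)] by blast
  have "exp (lam * real (Suc n)) = exp lam * exp (lam * real n)"
    "exp (- lam * real (Suc n)) = exp (- lam) * exp (- lam * real n)"
    by (simp_all add: distrib_left flip: exp_add)
  then show ?case using k k' by (intro exI[of _ k']) simp
qed

lemma invariant_lattice_conjugate:
  fixes Q A A' :: "real ^ 2 ^ 2"
  assumes A: "\<And>i j. A $ i $ j \<in> \<int>" "Q ** A = hyp_matrix lam ** Q"
    and A': "\<And>i j. A' $ i $ j \<in> \<int>" "Q ** A' = hyp_matrix (- lam) ** Q"
  shows "invariant_lattice lam Q"
proof -
  have step: "\<exists>m'. integral_vec m' \<and> (Q *v m') $ 1 = exp l * (Q *v m) $ 1 \<and> (Q *v m') $ 2 = exp (- l) * (Q *v m) $ 2"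
    if "\<And>i j. C $ i $ j \<in> \<int>" "Q ** C = hyp_matrix l ** Q" "integral_vec m" for C l m
  proof -
    have "Q *v (C *v m) = hyp_matrix l *v (Q *v m)" by (simp add: matrix_vector_mul_assoc that(2))
    then show ?thesis
      using integral_matrix_vec[OF that(1,3)] by (intro exI[of _ "C *v m"]) (simp add: hyp_matrix_vec)
  qed
  show ?thesis
    unfolding invariant_lattice_def
  proof (intro ballI allI impI)
    fix a :: real and m :: "real ^ 2" assume "a \<in> \<int>" and m: "integral_vec m"
    then obtain k where k: "a = of_int k" by (auto elim: Ints_cases)
    show "\<exists>m'. integral_vec m' \<and> (Q *v m') $ 1 = exp (lam * a) * (Q *v m) $ 1 \<and>
        (Q *v m') $ 2 = exp (- lam * a) * (Q *v m) $ 2"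
    proof (cases "k \<ge> 0")
      case True
      then have "a = real (nat k)" by (simp add: k)
      then show ?thesis using lattice_step_power[OF step[OF A] m, of "nat k"] by simp
    next
      case False
      then have "a = - real (nat (- k))" by (simp add: k)
      then show ?thesis using lattice_step_power[OF step[OF A'] m, of "nat (- k)"] by simp
    qed
  qed
qed

definition adj2 :: "real ^ 2 ^ 2 \<Rightarrow> real ^ 2 ^ 2" where
  "adj2 M = vector [vector [M $ 2 $ 2, - M $ 1 $ 2], vector [- M $ 2 $ 1, M $ 1 $ 1]]"

lemma matrix2_eq_iff: "(A :: 'a ^ 2 ^ 2) = B \<longleftrightarrow> A $ 1 $ 1 = B $ 1 $ 1 \<and> A $ 1 $ 2 = B $ 1 $ 2 \<and>
    A $ 2 $ 1 = B $ 2 $ 1 \<and> A $ 2 $ 2 = B $ 2 $ 2"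
  by (auto simp: vec2_eq_iff)

lemma mult_matrix2: "(A ** B) $ i $ j = A $ i $ 1 * B $ 1 $ j + A $ i $ 2 * B $ (2 :: 2) $ j"
  for A :: "real ^ 2 ^ 'm" and B :: "real ^ 'n ^ 2"
  by (simp add: matrix_matrix_mult_def UNIV_2)

lemma mat2_nth: "(mat 1 :: real ^ 2 ^ 2) $ 1 $ 1 = 1" "(mat 1 :: real ^ 2 ^ 2) $ 1 $ 2 = 0"
  "(mat 1 :: real ^ 2 ^ 2) $ 2 $ 1 = 0" "(mat 1 :: real ^ 2 ^ 2) $ 2 $ 2 = 1"
  by (simp_all add: mat_def)

lemma mult_adj2: "det M = 1 \<Longrightarrow> M ** adj2 M = mat 1"
  by (simp add: matrix2_eq_iff mult_matrix2 adj2_def det_2 mat2_nth algebra_simps)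

lemma hyp_matrix_inverse: "hyp_matrix (- lam) ** hyp_matrix lam = mat 1"
  by (simp add: matrix2_eq_iff mult_matrix2 hyp_matrix_def mat2_nth flip: exp_add)

lemma invariant_lattice_of_conjugate:
  fixes Q M :: "real ^ 2 ^ 2"
  assumes int: "\<And>i j. M $ i $ j \<in> \<int>" and det: "det M = 1" and QM: "Q ** M = hyp_matrix lam ** Q"
  shows "invariant_lattice lam Q"
proof (rule invariant_lattice_conjugate[OF int QM])
  have "hyp_matrix (- lam) ** Q = hyp_matrix (- lam) ** (Q ** (M ** adj2 M))"
    by (simp add: mult_adj2[OF det])
  also have "\<dots> = (hyp_matrix (- lam) ** hyp_matrix lam) ** Q ** adj2 M"
    using QM by (simp add: matrix_mul_assoc)
  also have "\<dots> = Q ** adj2 M" by (simp add: hyp_matrix_inverse)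
  finally show "Q ** adj2 M = hyp_matrix (- lam) ** Q" ..
  show "adj2 M $ i $ j \<in> \<int>" for i j
    using int exhaust_2[of i] exhaust_2[of j] by (auto simp: adj2_def)
qed

lemma invertible_transpose_inv:
  fixes P :: "real ^ 2 ^ 2"
  assumes "invertible P"
  shows "transpose P ** transpose (matrix_inv P) = mat 1" "transpose (matrix_inv P) ** transpose P = mat 1"
  by (simp_all add: matrix_inv_inverse[OF assms] flip: matrix_transpose_mul)

text \<open>The hypothesis reads \<open>P M = D P\<close> with \<open>D\<close> diagonal; transposing it and multiplying by \<open>P\<^sup>-\<^sup>T\<close> gives
  \<open>P\<^sup>-\<^sup>T M\<^sup>T = D P\<^sup>-\<^sup>T\<close>. The inverse of \<open>M\<close> is integral because \<open>det M = 1\<close>.\<close>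

lemma invariant_lattices:
  fixes P M :: "real ^ 2 ^ 2"
  assumes int: "\<And>i j. M $ i $ j \<in> \<int>" and det: "det M = 1" and P: "invertible P"
    and conj: "P ** M ** matrix_inv P = hyp_matrix lam"
  shows "invariant_lattice lam P" "invariant_lattice lam (transpose (matrix_inv P))"
proof -
  have "P ** M = P ** M ** (matrix_inv P ** P)" by (simp add: matrix_inv_inverse[OF P])
  also have "\<dots> = hyp_matrix lam ** P" using conj by (simp add: matrix_mul_assoc)
  finally show "invariant_lattice lam P" by (rule invariant_lattice_of_conjugate[OF int det])
  let ?T = "transpose (matrix_inv P)"
  have "transpose (hyp_matrix lam) = hyp_matrix lam"
    by (simp add: matrix2_eq_iff transpose_def hyp_matrix_def)
  then have "?T ** transpose M ** transpose P = hyp_matrix lam"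
    by (simp add: matrix_mul_assoc flip: conj matrix_transpose_mul)
  then have "?T ** transpose M ** (transpose P ** ?T) = hyp_matrix lam ** ?T"
    by (simp add: matrix_mul_assoc)
  then have "?T ** transpose M = hyp_matrix lam ** ?T"
    by (simp add: invertible_transpose_inv[OF P])
  then show "invariant_lattice lam ?T"
    by (rule invariant_lattice_of_conjugate[rotated 2]) (auto simp: transpose_def int det det_transpose[unfolded transpose_def])
qed

lemma S_matrix_vec: "((S_matrix ** R) *v n) $ 1 = (R *v n) $ 2" "((S_matrix ** R) *v n) $ 2 = (R *v n) $ 1"
  for R :: "real ^ 2 ^ 2"
  by (simp_all add: mult_vec2 mult_matrix2 S_matrix_def)

text \<open>Exchanging the coordinates turns the diagonal matrix into its inverse, so \<open>a\<close> is replaced by \<open>- a\<close>.\<close>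

lemma invariant_lattice_swap:
  assumes "invariant_lattice lam R"
  shows "invariant_lattice lam (S_matrix ** R)"
  unfolding invariant_lattice_def S_matrix_vec
proof (intro ballI allI impI)
  fix a :: real and m :: "real ^ 2" assume am: "a \<in> \<int>" "integral_vec m"
  then have "- a \<in> \<int>" by simp
  then obtain m' where m': "integral_vec m'" "(R *v m') $ 1 = exp (lam * - a) * (R *v m) $ 1"
    "(R *v m') $ 2 = exp (- lam * - a) * (R *v m) $ 2"
    using assms am(2) unfolding invariant_lattice_def by blast
  then show "\<exists>m'. integral_vec m' \<and> (R *v m') $ 2 = exp (lam * a) * (R *v m) $ 2 \<and>
      (R *v m') $ 1 = exp (- lam * a) * (R *v m) $ 1"
    by (intro exI[of _ m']) simp
qed

lemma invertible_swap:
  assumes "invertible R"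
  shows "invertible (S_matrix ** R)"
proof -
  have S: "S_matrix ** S_matrix = mat 1"
    by (simp add: matrix2_eq_iff mult_matrix2 S_matrix_def mat2_nth)
  have "(S_matrix ** R) ** (matrix_inv R ** S_matrix) = S_matrix ** (R ** matrix_inv R) ** S_matrix"
    "(matrix_inv R ** S_matrix) ** (S_matrix ** R) = matrix_inv R ** (S_matrix ** S_matrix) ** R"
    by (simp_all add: matrix_mul_assoc)
  then show ?thesis
    unfolding invertible_def by (intro exI[of _ "matrix_inv R ** S_matrix"]) (simp add: S matrix_inv_inverse[OF assms])
qed

section \<open>The torus fibrations of the Nakamura manifolds\<close>

definition N_to_tangent :: "complex ^ 3 \<Rightarrow> complex ^ 3" where
  "N_to_tangent p = vec012 (\<i> * p $ 0) (p $ 1) (p $ 2)"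

definition M_from_cotangent :: "(real ^ 3) \<times> (real ^ 3) \<Rightarrow> complex ^ 3" where
  "M_from_cotangent z = vec012 (Complex (fst z $ 0) (- snd z $ 0)) (Complex (fst z $ 1) (- snd z $ 2))
     (Complex (fst z $ 2) (- snd z $ 1))"

lemma re_im_vec_nth [simp]: "re_vec \<zeta> $ j = Re (\<zeta> $ j)" "im_vec \<zeta> $ j = Im (\<zeta> $ j)"
  "complex_vec u v $ j = Complex (u $ j) (v $ j)"
  by (simp_all add: re_vec_def im_vec_def complex_vec_def)

lemma diag_act_nth [simp]: "diag_act d v $ j = d $ j * v $ j"
  by (simp add: diag_act_def)

lemma N_tangent_inverse: "N_from_tangent (N_to_tangent p) = p" "N_to_tangent (N_from_tangent \<zeta>) = \<zeta>"
  by (simp_all add: N_from_tangent_def N_to_tangent_def vec3_eq_iff)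

lemma M_cotangent_inverse: "M_from_cotangent (M_to_cotangent p) = p" "M_to_cotangent (M_from_cotangent z) = z"
  by (simp_all add: M_from_cotangent_def M_to_cotangent_def vec3_eq_iff complex_eq_iff prod_eq_iff)

lemma affine_N_to_tangent: "affine_map N_to_tangent"
  by (rule affine_map_linear[where L = N_to_tangent and b = 0])
    (auto intro!: linearI simp: N_to_tangent_def vec3_eq_iff algebra_simps)

lemma affine_N_from_tangent: "affine_map N_from_tangent"
  by (rule affine_map_linear[where L = N_from_tangent and b = 0])
    (auto intro!: linearI simp: N_from_tangent_def vec3_eq_iff algebra_simps)

lemma affine_M_to_cotangent: "affine_map M_to_cotangent"
  by (rule affine_map_linear[where L = M_to_cotangent and b = 0])
    (auto intro!: linearI simp: M_to_cotangent_def vec3_eq_iff algebra_simps)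

lemma affine_M_from_cotangent: "affine_map M_from_cotangent"
  by (rule affine_map_linear[where L = M_from_cotangent and b = 0])
    (auto intro!: linearI simp: M_from_cotangent_def vec3_eq_iff complex_eq_iff algebra_simps)

lemma hyp_vec_nth: "hyp_vec lam a $ 0 = 1" "hyp_vec lam a $ 1 = exp (lam * a)" "hyp_vec lam a $ 2 = exp (- lam * a)"
  by (simp_all add: hyp_vec_def)

text \<open>The imaginary parts \<open>r\<close> and the real parts \<open>\<theta>'\<close> of \<open>(i w, z\<^sub>1, z\<^sub>2)\<close> are stretched by the same factors.\<close>

lemma N_to_tangent_mult:
  "N_to_tangent (nak_mult lam g p) = tangent_act (hyp_vec lam (Re (g $ 0))) (im_vec (N_to_tangent g))
     (re_vec (N_to_tangent g)) (N_to_tangent p)"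
  by (simp add: N_to_tangent_def nak_mult_def tangent_act_def vec3_eq_iff complex_eq_iff hyp_vec_def)

text \<open>As \<open>\<theta>\<^sub>1 = - y\<^sub>2\<close> and \<open>\<theta>\<^sub>2 = - y\<^sub>1\<close>, the fibre coordinates are stretched by the factors inverse to those of the
  base coordinates \<open>x\<^sub>1\<close> and \<open>x\<^sub>2\<close>.\<close>

lemma M_to_cotangent_mult:
  "M_to_cotangent (nak_mult lam g p) = cotangent_act (hyp_vec lam (Re (g $ 0))) (fst (M_to_cotangent g))
     (snd (M_to_cotangent g)) (M_to_cotangent p)"
  by (simp add: M_to_cotangent_def nak_mult_def cotangent_act_def vec3_eq_iff inv_hyp_vec hyp_vec_nth)

text \<open>This one shape covers the translation parts of the action on the base and the elements of \<open>\<Lambda>\<close> and \<open>\<Lambda>*\<close>.\<close>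

definition base_vec :: "real ^ 2 ^ 2 \<Rightarrow> real \<Rightarrow> real ^ 2 \<Rightarrow> real ^ 3" where
  "base_vec Q a m = vec012 a ((Q *v m) $ 1) ((Q *v m) $ 2)"

lemma base_act_eq: "base_act lam P a b r = diag_act (hyp_vec lam a) r + base_vec P a b"
  by (simp add: base_act_def vec3_eq_iff hyp_vec_def mult_vec2 base_vec_def)

lemma torus_lattice_mult:
  "torus_lattice s Q *v k = base_vec Q (s * k $ 0) (vector [k $ 1, k $ 2])"
proof -
  have "(L *v k) $ i = L $ i $ 0 * k $ 0 + L $ i $ 1 * k $ 1 + L $ i $ 2 * k $ 2" for L :: "real ^ 3 ^ 3" and i
    by (simp add: matrix_vector_mult_def sum_3)
  then show ?thesis
    by (simp add: torus_lattice_def vec3_eq_iff base_vec_def mult_vec2)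
qed

lemma lattice_torus: "lattice (torus_lattice s Q) = {base_vec Q (s * c) n | c n. c \<in> \<int> \<and> integral_vec n}"
proof -
  show ?thesis
  proof (intro equalityI subsetI)
    fix l assume "l \<in> lattice (torus_lattice s Q)"
    then obtain k where k: "l = torus_lattice s Q *v k" "\<forall>i. k $ i \<in> \<int>" by (auto simp: lattice_def)
    moreover have "integral_vec (vector [k $ 1, k $ 2] :: real ^ 2)"
      using k(2) by (auto simp: integral_vec_def forall_2)
    ultimately show "l \<in> {base_vec Q (s * c) n | c n. c \<in> \<int> \<and> integral_vec n}"
      unfolding torus_lattice_mult by blast
  next
    fix l assume "l \<in> {base_vec Q (s * c) n | c n. c \<in> \<int> \<and> integral_vec n}"
    then obtain c n where l: "l = base_vec Q (s * c) n" "c \<in> \<int>" "integral_vec n" by blast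
    let ?k = "vec012 c (n $ 1) (n $ 2)"
    have "l = torus_lattice s Q *v ?k"
      unfolding torus_lattice_mult l(1) by (simp add: base_vec_def mult_vec2 vec3_eq_iff)
    moreover have "?k $ i \<in> \<int>" for i
      using l index_3_cases[of i] by (auto simp: integral_vec_def)
    ultimately show "l \<in> lattice (torus_lattice s Q)" unfolding lattice_def by blast
  qed
qed

text \<open>Pairing with \<open>P n\<close> is pairing of the transposed image with \<open>n\<close>, so integrality on the lattice means that
  \<open>P\<^sup>T (\<theta>\<^sub>1, \<theta>\<^sub>2)\<close> and \<open>\<tau> \<theta>\<^sub>0\<close> are integral.\<close>

lemma dual_lattice_torus:
  assumes tau: "tau \<noteq> 0" and P: "invertible P"
  shows "dual_lattice (lattice (torus_lattice tau P)) = lattice (torus_lattice (1 / tau) (transpose (matrix_inv P)))"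
proof -
  let ?T = "transpose (matrix_inv P)"
  have inner: "\<theta> \<bullet> base_vec P a n = \<theta> $ 0 * a + vector [\<theta> $ 1, \<theta> $ 2] \<bullet> (P *v n)" for \<theta> a n
    by (simp add: inner_vec_def sum_3 base_vec_def UNIV_2)
  have adj: "u \<bullet> (P *v n) = (transpose P *v u) \<bullet> n" for u n :: "real ^ 2"
    by (simp add: inner_vec_def UNIV_2 mult_vec2 transpose_def algebra_simps)
  show ?thesis
  proof (intro equalityI subsetI)
    fix \<theta> assume \<theta>: "\<theta> \<in> dual_lattice (lattice (torus_lattice tau P))"
    have \<theta>': "\<theta> $ 0 * (tau * c) + (transpose P *v vector [\<theta> $ 1, \<theta> $ 2]) \<bullet> n \<in> \<int>"
      if "c \<in> \<int>" "integral_vec n" for c n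
      using \<theta> that unfolding dual_lattice_def lattice_torus adj[symmetric] inner[symmetric] by blast
    let ?n = "transpose P *v vector [\<theta> $ 1, \<theta> $ 2]"
    have "\<theta> $ 0 * tau \<in> \<int>" using \<theta>'[of 1 0] by auto
    moreover have "?n $ i \<in> \<int>" for i
    proof -
      have "integral_vec (axis i 1 :: real ^ 2)" by (simp add: integral_vec_def axis_def)
      from \<theta>'[OF Ints_0 this] show ?thesis by (simp add: inner_axis)
    qed
    then have "integral_vec ?n" by (simp add: integral_vec_def)
    moreover have "?T *v ?n = vector [\<theta> $ 1, \<theta> $ 2]"
      by (simp only: matrix_vector_mul_assoc invertible_transpose_inv[OF P] matrix_vector_mul_lid)
    then have "\<theta> = base_vec ?T ((1 / tau) * (\<theta> $ 0 * tau)) ?n"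
      using tau unfolding base_vec_def by (simp del: transpose_matrix_vector add: vec3_eq_iff)
    ultimately show "\<theta> \<in> lattice (torus_lattice (1 / tau) ?T)" unfolding lattice_torus by blast
  next
    fix \<theta> assume "\<theta> \<in> lattice (torus_lattice (1 / tau) ?T)"
    then obtain c n where \<theta>: "\<theta> = base_vec ?T (1 / tau * c) n" "c \<in> \<int>" "integral_vec n"
      unfolding lattice_torus by blast
    have v: "vector [\<theta> $ 1, \<theta> $ 2] = ?T *v n"
      by (simp add: \<theta>(1) base_vec_def vec2_eq_iff)
    have "\<theta> \<bullet> base_vec P (tau * c') n' \<in> \<int>" if "c' \<in> \<int>" "integral_vec n'" for c' n'
    proof -
      have "transpose P *v (?T *v n) = n"
        by (simp only: matrix_vector_mul_assoc invertible_transpose_inv[OF P] matrix_vector_mul_lid)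
      then have "\<theta> \<bullet> base_vec P (tau * c') n' = \<theta> $ 0 * (tau * c') + n \<bullet> n'"
        unfolding inner v adj by simp
      then have "\<theta> \<bullet> base_vec P (tau * c') n' = c * c' + n \<bullet> n'"
        using tau by (simp add: \<theta>(1) base_vec_def)
      moreover have "n \<bullet> n' \<in> \<int>"
        using \<theta>(3) that(2) by (auto simp: inner_vec_def integral_vec_def intro!: Ints_sum Ints_mult)
      ultimately show ?thesis using \<theta>(2) that(1) by simp
    qed
    then show "\<theta> \<in> dual_lattice (lattice (torus_lattice tau P))"
      unfolding dual_lattice_def lattice_torus by blast
  qed
qed

lemma invertible_torus_lattice:
  assumes "s \<noteq> 0" "invertible Q"
  shows "invertible (torus_lattice s Q)"
proof -
  have "inj ((*v) (torus_lattice s Q))"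
  proof (rule injI)
    fix k k' assume "torus_lattice s Q *v k = torus_lattice s Q *v k'"
    then have k0: "k $ 0 = k' $ 0" and "Q *v vector [k $ 1, k $ 2] = Q *v vector [k' $ 1, k' $ 2]"
      using assms(1) unfolding torus_lattice_mult by (auto simp: base_vec_def vec3_eq_iff vec2_eq_iff)
    then have "matrix_inv Q *v (Q *v vector [k $ 1, k $ 2]) = matrix_inv Q *v (Q *v vector [k' $ 1, k' $ 2])" by simp
    then have "vector [k $ 1, k $ 2] = (vector [k' $ 1, k' $ 2] :: real ^ 2)"
      by (simp add: matrix_vector_mul_assoc matrix_inv_inverse[OF assms(2)])
    then show "k = k'" using k0 by (simp add: vec3_eq_iff vec2_eq_iff)
  qed
  then show ?thesis by (simp add: invertible_left_inverse matrix_left_invertible_injective)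
qed


lemma lattice_subgroup:
  "0 \<in> lattice L" "u \<in> lattice L \<Longrightarrow> v \<in> lattice L \<Longrightarrow> u + v \<in> lattice L" "u \<in> lattice L \<Longrightarrow> - u \<in> lattice L"
proof -
  show "0 \<in> lattice L" unfolding lattice_def by (auto intro!: exI[of _ 0])
  show "u + v \<in> lattice L" if uv: "u \<in> lattice L" "v \<in> lattice L"
  proof -
    obtain k k' where "u = L *v k" "v = L *v k'" "\<forall>i. k $ i \<in> \<int>" "\<forall>i. k' $ i \<in> \<int>"
      using uv unfolding lattice_def by blast
    then show ?thesis
      unfolding lattice_def by (auto intro!: exI[of _ "k + k'"] simp: matrix_vector_right_distrib)
  qed
  show "- u \<in> lattice L" if u: "u \<in> lattice L"
  proof -
    obtain k where k: "u = L *v k" "\<forall>i. k $ i \<in> \<int>" using u unfolding lattice_def by blast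
    have "- u = L *v (- k)" by (simp add: k neg_vec)
    then show ?thesis unfolding lattice_def using k(2) by (auto intro!: exI[of _ "- k"])
  qed
qed

lemma lattice_translation_group:
  fixes T :: "real ^ 3 \<Rightarrow> 'e::real_normed_vector"
  assumes T: "linear T"
  shows "affine_group {(\<lambda>z. z + T l) | l. l \<in> lattice L}" (is "affine_group ?G")
  unfolding affine_group_def
proof (intro conjI ballI)
  show "id \<in> ?G"
    using lattice_subgroup(1)[of L] linear_0[OF T] by (auto simp: id_def intro!: exI[of _ 0])
  fix f assume "f \<in> ?G"
  then obtain l where l: "l \<in> lattice L" "f = (\<lambda>z. z + T l)" by blast
  show "affine_map f" unfolding l(2) by (rule affine_mapI[OF bounded_linear_ident]) simp
  have "(\<lambda>z. z + T (- l)) \<circ> f = id" by (simp add: l(2) fun_eq_iff linear_neg[OF T])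
  then show "\<exists>h\<in>?G. h \<circ> f = id" using lattice_subgroup(3)[OF l(1)] by blast
  fix f' assume "f' \<in> ?G"
  then obtain l' where l': "l' \<in> lattice L" "f' = (\<lambda>z. z + T l')" by blast
  have "f \<circ> f' = (\<lambda>z. z + T (l' + l))" by (simp add: l(2) l'(2) fun_eq_iff add.assoc linear_add[OF T])
  then show "f \<circ> f' \<in> ?G" using lattice_subgroup(2)[OF l'(1) l(1)] by blast
qed

lemma affine_group_tangent_translations:
  "affine_group {(\<lambda>\<zeta>. \<zeta> + complex_vec l 0) | l. l \<in> lattice L}"
proof (rule lattice_translation_group)
  show "linear (\<lambda>l. complex_vec l 0)" by (rule linearI) (simp_all add: vec3_eq_iff complex_eq_iff)
qed

lemma affine_group_cotangent_translations:
  "affine_group {(\<lambda>(r :: real ^ 3, \<theta>). (r, \<theta> + l)) | l :: real ^ 3. l \<in> lattice L}"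
proof -
  have "(\<lambda>z. z + (0, l)) = (\<lambda>(r :: real ^ 3, \<theta>). (r, \<theta> + l))" for l :: "real ^ 3"
    by (auto simp: fun_eq_iff)
  moreover have "linear (\<lambda>l :: real ^ 3. (0 :: real ^ 3, l))" by (rule linearI) simp_all
  from lattice_translation_group[OF this, of L]
  have "affine_group {(\<lambda>z. z + (0 :: real ^ 3, l)) | l. l \<in> lattice L}" .
  ultimately show ?thesis by (simp only:)
qed

text \<open>The hypothesis on \<open>P\<close> and the integral matrix enters through the two invariances of lattices.\<close>

locale nakamura =
  fixes lam tau :: real and P Q :: "real ^ 2 ^ 2"
  assumes tau: "tau \<noteq> 0" and P: "invertible P"
    and invP: "invariant_lattice lam P" and invT: "invariant_lattice lam (transpose (matrix_inv P))"
    and Q: "Q = S_matrix ** transpose (matrix_inv P)"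
begin

abbreviation "N_atlas \<equiv> quotient_atlas UNIV (nak_mult lam ` nak_lattice tau P P)"
abbreviation "M_atlas \<equiv> quotient_atlas UNIV (nak_mult lam ` nak_lattice (1 / tau) P Q)"
abbreviation "B_atlas \<equiv> quotient_atlas UNIV {base_act lam P a b | a b. a \<in> \<int> \<and> (\<forall>i. b $ i \<in> \<int>)}"
abbreviation "PT \<equiv> transpose (matrix_inv P)"

abbreviation "N_group \<equiv> nak_mult lam ` nak_lattice tau P P"
abbreviation "M_group \<equiv> nak_mult lam ` nak_lattice (1 / tau) P Q"
abbreviation "base_group \<equiv> {base_act lam P a b | a b. a \<in> \<int> \<and> (\<forall>i. b $ i \<in> \<int>)}"
abbreviation "N_deck a c m n \<equiv> nak_mult lam (nak_el a (tau * c) (P *v m) (P *v n))"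
abbreviation "M_deck a c m n \<equiv> nak_mult lam (nak_el a (1 / tau * c) (P *v m) (Q *v n))"
abbreviation "tangent_lattice \<equiv> lattice (torus_lattice tau P)"
abbreviation "cotangent_lattice \<equiv> lattice (torus_lattice (1 / tau) PT)"
abbreviation "tangent_translations \<equiv> {(\<lambda>\<zeta>. \<zeta> + complex_vec l 0) | l. l \<in> tangent_lattice}"
abbreviation "cotangent_translations \<equiv> {(\<lambda>(r :: real ^ 3, \<theta>). (r, \<theta> + l)) | l :: real ^ 3. l \<in> cotangent_lattice}"
abbreviation "cotangent_group \<equiv> {(\<lambda>(r, \<theta> :: real ^ 3). (base_act lam P a b r,
         vec012 (\<theta> $ 0) (exp (- lam * a) * \<theta> $ 1) (exp (lam * a) * \<theta> $ 2) + l)) | a b l.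
       a \<in> \<int> \<and> (\<forall>i. b $ i \<in> \<int>) \<and> l \<in> cotangent_lattice}"

lemma invertible_PT: "invertible PT"
  using invertible_transpose_inv[OF P] unfolding invertible_def by blast

lemma Q_vec: "(Q *v n) $ 1 = (PT *v n) $ 2" "(Q *v n) $ 2 = (PT *v n) $ 1"
  unfolding Q S_matrix_vec by (rule refl)+

lemma N_group: "affine_group N_group" "free_proper N_group"
  by (rule affine_group_nak[OF invP invP], rule free_proper_nak[OF tau P P])

lemma M_group: "affine_group M_group" "free_proper M_group"
proof -
  show "affine_group M_group"
    unfolding Q by (rule affine_group_nak[OF invP invariant_lattice_swap[OF invT]])
  show "free_proper M_group"
    unfolding Q using tau by (intro free_proper_nak P invertible_swap invertible_PT) simp
qed

lemma base_groupI: "a \<in> \<int> \<Longrightarrow> integral_vec b \<Longrightarrow> base_act lam P a b \<in> base_group"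
  unfolding integral_vec_def by blast

lemma base_groupE:
  assumes "g \<in> base_group"
  obtains a b where "a \<in> \<int>" "integral_vec b" "g = base_act lam P a b"
  using assms unfolding integral_vec_def by blast

lemma N_groupE:
  assumes "g \<in> N_group"
  obtains a c m n where "a \<in> \<int>" "c \<in> \<int>" "integral_vec m" "integral_vec n"
    "g = N_deck a c m n"
  using assms unfolding nak_lattice_el by blast

lemma M_groupE:
  assumes "g \<in> M_group"
  obtains a c m n where "a \<in> \<int>" "c \<in> \<int>" "integral_vec m" "integral_vec n"
    "g = M_deck a c m n"
  using assms unfolding nak_lattice_el by blast

lemma nak_groupI:
  assumes "a \<in> \<int>" "c \<in> \<int>" "integral_vec m" "integral_vec n"
  shows "nak_mult lam (nak_el a (s * c) (R *v m) (R' *v n)) \<in> nak_mult lam ` nak_lattice s R R'"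
  by (intro imageI nak_latticeI assms)

lemma N_act: "N_to_tangent (N_deck a c m n p) =
    tangent_act (hyp_vec lam a) (base_vec P a n) (base_vec P (tau * - c) m) (N_to_tangent p)"
proof -
  have "im_vec (N_to_tangent (nak_el a (tau * c) (P *v m) (P *v n))) = base_vec P a n"
    "re_vec (N_to_tangent (nak_el a (tau * c) (P *v m) (P *v n))) = base_vec P (tau * - c) m"
    "Re (nak_el a (tau * c) (P *v m) (P *v n) $ 0) = a"
    by (simp_all add: N_to_tangent_def nak_el_def base_vec_def vec3_eq_iff)
  then show ?thesis by (simp only: N_to_tangent_mult)
qed

lemma M_act: "M_to_cotangent (M_deck a c m n p) =
    cotangent_act (hyp_vec lam a) (base_vec P a m) (base_vec PT (1 / tau * - c) (- n)) (M_to_cotangent p)"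
proof -
  have "fst (M_to_cotangent (nak_el a (1 / tau * c) (P *v m) (Q *v n))) = base_vec P a m"
    "snd (M_to_cotangent (nak_el a (1 / tau * c) (P *v m) (Q *v n))) = base_vec PT (1 / tau * - c) (- n)"
    "Re (nak_el a (1 / tau * c) (P *v m) (Q *v n) $ 0) = a"
    unfolding M_to_cotangent_def nak_el_def base_vec_def vec3_eq_iff neg_vec
    by (simp_all del: transpose_matrix_vector add: Q_vec)
  then show ?thesis by (simp only: M_to_cotangent_mult)
qed

lemma im_tangent_act: "im_vec (tangent_act d t t' \<zeta>) = diag_act d (im_vec \<zeta>) + t"
  by (simp add: tangent_act_def vec3_eq_iff)

lemma fst_cotangent_act: "fst (cotangent_act d t l z) = diag_act d (fst z) + t"
  by (simp add: cotangent_act_def)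

lemma surj_im: "surj (\<lambda>p. im_vec (N_to_tangent p))"
proof (rule surjI)
  fix r show "im_vec (N_to_tangent (N_from_tangent (complex_vec 0 r))) = r"
    by (simp add: N_tangent_inverse vec3_eq_iff)
qed

lemma N_down:
  assumes "g \<in> N_group"
  shows "\<exists>g'\<in>base_group. \<forall>p. im_vec (N_to_tangent (g p)) = g' (im_vec (N_to_tangent p))"
proof -
  obtain a c m n where g: "a \<in> \<int>" "c \<in> \<int>" "integral_vec m" "integral_vec n"
    "g = N_deck a c m n" using assms by (rule N_groupE)
  have "im_vec (N_to_tangent (g p)) = base_act lam P a n (im_vec (N_to_tangent p))" for p
    unfolding g(5) N_act im_tangent_act base_act_eq ..
  then show ?thesis using base_groupI[OF g(1,4)] by blast
qed

text \<open>Deck transformations of the base extend to \<open>N\<close> without moving the zero section of \<open>TB\<close>.\<close>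

lemma N_up:
  assumes "g' \<in> base_group"
  shows "\<exists>g\<in>N_group. (\<forall>p. im_vec (N_to_tangent (g p)) = g' (im_vec (N_to_tangent p))) \<and>
    (\<forall>r. N_from_tangent (complex_vec 0 (g' r)) = g (N_from_tangent (complex_vec 0 r)))"
proof -
  obtain a b where g': "a \<in> \<int>" "integral_vec b" "g' = base_act lam P a b" using assms by (rule base_groupE)
  let ?g = "N_deck a 0 0 b"
  have "?g \<in> N_group" using g' by (intro nak_groupI) auto
  moreover have "im_vec (N_to_tangent (?g p)) = g' (im_vec (N_to_tangent p))" for p
    unfolding g'(3) N_act im_tangent_act base_act_eq ..
  moreover have "N_from_tangent (complex_vec 0 (g' r)) = ?g (N_from_tangent (complex_vec 0 r))" for r
  proof -
    have "N_to_tangent (?g (N_from_tangent (complex_vec 0 r))) = complex_vec 0 (g' r)"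
      unfolding N_act N_tangent_inverse g'(3) base_act_eq
      by (simp add: tangent_act_def base_vec_def vec3_eq_iff complex_eq_iff)
    then show ?thesis using N_tangent_inverse(1) by metis
  qed
  ultimately show ?thesis by blast
qed

lemma affine_base_act: "affine_map (base_act lam P a b)"
  by (rule affine_map_linear[OF linear_diag_act]) (rule base_act_eq)

text \<open>The action on the base is the image of that on \<open>N\<close> under the fibration, and embeds into it along the zero
  section; the first makes it a group, the second free and proper.\<close>

lemma base_group: "affine_group base_group" "free_proper base_group"
proof -
  show "affine_group base_group"
  proof (rule affine_group_surj[OF N_group(1) surj_im])
    fix g' assume g': "g' \<in> base_group"
    then show "affine_map g'" by (rule base_groupE) (simp only: affine_base_act)
    obtain g where g: "g \<in> N_group" "\<forall>p. im_vec (N_to_tangent (g p)) = g' (im_vec (N_to_tangent p))"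
      using N_up[OF g'] by blast
    show "\<exists>g\<in>N_group. \<forall>p. g' (im_vec (N_to_tangent p)) = im_vec (N_to_tangent (g p))"
      by (rule bexI[OF _ g(1)]) (simp add: g(2))
  next
    fix g assume "g \<in> N_group"
    from N_down[OF this] obtain g' where g': "g' \<in> base_group"
      "\<forall>p. im_vec (N_to_tangent (g p)) = g' (im_vec (N_to_tangent p))" by blast
    show "\<exists>g'\<in>base_group. \<forall>p. g' (im_vec (N_to_tangent p)) = im_vec (N_to_tangent (g p))"
      by (rule bexI[OF _ g'(1)]) (simp add: g'(2))
  qed
  have "linear (\<lambda>r. N_from_tangent (complex_vec 0 r))"
    by (rule linearI) (simp_all add: N_from_tangent_def vec3_eq_iff complex_eq_iff)
  then have "continuous_on UNIV (\<lambda>r. N_from_tangent (complex_vec 0 r))"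
    by (simp add: linear_continuous_on linear_conv_bounded_linear)
  moreover have "inj (\<lambda>r. N_from_tangent (complex_vec 0 r))"
  proof (rule injI)
    fix r r' assume "N_from_tangent (complex_vec 0 r) = N_from_tangent (complex_vec 0 r')"
    then have "complex_vec 0 r = complex_vec 0 r'" by (metis N_tangent_inverse(2))
    then show "r = r'" by (simp add: vec3_eq_iff)
  qed
  ultimately show "free_proper base_group"
  proof (intro free_proper_inj[OF N_group(2), of "\<lambda>r. N_from_tangent (complex_vec 0 r)"])
    fix g' assume "g' \<in> base_group"
    from N_up[OF this] show "\<exists>g\<in>N_group. \<forall>r. N_from_tangent (complex_vec 0 (g' r)) = g (N_from_tangent (complex_vec 0 r))"
      by blast
  qed
qed

lemma tangent_act_translation: "tangent_act (hyp_vec lam 0) 0 l \<zeta> = \<zeta> + complex_vec l 0"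
  by (simp add: tangent_act_def vec3_eq_iff hyp_vec_nth complex_eq_iff)

lemma cotangent_act_translation: "cotangent_act (hyp_vec lam 0) 0 l z = (case z of (r, \<theta>) \<Rightarrow> (r, \<theta> + l))"
  by (simp add: cotangent_act_def vec3_eq_iff hyp_vec_nth inv_hyp_vec prod_eq_iff split: prod.split)

lemma base_vec_zero: "base_vec R 0 0 = 0"
  by (simp add: base_vec_def vec3_eq_iff)

lemma affine_im_vec: "affine_map im_vec"
  by (rule affine_map_linear[where L = im_vec and b = 0]) (auto intro!: linearI simp: vec3_eq_iff)

lemma affine_fst: "affine_map (fst :: (real ^ 3) \<times> (real ^ 3) \<Rightarrow> real ^ 3)"
  by (rule affine_map_bounded_linear) (rule bounded_linear_fst)

lemma N_torus_fibration:
  "torus_fibration N_group tangent_translations N_to_tangent N_from_tangent im_vec base_group"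
proof
  show "surj im_vec"
    by (rule surjI[of _ "complex_vec 0"]) (simp add: vec3_eq_iff)
  fix g assume g: "g \<in> N_group"
  then show "\<exists>g'\<in>base_group. \<forall>x. im_vec (N_to_tangent (g x)) = g' (im_vec (N_to_tangent x))" by (rule N_down)
  assume fib: "\<And>x. im_vec (N_to_tangent (g x)) = im_vec (N_to_tangent x)"
  obtain a c m n where g: "a \<in> \<int>" "c \<in> \<int>" "integral_vec m" "integral_vec n"
    "g = N_deck a c m n" using g by (rule N_groupE)
  have t: "base_vec P a n = 0"
    using fib[of "N_from_tangent 0"] unfolding g(5) N_act im_tangent_act N_tangent_inverse
    by (simp add: vec3_eq_iff)
  have "base_vec P a n $ 0 = a" by (simp add: base_vec_def)
  then have a: "a = 0" by (simp add: t)
  have eq: "N_to_tangent (g (N_from_tangent z)) = z + complex_vec (base_vec P (tau * - c) m) 0" for z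
    unfolding g(5) N_act N_tangent_inverse t unfolding a tangent_act_translation ..
  have "- c \<in> \<int>" using g(2) by simp
  then have "base_vec P (tau * - c) m \<in> tangent_lattice"
    unfolding lattice_torus using g(3) by blast
  then have mem: "(\<lambda>\<zeta>. \<zeta> + complex_vec (base_vec P (tau * - c) m) 0) \<in> tangent_translations" by blast
  show "\<exists>h\<in>tangent_translations. \<forall>z. N_to_tangent (g (N_from_tangent z)) = h z"
    by (rule bexI[OF _ mem]) (simp add: eq)
next
  fix g' assume "g' \<in> base_group"
  then show "\<exists>g\<in>N_group. \<forall>x. im_vec (N_to_tangent (g x)) = g' (im_vec (N_to_tangent x))"
    using N_up by blast
next
  fix h assume "h \<in> tangent_translations"
  then obtain c m where h: "c \<in> \<int>" "integral_vec m" "h = (\<lambda>\<zeta>. \<zeta> + complex_vec (base_vec P (tau * c) m) 0)"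
    unfolding lattice_torus by blast
  \<comment> \<open>The sign of \<open>c\<close> comes from \<open>\<theta>'\<^sub>0 = - y\<close>.\<close>
  let ?g = "N_deck 0 (- c) m 0"
  have "?g \<in> N_group" using h by (intro nak_groupI) auto
  moreover have "N_to_tangent (?g (N_from_tangent z)) = h z" for z
    unfolding h(3) N_act N_tangent_inverse base_vec_zero tangent_act_translation by simp
  moreover have "im_vec (h z) = im_vec z" for z
    by (simp add: h(3) vec3_eq_iff)
  ultimately show "\<exists>g\<in>N_group. \<forall>z. N_to_tangent (g (N_from_tangent z)) = h z \<and> im_vec (h z) = im_vec z" by blast
qed (use N_group base_group affine_group_tangent_translations affine_N_to_tangent affine_N_from_tangent
    affine_im_vec N_tangent_inverse in auto)

lemma M_torus_fibration:
  "torus_fibration M_group cotangent_translations M_to_cotangent M_from_cotangent fst base_group"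
proof
  show "surj (fst :: (real ^ 3) \<times> (real ^ 3) \<Rightarrow> real ^ 3)" by (rule surjI[of _ "\<lambda>r. (r, 0)"]) simp
  fix g assume g: "g \<in> M_group"
  obtain a c m n where g: "a \<in> \<int>" "c \<in> \<int>" "integral_vec m" "integral_vec n"
    "g = M_deck a c m n" using g by (rule M_groupE)
  have down: "fst (M_to_cotangent (g x)) = base_act lam P a m (fst (M_to_cotangent x))" for x
    unfolding g(5) M_act fst_cotangent_act base_act_eq ..
  then show "\<exists>g'\<in>base_group. \<forall>x. fst (M_to_cotangent (g x)) = g' (fst (M_to_cotangent x))"
    using base_groupI[OF g(1,3)] by blast
  assume fib: "\<And>x. fst (M_to_cotangent (g x)) = fst (M_to_cotangent x)"
  have t: "base_vec P a m = 0"
    using fib[of "M_from_cotangent 0"] unfolding g(5) M_act fst_cotangent_act M_cotangent_inverse by simp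
  have "base_vec P a m $ 0 = a" by (simp add: base_vec_def)
  then have a: "a = 0" by (simp add: t)
  have eq: "M_to_cotangent (g (M_from_cotangent z)) =
      (case z of (r, \<theta>) \<Rightarrow> (r, \<theta> + base_vec PT (1 / tau * - c) (- n)))" for z
    unfolding g(5) M_act M_cotangent_inverse t unfolding a cotangent_act_translation ..
  have "- c \<in> \<int>" "integral_vec (- n)" using g(2,4) by auto
  then have "base_vec PT (1 / tau * - c) (- n) \<in> cotangent_lattice"
    unfolding lattice_torus by blast
  then have mem: "(\<lambda>(r :: real ^ 3, \<theta>). (r, \<theta> + base_vec PT (1 / tau * - c) (- n))) \<in> cotangent_translations" by blast
  show "\<exists>h\<in>cotangent_translations. \<forall>z. M_to_cotangent (g (M_from_cotangent z)) = h z"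
    by (rule bexI[OF _ mem]) (simp add: eq)
next
  fix g' assume "g' \<in> base_group"
  then obtain a b where g': "a \<in> \<int>" "integral_vec b" "g' = base_act lam P a b" by (rule base_groupE)
  let ?g = "M_deck a 0 b 0"
  have "?g \<in> M_group" using g' by (intro nak_groupI) auto
  moreover have "fst (M_to_cotangent (?g x)) = g' (fst (M_to_cotangent x))" for x
    unfolding g'(3) M_act fst_cotangent_act base_act_eq ..
  ultimately show "\<exists>g\<in>M_group. \<forall>x. fst (M_to_cotangent (g x)) = g' (fst (M_to_cotangent x))" by blast
next
  fix h :: "(real ^ 3) \<times> (real ^ 3) \<Rightarrow> (real ^ 3) \<times> (real ^ 3)" assume "h \<in> cotangent_translations"
  then obtain c n where h: "c \<in> \<int>" "integral_vec n" "h = (\<lambda>(r, \<theta>). (r, \<theta> + base_vec PT (1 / tau * c) n))"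
    unfolding lattice_torus by blast
  \<comment> \<open>The signs of \<open>c\<close> and \<open>n\<close> come from \<open>\<theta> = (- y, - y\<^sub>2, - y\<^sub>1)\<close>.\<close>
  let ?g = "M_deck 0 (- c) 0 (- n)"
  have "?g \<in> M_group" using h by (intro nak_groupI) auto
  moreover have "M_to_cotangent (?g (M_from_cotangent z)) = h z" for z
    unfolding h(3) M_act M_cotangent_inverse base_vec_zero cotangent_act_translation by simp
  moreover have "fst (h z) = fst z" for z
    by (simp add: h(3) split: prod.split)
  ultimately show "\<exists>g\<in>M_group. \<forall>z. M_to_cotangent (g (M_from_cotangent z)) = h z \<and> fst (h z) = fst z" by blast
qed (use M_group base_group affine_group_cotangent_translations affine_M_to_cotangent affine_M_from_cotangent
    affine_fst M_cotangent_inverse in auto)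

lemma cotangent_group_elements:
  "cotangent_group = {cotangent_act (hyp_vec lam a) (base_vec P a b) l | a b l.
     a \<in> \<int> \<and> integral_vec b \<and> l \<in> cotangent_lattice}"
proof -
  have "(\<lambda>(r, \<theta>). (base_act lam P a b r, vec012 (\<theta> $ 0) (exp (- lam * a) * \<theta> $ 1) (exp (lam * a) * \<theta> $ 2) + l)) =
      cotangent_act (hyp_vec lam a) (base_vec P a b) l" for a b l
    by (auto simp: fun_eq_iff cotangent_act_def base_act_eq vec3_eq_iff inv_hyp_vec)
  then show ?thesis by (simp only: integral_vec_def)
qed

lemma cotangent_up:
  assumes "h \<in> cotangent_group"
  shows "\<exists>g\<in>M_group. \<forall>x. h (M_to_cotangent x) = M_to_cotangent (g x)"
proof -
  obtain a b l where ab: "a \<in> \<int>" "integral_vec b" "h = cotangent_act (hyp_vec lam a) (base_vec P a b) l"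
    and l: "l \<in> cotangent_lattice"
    using assms unfolding cotangent_group_elements by (elim CollectE exE conjE)
  obtain c n where "l = base_vec PT (1 / tau * c) n" "c \<in> \<int>" "integral_vec n"
    using l unfolding lattice_torus by (elim CollectE exE conjE)
  with ab have h: "a \<in> \<int>" "integral_vec b" "c \<in> \<int>" "integral_vec n"
    "h = cotangent_act (hyp_vec lam a) (base_vec P a b) (base_vec PT (1 / tau * c) n)" by simp_all
  let ?g = "M_deck a (- c) b (- n)"
  have mem: "?g \<in> M_group" using h by (intro nak_groupI) auto
  have eq: "h (M_to_cotangent x) = M_to_cotangent (?g x)" for x
    unfolding h(5) M_act by simp
  show ?thesis by (rule bexI[OF _ mem]) (simp only: eq simp_thms)
qed

lemma cotangent_down:
  assumes "g \<in> M_group"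
  shows "\<exists>h\<in>cotangent_group. \<forall>x. h (M_to_cotangent x) = M_to_cotangent (g x)"
proof -
  obtain a c m n where g: "a \<in> \<int>" "c \<in> \<int>" "integral_vec m" "integral_vec n"
    "g = M_deck a c m n" using assms by (rule M_groupE)
  have "- c \<in> \<int>" "integral_vec (- n)" using g(2,4) by auto
  then have "base_vec PT (1 / tau * - c) (- n) \<in> cotangent_lattice"
    unfolding lattice_torus by blast
  then have mem: "cotangent_act (hyp_vec lam a) (base_vec P a m) (base_vec PT (1 / tau * - c) (- n)) \<in> cotangent_group"
    unfolding cotangent_group_elements using g(1,3) by (intro CollectI exI conjI) (rule refl)
  have eq: "M_to_cotangent (g x) = cotangent_act (hyp_vec lam a) (base_vec P a m)
      (base_vec PT (1 / tau * - c) (- n)) (M_to_cotangent x)" for x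
    unfolding g(5) M_act ..
  show ?thesis by (rule bexI[OF _ mem]) (simp only: eq simp_thms)
qed

lemma cotangent_orbit_restriction:
  "orbit_restriction M_group cotangent_group M_to_cotangent M_from_cotangent UNIV UNIV"
proof
  show "affine_group cotangent_group"
  proof (rule affine_group_surj[OF M_group(1)])
    show "surj M_to_cotangent" by (rule surjI) (rule M_cotangent_inverse)
    show "affine_map h" if "h \<in> cotangent_group" for h
      using that unfolding cotangent_group_elements by (auto intro: affine_cotangent_act)
  qed (rule cotangent_down cotangent_up; assumption)+
  show "free_proper cotangent_group"
  proof (rule free_proper_inj[OF M_group(2)])
    show "inj M_from_cotangent" by (metis M_cotangent_inverse(2) injI)
    show "continuous_on UNIV M_from_cotangent" by (rule continuous_affine[OF affine_M_from_cotangent])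
    fix h assume "h \<in> cotangent_group"
    then obtain g where g: "g \<in> M_group" "\<forall>x. h (M_to_cotangent x) = M_to_cotangent (g x)"
      using cotangent_up by blast
    have "M_from_cotangent (h z) = g (M_from_cotangent z)" for z
      using g(2)[rule_format, of "M_from_cotangent z"] by (simp add: M_cotangent_inverse)
    then show "\<exists>g\<in>M_group. \<forall>z. M_from_cotangent (h z) = g (M_from_cotangent z)" using g(1) by blast
  qed
  fix z :: "(real ^ 3) \<times> (real ^ 3)"
  show "orbit_of cotangent_group z = M_to_cotangent ` orbit_of M_group (M_from_cotangent z) \<inter> UNIV"
  proof (intro equalityI subsetI)
    fix w assume "w \<in> orbit_of cotangent_group z"
    then obtain h where h: "h \<in> cotangent_group" "w = h z" unfolding orbit_of_def by blast
    obtain g where "g \<in> M_group" "h (M_to_cotangent (M_from_cotangent z)) = M_to_cotangent (g (M_from_cotangent z))"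
      using cotangent_up[OF h(1)] by blast
    then show "w \<in> M_to_cotangent ` orbit_of M_group (M_from_cotangent z) \<inter> UNIV"
      unfolding orbit_of_def h(2) M_cotangent_inverse by blast
  next
    fix w assume "w \<in> M_to_cotangent ` orbit_of M_group (M_from_cotangent z) \<inter> UNIV"
    then obtain g where g: "g \<in> M_group" "w = M_to_cotangent (g (M_from_cotangent z))"
      unfolding orbit_of_def by blast
    obtain h where h: "h \<in> cotangent_group" "\<forall>x. h (M_to_cotangent x) = M_to_cotangent (g x)"
      using cotangent_down[OF g(1)] by blast
    have "w = h z" using g(2) h(2)[rule_format, of "M_from_cotangent z"] by (simp add: M_cotangent_inverse)
    then show "w \<in> orbit_of cotangent_group z" unfolding orbit_of_def using h(1) by blast
  qed
next
  show "orbit_of M_group x \<in> UNIV \<longleftrightarrow> (\<exists>g\<in>M_group. M_to_cotangent (g x) \<in> UNIV)" for x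
    using affine_groupD(2)[OF M_group(1)] by blast
qed (use M_group affine_M_to_cotangent affine_M_from_cotangent M_cotangent_inverse in auto)

end


section \<open>The invariant forms\<close>

lemma form_sum_apply: "(\<Sum>i\<in>I. \<alpha> i) x vs = (\<Sum>i\<in>I. \<alpha> i x vs)" for \<alpha> :: "'i \<Rightarrow> 'e form"
  by (induction I rule: infinite_finite_induct) auto

text \<open>Both symplectic forms are evaluated by this.\<close>

lemma wedge_dform:
  assumes "bounded_linear f" "bounded_linear g"
  shows "(dform f \<and>\<^sub>d dform g) x vs = (case vs of [u, v] \<Rightarrow> f u * g v - f v * g u | _ \<Rightarrow> 0)"
proof -
  have zero: "dform h x vs = 0" if "length vs \<noteq> 1" for h x and vs :: "'a list"
    using that by (auto simp: dform_def split: list.split)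
  show ?thesis
    by (subst wedge_degree_one)
      (auto simp: zero dform_bounded_linear assms split: list.split)
qed

lemma pullback_equivariant:
  assumes "affine_map J" "affine_map g" "affine_map g'" "\<And>x. J (g x) = g' (J x)" "pullback g' \<beta> = \<beta>"
  shows "pullback g (pullback J \<beta>) = pullback J \<beta>"
proof -
  have "J \<circ> g = g' \<circ> J" using assms(4) by (simp add: fun_eq_iff)
  then have "pullback g (pullback J \<beta>) = pullback J (pullback g' \<beta>)"
    using assms(1-3) by (simp flip: pullback_comp_affine)
  then show ?thesis by (simp add: assms(5))
qed

lemma pullback_inverse:
  assumes "affine_map J" "affine_map K" "\<And>x. K (J x) = x"
  shows "pullback J (pullback K \<alpha>) = \<alpha>"
proof -
  have "pullback J (pullback K \<alpha>) = pullback (K \<circ> J) \<alpha>"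
    using assms(1,2) by (simp add: pullback_comp_affine)
  also have "K \<circ> J = (\<lambda>x. x)" using assms(3) by (simp add: fun_eq_iff)
  also have "pullback (\<lambda>x. x) \<alpha> = \<alpha>"
    by (intro ext) (simp add: pullback_affine[OF affine_map_id])
  finally show ?thesis .
qed

lemma bounded_linear_vec_coordinates:
  "bounded_linear (\<lambda>p :: complex ^ 3. p $ k)"
  "bounded_linear (\<lambda>p :: complex ^ 3. complex_of_real (Re (p $ k)))"
  "bounded_linear (\<lambda>p :: complex ^ 3. complex_of_real (Im (p $ k)))"
  "bounded_linear (\<lambda>p :: complex ^ 3. Re (p $ k))"
  by (intro bounded_linear_vec_nth bounded_linear_compose[OF bounded_linear_of_real]
      bounded_linear_compose[OF bounded_linear_Re] bounded_linear_compose[OF bounded_linear_Im])+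

lemma bounded_linear_cotangent_coordinates:
  "bounded_linear ((\<lambda>(r, \<theta>). of_real (\<theta> $ j)) :: (real ^ 3) \<times> (real ^ 3) \<Rightarrow> complex)" (is "bounded_linear ?f")
  "bounded_linear ((\<lambda>(r, \<theta>). of_real (r $ j)) :: (real ^ 3) \<times> (real ^ 3) \<Rightarrow> complex)" (is "bounded_linear ?g")
proof -
  have "linear ?f" "linear ?g" by (auto intro!: linearI simp: complex_eq_iff)
  then show "bounded_linear ?f" "bounded_linear ?g" unfolding linear_conv_bounded_linear by this+
qed

lemma canonical_symplectic_explicit:
  "canonical_symplectic x vs =
    (case vs of [u, v] \<Rightarrow> of_real (snd u \<bullet> fst v - snd v \<bullet> fst u) | _ \<Rightarrow> 0)"
  unfolding canonical_symplectic_def form_sum_apply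
    wedge_dform[OF bounded_linear_cotangent_coordinates(1) bounded_linear_cotangent_coordinates(2)]
  by (auto simp: inner_vec_def case_prod_beta sum_subtractf split: list.split)

lemma M_omega_explicit:
  "M_omega x vs = (case vs of [u, v] \<Rightarrow> of_real
     (Re (u $ 0) * Im (v $ 0) - Re (v $ 0) * Im (u $ 0) +
      (Re (u $ 2) * Im (v $ 1) - Re (v $ 2) * Im (u $ 1)) +
      (Re (u $ 1) * Im (v $ 2) - Re (v $ 1) * Im (u $ 2))) | _ \<Rightarrow> 0)"
  unfolding M_omega_def plus_fun_apply
    wedge_dform[OF bounded_linear_vec_coordinates(2) bounded_linear_vec_coordinates(3)]
  by (auto split: list.split)

lemma M_omega_pullback: "pullback M_to_cotangent canonical_symplectic = M_omega"
proof (intro ext)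
  fix x vs
  show "pullback M_to_cotangent canonical_symplectic x vs = M_omega x vs"
    unfolding pullback_affine[OF affine_M_to_cotangent] canonical_symplectic_explicit M_omega_explicit
    by (auto simp: M_to_cotangent_def inner_vec_def sum_3 algebra_simps split: list.split)
qed

lemma canonical_symplectic_invariant:
  assumes "\<And>j. d $ j \<noteq> 0"
  shows "pullback (cotangent_act d t l) canonical_symplectic = canonical_symplectic"
proof (intro ext)
  fix x vs
  have "diag_act (inv_vec d) u \<bullet> diag_act d v = u \<bullet> v" for u v
    using assms by (auto simp: inner_vec_def inv_vec_def field_simps intro!: sum.cong)
  then show "pullback (cotangent_act d t l) canonical_symplectic x vs = canonical_symplectic x vs"
    unfolding pullback_affine[OF affine_cotangent_act] canonical_symplectic_explicit cotangent_act_linear_part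
    by (auto split: list.split)
qed

lemma hyp_vec_nonzero: "hyp_vec lam a $ j \<noteq> 0"
  using index_3_cases[of j] by (auto simp: hyp_vec_nth)

lemma M_omega_invariant: "pullback (nak_mult lam g) M_omega = M_omega"
  unfolding M_omega_pullback[symmetric]
  by (rule pullback_equivariant[OF affine_M_to_cotangent affine_nak_mult affine_cotangent_act M_to_cotangent_mult
      canonical_symplectic_invariant[OF hyp_vec_nonzero]])

text \<open>Left multiplication stretches \<open>dz\<^sub>k\<close> by the factor by which it shrinks the coefficient.\<close>

lemma coframe_invariant: "pullback (nak_mult lam g) (coframe lam k) = coframe lam k"
proof (intro ext)
  fix p :: "complex ^ 3" and vs
  have e: "of_real (exp (- (l * (Re (g $ 0) + Re (p $ 0))))) * (of_real (exp (l * Re (g $ 0))) * z) =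
      of_real (exp (- (l * Re (p $ 0)))) * (z :: complex)" for l z
  proof -
    have "exp (- (l * (Re (g $ 0) + Re (p $ 0)))) * exp (l * Re (g $ 0)) = exp (- (l * Re (p $ 0)))"
      by (simp add: algebra_simps flip: exp_add)
    then show ?thesis by (simp only: mult.assoc[symmetric] of_real_mult[symmetric])
  qed
  show "pullback (nak_mult lam g) (coframe lam k) p vs = coframe lam k p vs"
    unfolding pullback_affine[OF affine_nak_mult] coframe_def fscale_def
      dform_bounded_linear[OF bounded_linear_vec_coordinates(1)]
    using index_3_cases[of k] e[of lam] e[of "- lam"]
    by (auto simp: nak_mult_def split: list.split)
qed

lemma fscale_const_pullback: "pullback h (fscale (\<lambda>_. c) \<alpha>) = fscale (\<lambda>_. c) (pullback h \<alpha>)"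
  by (simp add: pullback_fscale comp_def)

lemma N_omega_invariant: "pullback (nak_mult lam g) (N_omega lam) = N_omega lam"
  unfolding N_omega_def fscale_const_pullback pullback_sum pullback_wedge pullback_fcnj coframe_invariant ..

lemma N_Omega_invariant: "pullback (nak_mult lam g) (N_Omega lam) = N_Omega lam"
  unfolding N_Omega_def fscale_const_pullback pullback_wedge coframe_invariant ..

lemma alternating_coframe: "alternating_form (coframe lam k)"
  unfolding coframe_def by (intro alternating_fscale alternating_dform bounded_linear_vec_coordinates)

lemma smooth_coframe: "smooth_form (coframe lam k)"
proof -
  have "bounded_linear (\<lambda>p :: complex ^ 3. c * Re (p $ 0))" for c
    by (intro bounded_linear_compose[OF bounded_linear_mult_right] bounded_linear_vec_coordinates)
  then have "smooth_on UNIV (\<lambda>p :: complex ^ 3. complex_of_real (exp (c * Re (p $ 0))))" for c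
    by (rule smooth_exp)
  then have "smooth_on UNIV (\<lambda>p :: complex ^ 3.
      complex_of_real (vec012 1 (exp (- lam * Re (p $ 0))) (exp (lam * Re (p $ 0))) $ k))"
    using index_3_cases[of k] smooth_const[of 1] by (elim disjE) (simp_all only: vec012_nth of_real_1)
  then show ?thesis
    unfolding coframe_def by (intro smooth_fscale smooth_dform bounded_linear_vec_coordinates)
qed

lemma N_omega_form: "alternating_form (N_omega lam)" "smooth_form (N_omega lam)"
  unfolding N_omega_def
  by (intro alternating_fscale alternating_sum alternating_wedge alternating_fcnj alternating_coframe)
    (intro smooth_fscale smooth_const smooth_form_sum smooth_wedge smooth_fcnj smooth_coframe)

lemma N_Omega_form: "alternating_form (N_Omega lam)" "smooth_form (N_Omega lam)"
  unfolding N_Omega_def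
  by (intro alternating_fscale alternating_wedge alternating_coframe)
    (intro smooth_fscale smooth_const smooth_wedge smooth_coframe)

lemma M_omega_form: "alternating_form M_omega" "smooth_form M_omega"
  unfolding M_omega_def
  by (intro alternating_add alternating_wedge alternating_dform bounded_linear_vec_coordinates)
    (intro smooth_form_add smooth_wedge smooth_dform bounded_linear_vec_coordinates)

definition dzeta :: "3 \<Rightarrow> (complex ^ 3) form" where
  "dzeta j = dform (\<lambda>\<zeta>. of_real (re_vec \<zeta> $ j)) + fscale (\<lambda>_. \<i>) (dform (\<lambda>\<zeta>. of_real (im_vec \<zeta> $ j)))"

lemma holomorphic_volume_dzeta: "holomorphic_volume = dzeta 0 \<and>\<^sub>d dzeta 1 \<and>\<^sub>d dzeta 2"
  by (simp only: holomorphic_volume_def dzeta_def)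

lemma dzeta_explicit: "dzeta j \<zeta> vs = (case vs of [v] \<Rightarrow> v $ j | _ \<Rightarrow> 0)"
  unfolding dzeta_def plus_fun_apply fscale_def re_im_vec_nth
    dform_bounded_linear[OF bounded_linear_vec_coordinates(2)] dform_bounded_linear[OF bounded_linear_vec_coordinates(3)]
  by (auto simp: complex_eq_iff split: list.split)

lemma holomorphic_volume_translation:
  "pullback (\<lambda>\<zeta>. \<zeta> + c) holomorphic_volume = holomorphic_volume"
proof -
  have aff: "affine_map (\<lambda>\<zeta> :: complex ^ 3. \<zeta> + c)" by (rule affine_mapI[OF bounded_linear_ident]) simp
  have "pullback (\<lambda>\<zeta>. \<zeta> + c) (dzeta j) = dzeta j" for j
    by (intro ext) (simp add: pullback_affine[OF aff] dzeta_explicit)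
  then show ?thesis by (simp only: holomorphic_volume_dzeta pullback_wedge)
qed

text \<open>\<open>d\<zeta>\<^sub>0 = i dw\<close>, and the exponential factors of the second and third member of the coframe cancel.\<close>

lemma N_Omega_pullback: "pullback N_to_tangent holomorphic_volume = N_Omega lam"
proof -
  define f where "f = (\<lambda>k (p :: complex ^ 3). vec012 \<i> (of_real (exp (lam * Re (p $ 0)))) (of_real (exp (- lam * Re (p $ 0)))) $ (k :: 3) :: complex)"
  have "pullback N_to_tangent (dzeta k) = fscale (f k) (coframe lam k)" for k
  proof (intro ext)
    fix p :: "complex ^ 3" and vs
    have e: "of_real (exp (l * Re (p $ 0))) * (of_real (exp (- (l * Re (p $ 0)))) * z) = (z :: complex)" for l z
      by (simp add: exp_minus)
    show "pullback N_to_tangent (dzeta k) p vs = fscale (f k) (coframe lam k) p vs"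
      unfolding pullback_affine[OF affine_N_to_tangent] dzeta_explicit coframe_def fscale_def
        dform_bounded_linear[OF bounded_linear_vec_coordinates(1)]
      using index_3_cases[of k] e[of lam] e[of "- lam"]
      by (auto simp: N_to_tangent_def f_def split: list.split)
  qed
  then have "pullback N_to_tangent holomorphic_volume =
      fscale (\<lambda>p. f 0 p * (f 1 p * f 2 p)) (coframe lam 0 \<and>\<^sub>d coframe lam 1 \<and>\<^sub>d coframe lam 2)"
    by (simp only: holomorphic_volume_dzeta pullback_wedge fscale_wedge_fscale)
  also have "(\<lambda>p. f 0 p * (f 1 p * f 2 p)) = (\<lambda>_. \<i>)"
    by (simp add: f_def fun_eq_iff flip: of_real_mult exp_add)
  finally show ?thesis by (simp only: N_Omega_def)
qed

definition tangent_omega :: "real \<Rightarrow> (complex ^ 3) form" where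
  "tangent_omega lam = pullback N_from_tangent (N_omega lam)"

text \<open>Such an affine map is left multiplication by the group element that \<open>N_to_tangent\<close> takes to \<open>t' + i t\<close>.\<close>

lemma tangent_omega_invariant: "pullback (tangent_act (hyp_vec lam (t $ 0)) t t') (tangent_omega lam) = tangent_omega lam"
  unfolding tangent_omega_def
proof (rule pullback_equivariant[OF affine_N_from_tangent affine_tangent_act affine_nak_mult _ N_omega_invariant])
  fix \<zeta>
  let ?g = "N_from_tangent (complex_vec t' t)"
  have "Re (?g $ 0) = t $ 0" by (simp add: N_from_tangent_def)
  moreover have "im_vec (complex_vec t' t) = t" "re_vec (complex_vec t' t) = t'" by (simp_all add: vec3_eq_iff)
  ultimately have "N_to_tangent (nak_mult lam ?g (N_from_tangent \<zeta>)) = tangent_act (hyp_vec lam (t $ 0)) t t' \<zeta>"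
    unfolding N_to_tangent_mult N_tangent_inverse by simp
  from arg_cong[OF this, of N_from_tangent]
  show "N_from_tangent (tangent_act (hyp_vec lam (t $ 0)) t t' \<zeta>) = nak_mult lam ?g (N_from_tangent \<zeta>)"
    by (simp only: N_tangent_inverse)
qed

lemma tangent_omega_translation: "pullback (tangent_act 1 0 t') (tangent_omega lam) = tangent_omega lam"
  using tangent_omega_invariant[of lam 0 t'] by (simp add: hyp_vec_zero)

lemma tangent_omega_periodic: "tangent_omega lam (\<zeta> + complex_vec t 0) = tangent_omega lam \<zeta>"
proof
  fix vs
  have one: "diag_act 1 u = u" for u by (simp add: vec3_eq_iff)
  have "tangent_act 1 0 t \<zeta> = \<zeta> + complex_vec t 0"
    by (simp add: tangent_act_def one vec3_eq_iff complex_eq_iff)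
  moreover have "map (\<lambda>v. tangent_act 1 0 t v - tangent_act 1 0 t 0) vs = vs"
    unfolding tangent_act_linear_part one by (rule map_idI) (simp add: vec3_eq_iff)
  ultimately have "pullback (tangent_act 1 0 t) (tangent_omega lam) \<zeta> vs = tangent_omega lam (\<zeta> + complex_vec t 0) vs"
    by (simp only: pullback_affine[OF affine_tangent_act])
  then show "tangent_omega lam (\<zeta> + complex_vec t 0) vs = tangent_omega lam \<zeta> vs"
    by (simp only: tangent_omega_translation)
qed

lemma tangent_omega_form: "alternating_form (tangent_omega lam)" "smooth_form (tangent_omega lam)"
  unfolding tangent_omega_def
  by (intro alternating_pullback smooth_pullback affine_N_from_tangent N_omega_form)+

definition mirror_form :: "real \<Rightarrow> real ^ 3 ^ 3 \<Rightarrow> ((real ^ 3) \<times> (real ^ 3)) form" where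
  "mirror_form lam L = fourier_mukai L (fexp (fscale (\<lambda>_. 2) (tangent_omega lam)))"

lemma exp_tangent_omega_invariant:
  "pullback (tangent_act (hyp_vec lam (t $ 0)) t t') (fexp (fscale (\<lambda>_. 2) (tangent_omega lam))) =
     fexp (fscale (\<lambda>_. 2) (tangent_omega lam))"
  "pullback (tangent_act 1 0 t') (fexp (fscale (\<lambda>_. 2) (tangent_omega lam))) =
     fexp (fscale (\<lambda>_. 2) (tangent_omega lam))"
  by (simp_all only: pullback_fexp fscale_const_pullback tangent_omega_invariant tangent_omega_translation)

lemma mirror_form_form: "alternating_form (mirror_form lam L)" "smooth_form (mirror_form lam L)"
  unfolding mirror_form_def
  by (intro alternating_fourier_mukai smooth_fourier_mukai exp_tangent_omega_invariant
      alternating_fexp smooth_fexp alternating_fscale smooth_fscale smooth_const tangent_omega_form)+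

lemma mirror_form_invariant:
  "pullback (cotangent_act (hyp_vec lam (t $ 0)) t l) (mirror_form lam L) = mirror_form lam L"
  unfolding mirror_form_def
  by (intro fourier_mukai_invariant exp_tangent_omega_invariant alternating_fexp alternating_fscale tangent_omega_form)
    (simp add: hyp_vec_nth flip: exp_add)

lemma M_Omega_pullback: "M_Omega lam tau P = pullback M_to_cotangent (mirror_form lam (torus_lattice tau P))"
  by (simp only: M_Omega_def mirror_form_def tangent_omega_def)

lemma M_Omega_invariant: "pullback (nak_mult lam g) (M_Omega lam tau P) = M_Omega lam tau P"
proof -
  have t: "fst (M_to_cotangent g) $ 0 = Re (g $ 0)" by (simp add: M_to_cotangent_def)
  have "pullback (cotangent_act (hyp_vec lam (Re (g $ 0))) (fst (M_to_cotangent g)) (snd (M_to_cotangent g)))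
      (mirror_form lam (torus_lattice tau P)) = mirror_form lam (torus_lattice tau P)"
    unfolding t[symmetric] by (rule mirror_form_invariant)
  from pullback_equivariant[OF affine_M_to_cotangent affine_nak_mult affine_cotangent_act M_to_cotangent_mult this]
  show ?thesis unfolding M_Omega_pullback .
qed

lemma M_Omega_form: "alternating_form (M_Omega lam tau P)" "smooth_form (M_Omega lam tau P)"
  unfolding M_Omega_pullback
  by (intro alternating_pullback smooth_pullback affine_M_to_cotangent mirror_form_form)+

text \<open>The form is its own expression in every chart, and transitions are locally deck transformations.\<close>

lemma differential_form_quotient:
  assumes G: "affine_group G" and \<alpha>: "alternating_form \<alpha>" "smooth_form \<alpha>"
    and inv: "\<And>g. g \<in> G \<Longrightarrow> pullback g \<alpha> = \<alpha>"
  shows "differential_form (quotient_atlas UNIV G) (descend \<alpha>)"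
proof -
  have "is_pullback (quotient_atlas UNIV G) (quotient_atlas UNIV G) (\<lambda>x. x) (descend \<alpha>) (descend \<alpha>)"
  proof (rule is_pullback_lift[OF section_atlas_quotient section_atlas_quotient deck_maps_orbit_of[OF G]
        lifts_to_identity[of G, OF affine_groupD(2)[OF G]]])
  qed (simp_all add: inv)
  moreover have "alternating (descend \<alpha> \<phi> p)" for \<phi> p
    using \<alpha>(1) by (simp add: alternating_form_def descend_def[abs_def])
  moreover have "smooth_on (\<phi> ` U) (\<lambda>x. in_chart U \<phi> (descend \<alpha>) x vs)"
    if U: "(U, \<phi>) \<in> quotient_atlas UNIV G" for U \<phi> vs
  proof (rule smooth_on_local)
    note sec = section_atlasD[OF section_atlas_quotient U]
    show op: "open (\<phi> ` U)" by (rule sec(1))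
    fix x assume "x \<in> \<phi> ` U"
    have "\<forall>y\<in>\<phi> ` U. in_chart U \<phi> (descend \<alpha>) y vs = \<alpha> y vs"
      by (simp add: in_chart_def descend_def f_inv_into_f)
    then show "\<exists>N g. open N \<and> x \<in> N \<and> smooth_on UNIV g \<and> (\<forall>y\<in>N. in_chart U \<phi> (descend \<alpha>) y vs = g y)"
      using \<alpha>(2) op \<open>x \<in> \<phi> ` U\<close> unfolding smooth_form_def by (intro exI[of _ "\<phi> ` U"] exI[of _ "\<lambda>y. \<alpha> y vs"]) simp
  qed
  ultimately show ?thesis unfolding differential_form_def by blast
qed

lemma M_omega_nondegenerate:
  assumes "u \<noteq> 0"
  shows "\<exists>v. M_omega x [u, v] \<noteq> 0"
proof -
  \<comment> \<open>\<open>v\<close> is \<open>i u\<close> with its last two components exchanged, so that the pairing is \<open>\<bar>u\<bar>\<^sup>2\<close>.\<close>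
  define v where "v = vec012 (Complex (- Im (u $ 0)) (Re (u $ 0))) (Complex (- Im (u $ 2)) (Re (u $ 2)))
    (Complex (- Im (u $ 1)) (Re (u $ 1)))"
  have "M_omega x [u, v] = of_real ((Re (u $ 0))\<^sup>2 + (Im (u $ 0))\<^sup>2 + ((Re (u $ 1))\<^sup>2 + (Im (u $ 1))\<^sup>2) +
      ((Re (u $ 2))\<^sup>2 + (Im (u $ 2))\<^sup>2))"
    by (simp add: M_omega_explicit v_def power2_eq_square algebra_simps)
  moreover have "(Re (u $ k))\<^sup>2 + (Im (u $ k))\<^sup>2 = (norm (u $ k))\<^sup>2" for k by (simp add: cmod_power2)
  ultimately have "M_omega x [u, v] = of_real ((norm (u $ 0))\<^sup>2 + (norm (u $ 1))\<^sup>2 + (norm (u $ 2))\<^sup>2)" by simp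
  moreover have "(norm (u $ 0))\<^sup>2 + (norm (u $ 1))\<^sup>2 + (norm (u $ 2))\<^sup>2 \<noteq> 0"
  proof
    assume "(norm (u $ 0))\<^sup>2 + (norm (u $ 1))\<^sup>2 + (norm (u $ 2))\<^sup>2 = 0"
    then have "(norm (u $ 0))\<^sup>2 = 0" "(norm (u $ 1))\<^sup>2 = 0" "(norm (u $ 2))\<^sup>2 = 0"
      by (smt (verit) zero_le_power2)+
    then show False using assms by (simp add: vec3_eq_iff)
  qed
  ultimately show ?thesis by (metis of_real_eq_0_iff)
qed

lemma symplectic_manifold_M_quotient:
  assumes G: "affine_group (nak_mult lam ` \<Gamma>)" "free_proper (nak_mult lam ` \<Gamma>)"
  shows "symplectic_manifold (quotient_atlas UNIV (nak_mult lam ` \<Gamma>)) (descend M_omega)"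
proof -
  have "ext_d (in_chart U \<phi> (descend M_omega)) x vs = 0" for U \<phi> x vs
  proof -
    have "in_chart U \<phi> (descend M_omega) y ws = M_omega 0 ws" for y ws
      by (simp add: in_chart_def descend_def M_omega_explicit)
    then show ?thesis by (simp add: ext_d_def)
  qed
  moreover have "descend M_omega \<phi> p vs \<in> \<real>" "length vs \<noteq> 2 \<Longrightarrow> descend M_omega \<phi> p vs = 0" for \<phi> p vs
    by (auto simp: descend_def M_omega_explicit split: list.split)
  moreover have "u \<noteq> 0 \<Longrightarrow> \<exists>v. descend M_omega \<phi> p [u, v] \<noteq> 0" for \<phi> p u
    unfolding descend_def by (rule M_omega_nondegenerate)
  moreover have "differential_form (quotient_atlas UNIV (nak_mult lam ` \<Gamma>)) (descend M_omega)"
    by (rule differential_form_quotient[OF G(1) M_omega_form]) (use M_omega_invariant in blast)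
  ultimately show ?thesis
    unfolding symplectic_manifold_def using smooth_manifold_quotient[OF G] by blast
qed


section \<open>The semi-flat mirror pair\<close>

lemma carrier_quotient_charts:
  "carrier_of (quotient_atlas UNIV G) = \<Union> ((\<lambda>V. orbit_of G ` V) ` {V. open V \<and> inj_on (orbit_of G) V})"
proof (intro equalityI subsetI)
  fix p assume "p \<in> carrier_of (quotient_atlas UNIV G)"
  then obtain c where c: "c \<in> quotient_atlas UNIV G" "p \<in> fst c" unfolding carrier_of_def by blast
  then obtain V where "open V" "inj_on (orbit_of G) V" "c = (orbit_of G ` V, inv_into V (orbit_of G))"
    unfolding quotient_atlas_def by blast
  then show "p \<in> \<Union> ((\<lambda>V. orbit_of G ` V) ` {V. open V \<and> inj_on (orbit_of G) V})" using c(2) by auto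
next
  fix p assume "p \<in> \<Union> ((\<lambda>V. orbit_of G ` V) ` {V. open V \<and> inj_on (orbit_of G) V})"
  then obtain V where V: "open V" "inj_on (orbit_of G) V" "p \<in> orbit_of G ` V" by blast
  then have "(orbit_of G ` V, inv_into V (orbit_of G)) \<in> quotient_atlas UNIV G"
    unfolding quotient_atlas_def by blast
  then have "orbit_of G ` V \<in> fst ` quotient_atlas UNIV G" by (metis fst_conv imageI)
  then show "p \<in> carrier_of (quotient_atlas UNIV G)" unfolding carrier_of_def using V(3) by (rule UnionI)
qed

context nakamura
begin

abbreviation "base_orbit \<equiv> orbit_of base_group"

abbreviation "N_dom V \<equiv> open_submanifold N_atlas (N_fibration -` (base_orbit ` V))"
abbreviation "M_dom V \<equiv> open_submanifold M_atlas (M_fibration -` (base_orbit ` V))"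
abbreviation "N_model V \<equiv> quotient_atlas (im_vec -` V) tangent_translations"
abbreviation "M_model V \<equiv> quotient_atlas (fst -` V) cotangent_translations"
abbreviation "N_triv V y \<equiv> N_to_tangent ` y \<inter> im_vec -` V"
abbreviation "M_triv V x \<equiv> M_to_cotangent ` x \<inter> fst -` V"
abbreviation "good V \<equiv> open V \<and> inj_on base_orbit V"

text \<open>A point of \<open>N\<close> or \<open>M\<close> is an orbit; its image in the local model is the part of that orbit over \<open>V\<close>.\<close>

definition chart_over :: "(real ^ 3) set \<Rightarrow>
    ((real ^ 3) set, (complex ^ 3) set, (complex ^ 3) set) semi_flat_chart" where
  "chart_over V = \<lparr>sf_dom = base_orbit ` V, sf_aff = inv_into V base_orbit, sf_lat = torus_lattice tau P,
     sf_tan = (N_triv V), sf_cot = (M_triv V)\<rparr>"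

lemma chart_over_simps:
  "sf_dom (chart_over V) = base_orbit ` V" "sf_aff (chart_over V) = inv_into V base_orbit"
  "sf_lat (chart_over V) = torus_lattice tau P"
  "sf_tan (chart_over V) = (N_triv V)"
  "sf_cot (chart_over V) = (M_triv V)"
  by (simp_all add: chart_over_def)

lemma sf_image_chart_over: "good V \<Longrightarrow> sf_image (chart_over V) = V"
  unfolding sf_image_def chart_over_simps by (auto simp: image_image)

lemma sf_tan_model_chart_over:
  assumes "good V"
  shows "sf_tan_model (chart_over V) = N_model V"
  unfolding sf_tan_model_def sf_image_chart_over[OF assms] tangent_torus_bundle_def chart_over_simps
  by (simp only: vimage_def)

lemma sf_cot_model_chart_over:
  assumes "good V"
  shows "sf_cot_model (chart_over V) = M_model V"
proof -
  have "V \<times> UNIV = (fst :: (real ^ 3) \<times> (real ^ 3) \<Rightarrow> _) -` V" by auto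
  then show ?thesis
    unfolding sf_cot_model_def sf_image_chart_over[OF assms] cotangent_torus_bundle_def chart_over_simps
      dual_lattice_torus[OF tau P] by (simp only:)
qed

lemma N_manifold_quotient: "N_manifold lam tau P = N_atlas"
  by (simp only: N_manifold_def nak_quotient_def)

lemma M_manifold_quotient: "M_manifold lam tau P = M_atlas"
  by (simp only: M_manifold_def nak_quotient_def Q)

lemma N_fibration_eq: "N_fibration = image (im_vec \<circ> N_to_tangent)"
proof -
  have "(\<lambda>p. vec012 (Re (p $ 0)) (Im (p $ 1)) (Im (p $ 2))) = im_vec \<circ> N_to_tangent"
    by (simp add: fun_eq_iff N_to_tangent_def vec3_eq_iff)
  then show ?thesis by (simp only: N_fibration_def)
qed

lemma M_fibration_eq: "M_fibration = image (fst \<circ> M_to_cotangent)"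
proof -
  have "(\<lambda>p. vec012 (Re (p $ 0)) (Re (p $ 1)) (Re (p $ 2))) = fst \<circ> M_to_cotangent"
    by (simp add: fun_eq_iff M_to_cotangent_def)
  then show ?thesis by (simp only: M_fibration_def)
qed

lemmas N_restriction = torus_fibration.orbit_restriction_chart[OF N_torus_fibration, folded N_fibration_eq]
lemmas M_restriction = torus_fibration.orbit_restriction_chart[OF M_torus_fibration, folded M_fibration_eq]

lemma M_group_form_invariant:
  assumes "\<And>g. pullback (nak_mult lam g) \<alpha> = \<alpha>" "h \<in> M_group"
  shows "pullback h \<alpha> = \<alpha>"
  using assms by blast

lemma N_group_form_invariant:
  assumes "\<And>g. pullback (nak_mult lam g) \<alpha> = \<alpha>" "h \<in> N_group"
  shows "pullback h \<alpha> = \<alpha>"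
  using assms by blast

lemma cotangent_translation_form_invariant:
  assumes "\<And>t l. pullback (cotangent_act (hyp_vec lam (t $ 0)) t l) \<beta> = \<beta>" "h \<in> cotangent_translations"
  shows "pullback h \<beta> = \<beta>"
proof -
  obtain l :: "real ^ 3" where h: "h = (\<lambda>(r, \<theta>). (r, \<theta> + l))" using assms(2) by blast
  have "h = cotangent_act (hyp_vec lam ((0 :: real ^ 3) $ 0)) 0 l"
    unfolding h fun_eq_iff zero_index cotangent_act_translation by simp
  then show ?thesis using assms(1) by (simp only:)
qed

lemma tangent_translation_form_invariant:
  assumes "\<And>t t'. pullback (tangent_act (hyp_vec lam (t $ 0)) t t') \<beta> = \<beta>" "h \<in> tangent_translations"
  shows "pullback h \<beta> = \<beta>"
proof -
  obtain l :: "real ^ 3" where h: "h = (\<lambda>\<zeta>. \<zeta> + complex_vec l 0)" using assms(2) by blast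
  have "h = tangent_act (hyp_vec lam ((0 :: real ^ 3) $ 0)) 0 l"
    unfolding h fun_eq_iff zero_index tangent_act_translation by simp
  then show ?thesis using assms(1) by (simp only:)
qed

lemma canonical_symplectic_hyp_invariant:
  "pullback (cotangent_act (hyp_vec lam a) t l) canonical_symplectic = canonical_symplectic"
  by (rule canonical_symplectic_invariant[OF hyp_vec_nonzero])

lemma symplectomorphism_chart:
  assumes V: "good V"
  shows "symplectomorphism (M_dom V)
     (descend M_omega) (M_model V) (descend canonical_symplectic)
     (M_triv V)"
  unfolding symplectomorphism_def
proof
  interpret R: orbit_restriction M_group cotangent_translations M_to_cotangent M_from_cotangent "fst -` V"
    "M_fibration -` (base_orbit ` V)" using V by (intro M_restriction) auto
  show "diffeomorphism R.source R.target R.trivialise" by (rule R.diffeomorphism_trivialise)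
  show "is_pullback R.source R.target R.trivialise (descend canonical_symplectic) (descend M_omega)"
    by (rule R.is_pullback_trivialise)
      (rule cotangent_translation_form_invariant[OF canonical_symplectic_hyp_invariant]
        M_group_form_invariant[OF M_omega_invariant] M_omega_pullback; assumption)+
qed

lemma mirror_form_chart:
  assumes V: "good V"
  shows "is_pullback (M_dom V)
     (M_model V) (M_triv V)
     (descend (mirror_form lam (torus_lattice tau P))) (descend (M_Omega lam tau P))"
proof -
  interpret R: orbit_restriction M_group cotangent_translations M_to_cotangent M_from_cotangent "fst -` V"
    "M_fibration -` (base_orbit ` V)" using V by (intro M_restriction) auto
  show ?thesis
    by (rule R.is_pullback_trivialise)
      (rule cotangent_translation_form_invariant[OF mirror_form_invariant]
        M_group_form_invariant[OF M_Omega_invariant] M_Omega_pullback[symmetric]; assumption)+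
qed

lemma complex_affine_maps:
  "complex_affine (nak_mult lam g)" "complex_affine N_to_tangent" "complex_affine N_from_tangent"
  "h \<in> tangent_translations \<Longrightarrow> complex_affine h"
proof -
  show "complex_affine (nak_mult lam g)"
    by (simp add: complex_affine_def nak_mult_def vec3_eq_iff algebra_simps)
  show "complex_affine N_to_tangent" "complex_affine N_from_tangent"
    by (simp_all add: complex_affine_def N_to_tangent_def N_from_tangent_def vec3_eq_iff)
  assume "h \<in> tangent_translations"
  then obtain c where "h = (\<lambda>\<zeta>. \<zeta> + c)" by blast
  then show "complex_affine h" by (simp add: complex_affine_def)
qed

lemma N_group_complex_affine: "g \<in> N_group \<Longrightarrow> complex_affine g"
  using complex_affine_maps(1) by blast

lemma biholomorphism_chart:
  assumes V: "good V"
  shows "biholomorphism (N_dom V)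
     (N_model V) (N_triv V)"
  using V by (intro biholomorphism_trivialise[OF N_restriction] complex_affine_maps N_group_complex_affine) auto

lemma N_forms_chart:
  assumes V: "good V"
  shows "is_pullback (N_dom V)
      (N_model V) (N_triv V)
      (descend holomorphic_volume) (descend (N_Omega lam))"
    "is_pullback (N_dom V)
      (N_model V) (N_triv V)
      (descend (tangent_omega lam)) (descend (N_omega lam))"
proof -
  interpret R: orbit_restriction N_group tangent_translations N_to_tangent N_from_tangent "im_vec -` V"
    "N_fibration -` (base_orbit ` V)" using V by (intro N_restriction) auto
  have vol: "pullback h holomorphic_volume = holomorphic_volume" if h: "h \<in> tangent_translations" for h
  proof -
    obtain c where "h = (\<lambda>\<zeta>. \<zeta> + c)" using h by blast
    then show ?thesis by (simp only: holomorphic_volume_translation)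
  qed
  have omega: "pullback N_to_tangent (tangent_omega lam) = N_omega lam"
    unfolding tangent_omega_def
    by (rule pullback_inverse[OF affine_N_to_tangent affine_N_from_tangent N_tangent_inverse(1)])
  show "is_pullback R.source R.target R.trivialise (descend holomorphic_volume) (descend (N_Omega lam))"
    by (rule R.is_pullback_trivialise[OF vol N_group_form_invariant[OF N_Omega_invariant] N_Omega_pullback])
  show "is_pullback R.source R.target R.trivialise (descend (tangent_omega lam)) (descend (N_omega lam))"
    by (rule R.is_pullback_trivialise[OF tangent_translation_form_invariant[OF tangent_omega_invariant]
          N_group_form_invariant[OF N_omega_invariant] omega])
qed

lemma semi_flat_chart_over:
  assumes V: "good V"
  shows "is_semi_flat_chart B_atlas
    N_atlas N_fibration (descend (N_Omega lam))
    M_atlas M_fibration (descend M_omega) (chart_over V)"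
  unfolding is_semi_flat_chart_def sf_image_chart_over[OF V] sf_tan_model_chart_over[OF V]
    sf_cot_model_chart_over[OF V] unfolding chart_over_simps
proof (intro conjI ballI)
  show "manifold_open B_atlas (base_orbit ` V)"
    unfolding manifold_open_quotient_iff[OF base_group]
    using open_orbit_preimage[OF base_group(1)] V by blast
  show "open V" using V by blast
  show "diffeomorphism (open_submanifold B_atlas (base_orbit ` V)) (euclidean_atlas V)
      (inv_into V base_orbit)"
    using V by (intro diffeomorphism_orbit_chart base_group) auto
  show "invertible (torus_lattice tau P)" by (rule invertible_torus_lattice[OF tau P])
next
  fix x z assume x: "x \<in> carrier_of M_atlas \<inter> M_fibration -` (base_orbit ` V)"
    and z: "z \<in> M_triv V x"
  have "fst z = inv_into V base_orbit (M_fibration x)"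
    unfolding M_fibration_eq
    by (rule torus_fibration.base_of_trivialisation[OF M_torus_fibration]) (use V x z in auto)
  then show "case z of (r, \<theta>) \<Rightarrow> r = inv_into V base_orbit (M_fibration x)" by (cases z) simp
next
  fix y z assume y: "y \<in> carrier_of N_atlas \<inter> N_fibration -` (base_orbit ` V)"
    and z: "z \<in> N_triv V y"
  show "im_vec z = inv_into V base_orbit (N_fibration y)"
    unfolding N_fibration_eq
    by (rule torus_fibration.base_of_trivialisation[OF N_torus_fibration]) (use V y z in auto)
qed (rule symplectomorphism_chart[OF V] biholomorphism_chart[OF V] N_forms_chart(1)[OF V])+

text \<open>The change of base coordinates is a deck transformation of \<open>B\<close> with translation vector \<open>(a, P b)\<close>. It is
  covered by a deck transformation of \<open>N\<close> without translation in the fibres, and this takes \<open>\<zeta>\<close> to the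
  required point of the same orbit.\<close>

lemma chart_transitions:
  assumes V: "good V" and V': "good V'"
    and y: "y \<in> carrier_of N_atlas"
      "N_fibration y \<in> base_orbit ` V" "N_fibration y \<in> base_orbit ` V'"
    and \<zeta>: "\<zeta> \<in> N_triv V y"
  shows "\<exists>\<zeta>'\<in>N_triv V' y. re_vec \<zeta>' =
     frechet_derivative (coord_rep (base_orbit ` V) (inv_into V base_orbit) (inv_into V' base_orbit) (\<lambda>b. b))
       (at (inv_into V base_orbit (N_fibration y))) (re_vec \<zeta>)"
proof -
  have UV: "(base_orbit ` V, inv_into V base_orbit) \<in> B_atlas"
    "(base_orbit ` V', inv_into V' base_orbit) \<in> B_atlas"
    using V V' unfolding quotient_atlas_def by blast+
  let ?D = "frechet_derivative (coord_rep (base_orbit ` V) (inv_into V base_orbit) (inv_into V' base_orbit) (\<lambda>b. b))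
       (at (inv_into V base_orbit (N_fibration y)))"
  have r: "im_vec \<zeta> = inv_into V base_orbit (N_fibration y)"
    unfolding N_fibration_eq
    by (rule torus_fibration.base_of_trivialisation[OF N_torus_fibration]) (use V y(1) \<zeta> in auto)
  have deck: "deck_maps base_orbit UNIV base_group"
    by (rule deck_maps_orbit_of[OF base_group(1)]) auto
  obtain g h where g: "g \<in> base_group" "h \<in> {id}"
    "inv_into V' base_orbit (N_fibration y) = g (h (inv_into V base_orbit (N_fibration y)))"
    "\<And>v. ?D v = g (h v) - g (h 0)"
  proof (rule coord_rep_lift_derivative[OF section_atlas_quotient section_atlas_quotient deck
        lifts_to_identity[of "{id}", OF singletonI] UV y(2,3)])
    fix g h
    assume "g \<in> base_group" "h \<in> {id}"
      "inv_into V' base_orbit (N_fibration y) = g (h (inv_into V base_orbit (N_fibration y)))"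
      "\<And>v. ?D v = g (h v) - g (h 0)"
    then show thesis by (rule that)
  qed
  obtain a b where ab: "a \<in> \<int>" "integral_vec b" "g = base_act lam P a b" using g(1) by (rule base_groupE)
  let ?g = "N_deck a 0 0 b"
  have gN: "?g \<in> N_group" using ab by (intro nak_groupI) auto
  obtain p where p: "p \<in> y" "\<zeta> = N_to_tangent p" using \<zeta> by blast
  obtain p0 where "y = orbit_of N_group p0" using y(1) carrier_quotient_atlas[OF N_group open_UNIV] by blast
  then have yp: "y = orbit_of N_group p" using p(1) orbit_of_mem_iff[OF N_group(1)] by blast
  have gp: "?g p \<in> y" unfolding yp orbit_of_def by (rule imageI[OF gN])
  let ?\<zeta>' = "N_to_tangent (?g p)"
  have zero: "base_vec P (tau * - 0) 0 = 0" by (simp add: base_vec_zero)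
  have \<zeta>': "?\<zeta>' = tangent_act (hyp_vec lam a) (base_vec P a b) 0 \<zeta>"
    unfolding N_act zero p(2) ..
  have "im_vec ?\<zeta>' = g (im_vec \<zeta>)"
    unfolding \<zeta>' im_tangent_act ab(3) base_act_eq ..
  also have "\<dots> = inv_into V' base_orbit (N_fibration y)" using g(2,3) r by simp
  also have "\<dots> \<in> V'" using y(3) by (rule inv_into_into)
  finally have "?\<zeta>' \<in> N_triv V' y" using gp by blast
  moreover have "re_vec ?\<zeta>' = ?D (re_vec \<zeta>)"
    using g(2) unfolding g(4) ab(3) base_act_eq \<zeta>' by (simp add: tangent_act_def vec3_eq_iff)
  ultimately show ?thesis by blast
qed

text \<open>In coordinates the derivative is \<open>v \<mapsto> D (x, x\<^sub>1, x\<^sub>2)\<close> with \<open>D\<close> an invertible diagonal matrix. So its kernel is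
  the space of purely imaginary vectors, on which \<open>M_omega\<close> vanishes.\<close>

lemma lagrangian_fibration_M:
  "lagrangian_fibration M_atlas (descend M_omega) B_atlas M_fibration"
  unfolding lagrangian_fibration_def
proof (intro conjI)
  note M = torus_fibration.smooth_map_fibration[OF M_torus_fibration, folded M_fibration_eq]
    torus_fibration.fibration_carrier[OF M_torus_fibration, folded M_fibration_eq]
    torus_fibration.fibration_lifts[OF M_torus_fibration, folded M_fibration_eq]
  show "smooth_map M_atlas B_atlas M_fibration" by (rule M(1))
  show "M_fibration ` carrier_of M_atlas = carrier_of B_atlas"
    by (rule M(2))
  show "DIM(complex ^ 3) = 2 * DIM(real ^ 3)" by simp
  have deck: "deck_maps base_orbit UNIV base_group"
    by (rule deck_maps_orbit_of[OF base_group(1)]) auto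
  have main: "surj D \<and> (\<forall>u v. D u = 0 \<and> D v = 0 \<longrightarrow> descend M_omega \<phi> x [u, v] = 0)"
    if UV: "(U, \<phi>) \<in> M_atlas" "(V, \<psi>) \<in> B_atlas"
      "x \<in> U" "M_fibration x \<in> V" and D: "D = frechet_derivative (coord_rep U \<phi> \<psi> M_fibration) (at (\<phi> x))"
    for U \<phi> V \<psi> x D
  proof -
    obtain g h where g: "g \<in> base_group" "h \<in> {fst \<circ> M_to_cotangent}" "\<And>v. D v = g (h v) - g (h 0)"
    proof (rule coord_rep_lift_derivative[OF section_atlas_quotient section_atlas_quotient deck M(3) UV(1-4)])
      fix g h
      assume gh: "g \<in> base_group" "h \<in> {fst \<circ> M_to_cotangent}"
        and D': "\<And>v. frechet_derivative (coord_rep U \<phi> \<psi> M_fibration) (at (\<phi> x)) v = g (h v) - g (h 0)"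
      have "D v = g (h v) - g (h 0)" for v unfolding D by (rule D')
      with gh show thesis by (rule that)
    qed
    obtain a b where ab: "g = base_act lam P a b" using g(1) by (rule base_groupE)
    have Dv: "D v = diag_act (hyp_vec lam a) (fst (M_to_cotangent v))" for v
      using g(2) unfolding g(3) ab base_act_eq by (simp add: M_to_cotangent_def vec3_eq_iff)
    have "surj D"
    proof (rule surjI)
      fix w
      show "D (M_from_cotangent (diag_act (inv_vec (hyp_vec lam a)) w, 0)) = w"
        unfolding Dv M_cotangent_inverse using hyp_vec_nonzero by (simp add: vec_eq_iff inv_vec_def)
    qed
    moreover have ker: "Re (u $ k) = 0" if "D u = 0" for u k
    proof -
      have "fst (M_to_cotangent u) $ k = 0" using that hyp_vec_nonzero unfolding Dv by (simp add: vec_eq_iff)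
      then show ?thesis using index_3_cases[of k] by (auto simp: M_to_cotangent_def)
    qed
    ultimately show ?thesis by (auto simp: descend_def M_omega_explicit ker)
  qed
  show "\<forall>(U, \<phi>)\<in>M_atlas. \<forall>(V, \<psi>)\<in>B_atlas. \<forall>x \<in> U \<inter> M_fibration -` V.
        surj (frechet_derivative (coord_rep U \<phi> \<psi> M_fibration) (at (\<phi> x))) \<and>
        (\<forall>u v. frechet_derivative (coord_rep U \<phi> \<psi> M_fibration) (at (\<phi> x)) u = 0 \<and>
               frechet_derivative (coord_rep U \<phi> \<psi> M_fibration) (at (\<phi> x)) v = 0 \<longrightarrow> descend M_omega \<phi> x [u, v] = 0)"
    using main[OF _ _ _ _ refl] by blast
qed

lemma complex_manifold_N: "complex_manifold N_atlas"
  unfolding complex_manifold_def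
proof
  show "smooth_manifold N_atlas" by (rule smooth_manifold_quotient[OF N_group])
  show "holomorphic_map N_atlas N_atlas (\<lambda>x. x)"
    by (rule holomorphic_map_lift[OF section_atlas_quotient section_atlas_quotient
          deck_maps_orbit_of[OF N_group(1)] lifts_to_identity[of N_group]])
      (use affine_groupD(2)[OF N_group(1)] N_group_complex_affine in auto)
qed

lemma nak_base_quotient: "nak_base lam P = B_atlas"
  by (simp only: nak_base_def)

theorem semi_flat_family_nakamura:
  "semi_flat_family (nak_base lam P) (N_manifold lam tau P) N_fibration (descend (N_Omega lam))
     (M_manifold lam tau P) M_fibration (descend M_omega) (chart_over ` {V. good V})"
  unfolding semi_flat_family_def nak_base_quotient N_manifold_quotient M_manifold_quotient
proof (intro conjI)
  show "smooth_manifold B_atlas" by (rule smooth_manifold_quotient[OF base_group])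
  show "symplectic_manifold M_atlas (descend M_omega)"
    by (rule symplectic_manifold_M_quotient[OF M_group])
  show "lagrangian_fibration M_atlas (descend M_omega) B_atlas M_fibration"
    by (rule lagrangian_fibration_M)
  show "complex_manifold N_atlas" by (rule complex_manifold_N)
  show "smooth_map N_atlas B_atlas N_fibration"
    by (rule torus_fibration.smooth_map_fibration[OF N_torus_fibration, folded N_fibration_eq])
  show "N_fibration ` carrier_of N_atlas = carrier_of B_atlas"
    by (rule torus_fibration.fibration_carrier[OF N_torus_fibration, folded N_fibration_eq])
  show "differential_form N_atlas (descend (N_Omega lam))"
    by (rule differential_form_quotient[OF N_group(1) N_Omega_form N_group_form_invariant[OF N_Omega_invariant]])
  have "carrier_of B_atlas = \<Union> ((\<lambda>V. base_orbit ` V) ` {V. good V})"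
    by (rule carrier_quotient_charts)
  then show "carrier_of B_atlas = \<Union> (sf_dom ` chart_over ` {V. good V})"
    unfolding image_image chart_over_simps .
  show "\<forall>c\<in>chart_over ` {V. good V}. is_semi_flat_chart B_atlas
      N_atlas N_fibration (descend (N_Omega lam))
      M_atlas M_fibration (descend M_omega) c"
    using semi_flat_chart_over by blast
  show "dual_transitions N_atlas N_fibration (chart_over ` {V. good V})"
    unfolding dual_transitions_def
  proof (intro ballI)
    fix c c' y \<zeta>
    assume c: "c \<in> chart_over ` {V. good V}" and c': "c' \<in> chart_over ` {V. good V}"
      and y: "y \<in> carrier_of N_atlas \<inter> N_fibration -` (sf_dom c \<inter> sf_dom c')"
      and \<zeta>: "\<zeta> \<in> sf_tan c y"
    obtain V where V: "good V" "c = chart_over V" using c by blast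
    obtain V' where V': "good V'" "c' = chart_over V'" using c' by blast
    show "\<exists>\<zeta>'\<in>sf_tan c' y. re_vec \<zeta>' = frechet_derivative (coord_rep (sf_dom c) (sf_aff c) (sf_aff c') (\<lambda>b. b))
        (at (sf_aff c (N_fibration y))) (re_vec \<zeta>)"
      using y \<zeta> unfolding V(2) V'(2) chart_over_simps
      by (intro chart_transitions V(1) V'(1)) auto
  qed
qed

theorem semi_flat_mirror_triple_nakamura:
  "semi_flat_mirror_triple (nak_base lam P)
     (N_manifold lam tau P) N_fibration (descend (N_omega lam)) (descend (N_Omega lam))
     (M_manifold lam tau P) M_fibration (descend M_omega) (descend (M_Omega lam tau P))"
  unfolding semi_flat_mirror_triple_def
proof (intro conjI exI[of _ "chart_over ` {V. good V}"] ballI)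
  show "differential_form (N_manifold lam tau P) (descend (N_omega lam))"
    unfolding N_manifold_quotient
    by (rule differential_form_quotient[OF N_group(1) N_omega_form N_group_form_invariant[OF N_omega_invariant]])
  show "differential_form (M_manifold lam tau P) (descend (M_Omega lam tau P))"
    unfolding M_manifold_quotient
    by (rule differential_form_quotient[OF M_group(1) M_Omega_form M_group_form_invariant[OF M_Omega_invariant]])
  show "semi_flat_family (nak_base lam P) (N_manifold lam tau P) N_fibration (descend (N_Omega lam))
     (M_manifold lam tau P) M_fibration (descend M_omega) (chart_over ` {V. good V})"
    by (rule semi_flat_family_nakamura)
  fix c assume "c \<in> chart_over ` {V. good V}"
  then obtain V where V: "good V" "c = chart_over V" by blast
  have "is_pullback (open_submanifold (N_manifold lam tau P) (N_fibration -` sf_dom c)) (sf_tan_model c) (sf_tan c)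
      (descend (tangent_omega lam)) (descend (N_omega lam))"
    unfolding V(2) sf_tan_model_chart_over[OF V(1)] N_manifold_quotient unfolding chart_over_simps
    by (rule N_forms_chart(2)[OF V(1)])
  moreover have "is_pullback (open_submanifold (M_manifold lam tau P) (M_fibration -` sf_dom c)) (sf_cot_model c) (sf_cot c)
      (descend (fourier_mukai (sf_lat c) (fexp (fscale (\<lambda>_. 2) (tangent_omega lam))))) (descend (M_Omega lam tau P))"
    unfolding V(2) sf_cot_model_chart_over[OF V(1)] M_manifold_quotient
    unfolding chart_over_simps mirror_form_def[symmetric]
    by (rule mirror_form_chart[OF V(1)])
  ultimately show "\<exists>\<beta>. (\<forall>\<zeta> t. \<beta> (\<zeta> + complex_vec t 0) = \<beta> \<zeta>) \<and>
      is_pullback (open_submanifold (N_manifold lam tau P) (N_fibration -` sf_dom c)) (sf_tan_model c) (sf_tan c)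
        (descend \<beta>) (descend (N_omega lam)) \<and>
      is_pullback (open_submanifold (M_manifold lam tau P) (M_fibration -` sf_dom c)) (sf_cot_model c) (sf_cot c)
        (descend (fourier_mukai (sf_lat c) (fexp (fscale (\<lambda>_. 2) \<beta>)))) (descend (M_Omega lam tau P))"
    by (intro exI[of _ "tangent_omega lam"] conjI allI tangent_omega_periodic)
qed

theorem symplectomorphism_cotangent:
  "symplectomorphism (M_manifold lam tau P) (descend M_omega)
     (cotangent_quotient lam tau P) (descend canonical_symplectic) (image M_to_cotangent)"
proof -
  interpret R: orbit_restriction M_group cotangent_group M_to_cotangent M_from_cotangent UNIV UNIV
    by (rule cotangent_orbit_restriction)
  have "open_submanifold A UNIV = A" for A :: "((complex ^ 3) set, complex ^ 3) atlas" by (simp add: open_submanifold_def)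
  then have source: "M_manifold lam tau P = R.source" unfolding M_manifold_quotient by simp
  have target: "cotangent_quotient lam tau P = R.target" by (simp only: cotangent_quotient_def)
  have triv: "R.trivialise = image M_to_cotangent" by simp
  have H: "pullback h canonical_symplectic = canonical_symplectic" if "h \<in> cotangent_group" for h
    using that canonical_symplectic_hyp_invariant unfolding cotangent_group_elements by blast
  have "symplectomorphism R.source (descend M_omega) R.target (descend canonical_symplectic) R.trivialise"
    unfolding symplectomorphism_def
    by (rule conjI[OF R.diffeomorphism_trivialise
        R.is_pullback_trivialise[OF H M_group_form_invariant[OF M_omega_invariant] M_omega_pullback]])
  then show ?thesis unfolding source target triv .
qed

end

theorem theorem6p1:
  fixes lam tau :: real and M0 :: "int ^ 2 ^ 2" and P :: "real ^ 2 ^ 2"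
  assumes "lam \<noteq> 0" and "tau \<noteq> 0"
    and "det M0 = 1" and "invertible P"
    and "P ** (\<chi> i j. real_of_int (M0 $ i $ j)) ** matrix_inv P =
           vector [vector [exp lam, 0], vector [0, exp (- lam)]]"
  shows "symplectomorphism (M_manifold lam tau P) (descend M_omega)
           (cotangent_quotient lam tau P) (descend canonical_symplectic) (image M_to_cotangent)
       \<and> semi_flat_mirror_triple (nak_base lam P)
           (N_manifold lam tau P) N_fibration (descend (N_omega lam)) (descend (N_Omega lam))
           (M_manifold lam tau P) M_fibration (descend M_omega) (descend (M_Omega lam tau P))"
proof -
  let ?M = "(\<chi> i j. real_of_int (M0 $ i $ j)) :: real ^ 2 ^ 2"
  have det: "det ?M = 1"
  proof -
    have "det ?M = real_of_int (det M0)" by (simp add: det_2)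
    then show ?thesis using assms(3) by simp
  qed
  have int: "?M $ i $ j \<in> \<int>" for i j by simp
  have conj: "P ** ?M ** matrix_inv P = hyp_matrix lam" unfolding hyp_matrix_def by (rule assms(5))
  interpret nakamura lam tau P "S_matrix ** transpose (matrix_inv P)"
    by unfold_locales (use assms(2,4) invariant_lattices[OF int det assms(4) conj] in auto)
  show ?thesis using symplectomorphism_cotangent semi_flat_mirror_triple_nakamura by blast
qed

end
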